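(* There exist functions $\omega_l,\omega_u:\mathbb{N}\to\mathbb{R}$ with $\omega_l(r)=o(r)$ and $\omega_u(r)=o(r)$ as $r\to\infty$ such that the following holds. Let $G_n$ be a random $r$-regular graph on $n$ vertices and let $d=\mathrm{diam}(G_n)$. Assume $r\ge 3$, $n>\max\{\lceil r^r\rceil,\lceil r^2J/h\rceil\}$, $h>0$ and $J\ge\max\{1,\lceil h/i_e(G_n)\rceil\}$. Put $$\Gamma_l=J\Big(\frac r2-\omega_l(r)\Big)n,\qquad \Gamma_u=J\big(r f(r,\lambda)+\omega_u(r)\big)n .$$ Then, with high probability with respect to the choice of $G_n$, for all $\varepsilon>0$, $$\lim_{\beta\to\infty}\mathbb{P}_{\mathbf{-1}}\left(e^{\beta(\Gamma_l-\varepsilon)}<\tau_{\mathbf{+1}}<e^{\beta(\Gamma_u+\varepsilon)}\right)=1 .$$ Moreover, if $\eta$ is a metastable state, then the same holds with $\mathbf{-1}$ replaced by $\eta$.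
   Context: Graph. For $r\in\mathbb{N}$ and $n>r$ with $nr$ even, a random $r$-regular graph $G_n=(V_n,E_n)$, $V_n=\{1,\dots,n\}$, is chosen uniformly among all simple $r$-regular graphs on $V_n$. $d(x,y)$ is the graph distance and $\mathrm{diam}(G_n)=\max_{x,y}d(x,y)$. For $A\subset V_n$, $\partial_eA=\{(x,y)\in E_n: x\in A,\ y\notin A\}$; the Cheeger constant is $i_e(G_n)=\min_{A\subset V_n,\,1\le|A|\le n/2}|\partial_eA|/|A|$. The condition $J\ge\max\{1,\lceil h/i_e(G_n)\rceil\}$ includes $i_e(G_n)>0$, i.e. $G_n$ is connected. "With high probability" (w.h.p.): the probability over the choice of $G_n$ that the conclusion holds whenever the parameter conditions hold tends to $1$ as $n\to\infty$ (along $nr$ even). Interaction. One of two choices is made: $\mathcal{J}(i)=Jr^{1-i}$, or $\mathcal{J}(i)=Ji^{-\lambda}$, with constants $J>0$, $\lambda>2$. With $\zeta(\lambda)=\sum_{k\ge1}k^{-\lambda}$ and $d=\mathrm{diam}(G_n)$, set $f(r,\lambda)=r$ if $\mathcal{J}(i)=Jr^{1-i}$; $f(r,\lambda)=r-2$ if $\mathcal{J}(i)=Ji^{-\lambda}$ and $\lambda\ge d$; $f(r,\lambda)=\zeta(\lambda)(r-1)^d$ if $\mathcal{J}(i)=Ji^{-\lambda}$ and $\lambda<d$. Model. $\mathcal{X}=\{-1,+1\}^{V_n}$ and $H(\sigma)=-\sum_{\{x,y\}\subset V_n,\,x\ne y}\mathcal{J}(d(x,y))\sigma_x\sigma_y-h\sum_{x\in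 V_n}\sigma_x$, each unordered pair counted once. $\mathbf{+1},\mathbf{-1}$ are the configurations with all spins $+1$, respectively $-1$. Dynamics. For inverse temperature $\beta>0$, $(\sigma_t)_{t\in\mathbb{N}}$ is the Metropolis Markov chain on $\mathcal{X}$ with $p(\sigma,\eta)=q(\sigma,\eta)e^{-\beta[H(\eta)-H(\sigma)]_+}$ for $\eta\ne\sigma$, where $[\cdot]_+$ is the positive part, $q(\sigma,\eta)=1/n$ if $\eta$ is obtained from $\sigma$ by flipping exactly one spin and $0$ otherwise, and $p(\sigma,\sigma)=1-\sum_{\eta\ne\sigma}p(\sigma,\eta)$. $\mathbb{P}_\sigma$ is the law of the chain started at $\sigma$, and $\tau_{\mathbf{+1}}=\inf\{t>0:\sigma_t=\mathbf{+1}\}$. Metastable states. A path is a finite sequence of configurations in which consecutive ones differ by a single spin flip. $\Phi(\sigma,\eta)=\min_{\omega:\sigma\to\eta}\max_{\zeta\in\omega}H(\zeta)$ over paths $\omega$ from $\sigma$ to $\eta$. Let $\mathcal{I}_\sigma=\{\eta: H(\eta)<H(\sigma)\}$; the stability level is $V_\sigma=\min_{\eta\in\mathcal{I}_\sigma}\Phi(\sigma,\eta)-H(\sigma)$ ($=\infty$ if $\mathcal{I}_\sigma=\emptyset$). $\mathcal{X}^s$ is the set of global minimizers of $H$, $\Gamma=\max_{\sigma\in\mathcal{X}\setminus\mathcal{X}^s}V_\sigma$, and the metastable states are the $\sigma$ with $V_\sigma=\Gamma$. *)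

theory Defs
  imports "HOL-Probability.Probability" "HOL-Library.Landau_Symbols"
begin

text \<open>
  A graph on the vertex set $\{1,\dots,n\}$ is represented by its set of edges, each edge being a
  two-element set of vertices; multiple edges and loops are thus excluded.
\<close>

type_synonym graph = "nat set set"

definition vertices :: "nat \<Rightarrow> nat set" where
  "vertices n = {1..n}"

definition regular_graphs :: "nat \<Rightarrow> nat \<Rightarrow> graph set" where
  "regular_graphs n r =
     {G. G \<subseteq> {{x, y} | x y. x \<in> vertices n \<and> y \<in> vertices n \<and> x \<noteq> y} \<and>
         (\<forall>x\<in>vertices n. card {y \<in> vertices n. {x, y} \<in> G} = r)}"

definition random_regular_graph :: "nat \<Rightarrow> nat \<Rightarrow> graph pmf" where
  "random_regular_graph n r = pmf_of_set (regular_graphs n r)"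

text \<open>
  For vertices in different components the value is unspecified. This is harmless wherever the
  Cheeger constant is assumed to be positive, which forces the graph to be connected.
\<close>

definition graph_dist :: "graph \<Rightarrow> nat \<Rightarrow> nat \<Rightarrow> nat" where
  "graph_dist G x y = (LEAST k. (x, y) \<in> {(u, v). {u, v} \<in> G} ^^ k)"

definition graph_diam :: "nat \<Rightarrow> graph \<Rightarrow> nat" where
  "graph_diam n G = Max {graph_dist G x y | x y. x \<in> vertices n \<and> y \<in> vertices n}"

definition edge_boundary :: "nat \<Rightarrow> graph \<Rightarrow> nat set \<Rightarrow> (nat \<times> nat) set" where
  "edge_boundary n G A = {(x, y). {x, y} \<in> G \<and> x \<in> A \<and> y \<in> vertices n - A}"

definition cheeger :: "nat \<Rightarrow> graph \<Rightarrow> real" where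
  "cheeger n G =
     Min {real (card (edge_boundary n G A)) / real (card A) | A.
            A \<subseteq> vertices n \<and> 1 \<le> card A \<and> real (card A) \<le> real n / 2}"

datatype interaction = Exponential | Polynomial real

fun admissible :: "interaction \<Rightarrow> bool" where
  "admissible Exponential \<longleftrightarrow> True"
| "admissible (Polynomial l) \<longleftrightarrow> l > 2"

fun coupling :: "interaction \<Rightarrow> nat \<Rightarrow> real \<Rightarrow> nat \<Rightarrow> real" where
  "coupling Exponential r J i = J * real r powr (1 - real i)"
| "coupling (Polynomial l) r J i = J * real i powr (- l)"

definition zeta_series :: "real \<Rightarrow> real" where
  "zeta_series l = (\<Sum>k. real (Suc k) powr (- l))"

fun f_bound :: "interaction \<Rightarrow> nat \<Rightarrow> nat \<Rightarrow> real" where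
  "f_bound Exponential r d = real r"
| "f_bound (Polynomial l) r d =
     (if l \<ge> real d then real r - 2 else zeta_series l * (real r - 1) ^ d)"

type_synonym config = "nat \<Rightarrow> int"

text \<open>Configurations are extensional functions, i.e.\ \<open>undefined\<close> outside the vertex set.\<close>

definition configs :: "nat \<Rightarrow> config set" where
  "configs n = (\<Pi>\<^sub>E x\<in>vertices n. {-1, 1})"

definition all_plus :: "nat \<Rightarrow> config" where
  "all_plus n = (\<lambda>x\<in>vertices n. 1)"

definition all_minus :: "nat \<Rightarrow> config" where
  "all_minus n = (\<lambda>x\<in>vertices n. -1)"

text \<open>The condition \<open>x < y\<close> selects every unordered pair of distinct vertices once.\<close>

definition hamiltonian ::
    "interaction \<Rightarrow> nat \<Rightarrow> real \<Rightarrow> real \<Rightarrow> nat \<Rightarrow> graph \<Rightarrow> config \<Rightarrow> real" where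
  "hamiltonian I r J h n G s =
     - (\<Sum>(x, y) \<in> {(x, y). x \<in> vertices n \<and> y \<in> vertices n \<and> x < y}.
          coupling I r J (graph_dist G x y) * of_int (s x) * of_int (s y))
     - h * (\<Sum>x\<in>vertices n. of_int (s x))"

definition single_flip :: "nat \<Rightarrow> config \<Rightarrow> config \<Rightarrow> bool" where
  "single_flip n s t \<longleftrightarrow> card {x \<in> vertices n. s x \<noteq> t x} = 1"

definition proposal :: "nat \<Rightarrow> config \<Rightarrow> config \<Rightarrow> real" where
  "proposal n s t = (if single_flip n s t then 1 / real n else 0)"

definition metropolis_move :: "nat \<Rightarrow> (config \<Rightarrow> real) \<Rightarrow> real \<Rightarrow> config \<Rightarrow> config \<Rightarrow> real" where
  "metropolis_move n H \<beta> s t = proposal n s t * exp (- \<beta> * max 0 (H t - H s))"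

definition metropolis :: "nat \<Rightarrow> (config \<Rightarrow> real) \<Rightarrow> real \<Rightarrow> config \<Rightarrow> config \<Rightarrow> real" where
  "metropolis n H \<beta> s t =
     (if t = s then 1 - (\<Sum>u \<in> configs n - {s}. metropolis_move n H \<beta> s u)
      else metropolis_move n H \<beta> s t)"

text \<open>
  The conditional law of the state at time \<open>i\<close> given the trajectory \<open>w\<close> up to time \<open>i - 1\<close>, for the
  chain started at \<open>s\<close>; the law of the whole trajectory is the resulting Ionescu-Tulcea measure on
  the product space.
\<close>

definition metropolis_kernel ::
    "nat \<Rightarrow> (config \<Rightarrow> real) \<Rightarrow> real \<Rightarrow> config \<Rightarrow> nat \<Rightarrow> (nat \<Rightarrow> config) \<Rightarrow> config measure" where
  "metropolis_kernel n H \<beta> s i w =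
     (case i of 0 \<Rightarrow> return (count_space (configs n)) s
      | Suc k \<Rightarrow> point_measure (configs n) (\<lambda>t. ennreal (metropolis n H \<beta> (w k) t)))"

definition metropolis_law ::
    "nat \<Rightarrow> (config \<Rightarrow> real) \<Rightarrow> real \<Rightarrow> config \<Rightarrow> (nat \<Rightarrow> config) measure" where
  "metropolis_law n H \<beta> s =
     projective_family.lim UNIV
       (Ionescu_Tulcea.CI (metropolis_kernel n H \<beta> s) (\<lambda>_. count_space (configs n)))
       (\<lambda>_. count_space (configs n))"

definition hitting_time :: "config \<Rightarrow> (nat \<Rightarrow> config) \<Rightarrow> enat" where
  "hitting_time t w = Inf (enat ` {k. 0 < k \<and> w k = t})"

definition is_path :: "nat \<Rightarrow> config \<Rightarrow> config \<Rightarrow> config list \<Rightarrow> bool" where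
  "is_path n s t p \<longleftrightarrow>
     p \<noteq> [] \<and> set p \<subseteq> configs n \<and> hd p = s \<and> last p = t \<and>
     (\<forall>i. Suc i < length p \<longrightarrow> single_flip n (p ! i) (p ! Suc i))"

definition comm_height :: "nat \<Rightarrow> (config \<Rightarrow> real) \<Rightarrow> config \<Rightarrow> config \<Rightarrow> real" where
  "comm_height n H s t = Min {Max (H ` set p) | p. is_path n s t p}"

definition lower_states :: "nat \<Rightarrow> (config \<Rightarrow> real) \<Rightarrow> config \<Rightarrow> config set" where
  "lower_states n H s = {t \<in> configs n. H t < H s}"

definition stability_level :: "nat \<Rightarrow> (config \<Rightarrow> real) \<Rightarrow> config \<Rightarrow> ereal" where
  "stability_level n H s =
     (if lower_states n H s = {} then \<infinity>
      else ereal (Min (comm_height n H s ` lower_states n H s) - H s))"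

definition stable_states :: "nat \<Rightarrow> (config \<Rightarrow> real) \<Rightarrow> config set" where
  "stable_states n H = {s. is_arg_min H (\<lambda>t. t \<in> configs n) s}"

definition max_stability :: "nat \<Rightarrow> (config \<Rightarrow> real) \<Rightarrow> ereal" where
  "max_stability n H = Max (stability_level n H ` (configs n - stable_states n H))"

definition metastable_states :: "nat \<Rightarrow> (config \<Rightarrow> real) \<Rightarrow> config set" where
  "metastable_states n H = {s \<in> configs n. stability_level n H s = max_stability n H}"

lemma finite_configs: "finite (configs n)"
  by (auto simp: configs_def vertices_def intro!: finite_PiE)

lemma card_single_flips:
  assumes "s \<in> configs n"
  shows "card {t \<in> configs n. single_flip n s t} \<le> n"
proof -
  have "{t \<in> configs n. single_flip n s t} \<subseteq> (\<lambda>x. s(x := - s x)) ` vertices n"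
  proof
    fix t assume t: "t \<in> {t \<in> configs n. single_flip n s t}"
    then obtain x where x: "{x \<in> vertices n. s x \<noteq> t x} = {x}"
      by (auto simp: single_flip_def card_1_singleton_iff)
    have "t = s(x := - s x)"
    proof
      fix y
      have y: "y \<in> vertices n \<and> s y \<noteq> t y \<longleftrightarrow> y = x"
        using x by blast
      show "t y = (s(x := - s x)) y"
      proof (cases "y \<in> vertices n")
        case True
        then have "s y = -1 \<or> s y = 1" "t y = -1 \<or> t y = 1"
          using assms t by (auto simp: configs_def PiE_iff)
        then show ?thesis using y True by auto
      next
        case False
        then have "s y = undefined" "t y = undefined" "y \<noteq> x"
          using assms t x by (auto simp: configs_def PiE_iff extensional_def)
        then show ?thesis by simp
      qed
    qed
    then show "t \<in> (\<lambda>x. s(x := - s x)) ` vertices n"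
      using x by blast
  qed
  then have "card {t \<in> configs n. single_flip n s t} \<le> card (vertices n)"
    by (intro surj_card_le) (auto simp: vertices_def)
  then show ?thesis by (simp add: vertices_def)
qed

lemma metropolis_nonneg:
  assumes "s \<in> configs n" "\<beta> \<ge> 0"
  shows "0 \<le> metropolis n H \<beta> s t"
proof -
  have "(\<Sum>u \<in> configs n - {s}. metropolis_move n H \<beta> s u) \<le> (\<Sum>u \<in> configs n - {s}. proposal n s u)"
    unfolding metropolis_move_def
    by (intro sum_mono mult_right_le_one_le) (auto simp: proposal_def assms)
  also have "\<dots> \<le> (\<Sum>u \<in> configs n. proposal n s u)"
    by (intro sum_mono2) (auto simp: finite_configs proposal_def)
  also have "\<dots> = real (card {t \<in> configs n. single_flip n s t}) / real n"
    by (simp add: proposal_def finite_configs sum.If_cases Int_def)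
  also have "\<dots> \<le> 1"
    using card_single_flips[OF assms(1)] by (cases "n = 0") auto
  finally show ?thesis
    by (auto simp: metropolis_def metropolis_move_def proposal_def)
qed

lemma metropolis_sum:
  assumes "s \<in> configs n"
  shows "(\<Sum>t \<in> configs n. metropolis n H \<beta> s t) = 1"
  using assms by (subst sum.remove[of _ s]) (auto simp: finite_configs metropolis_def)

lemma Ionescu_Tulcea_metropolis:
  assumes s: "s \<in> configs n" and "\<beta> \<ge> 0"
  shows "Ionescu_Tulcea (metropolis_kernel n H \<beta> s) (\<lambda>_. count_space (configs n))"
proof (rule Ionescu_Tulcea.intro)
  let ?M = "\<lambda>_::nat. count_space (configs n)"
  have prob: "prob_space (point_measure (configs n) (\<lambda>t. ennreal (metropolis n H \<beta> u t)))"
    if "u \<in> configs n" for u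
    using that assms metropolis_sum[OF that, of H \<beta>]
    by (intro prob_spaceI)
       (simp add: emeasure_point_measure_finite finite_configs space_point_measure
          sum_ennreal metropolis_nonneg)
  fix i
  show "prob_space (metropolis_kernel n H \<beta> s i x)" if "x \<in> space (PiM {0..<i} ?M)" for x
    using that s by (cases i)
      (auto simp: metropolis_kernel_def space_PiM intro!: prob_space_return prob)
  have return_in_subprob: "return (count_space (configs n)) s
      \<in> space (subprob_algebra (count_space (configs n)))"
    using s by (auto simp: space_subprob_algebra
        intro!: prob_space_imp_subprob_space prob_space_return)
  show "metropolis_kernel n H \<beta> s i \<in> measurable (PiM {0..<i} ?M) (subprob_algebra (count_space (configs n)))"
  proof (cases i)
    case 0
    then show ?thesis
      using s by (simp add: metropolis_kernel_def[abs_def] return_in_subprob)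
  next
    case (Suc k)
    have "(\<lambda>u. point_measure (configs n) (\<lambda>t. ennreal (metropolis n H \<beta> u t)))
        \<in> measurable (count_space (configs n)) (subprob_algebra (count_space (configs n)))"
      using prob by (auto simp: space_subprob_algebra sets_point_measure
          intro!: prob_space_imp_subprob_space)
    moreover have "(\<lambda>w. w k) \<in> measurable (PiM {0..<i} ?M) (count_space (configs n))"
      using Suc by (intro measurable_component_singleton) auto
    ultimately show ?thesis
      unfolding metropolis_kernel_def Suc nat.case by (rule measurable_compose[rotated])
  qed
qed

lemma metropolis_law_cylinder:
  assumes s: "s \<in> configs n" and \<beta>: "\<beta> \<ge> 0" and w: "\<And>i. w i \<in> configs n"
  shows "emeasure (metropolis_law n H \<beta> s) {v \<in> space (metropolis_law n H \<beta> s). \<forall>i\<le>k. v i = w i}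
    = (if w 0 = s then \<Prod>i<k. ennreal (metropolis n H \<beta> (w i) (w (Suc i))) else 0)"
proof -
  let ?M = "\<lambda>_::nat. count_space (configs n)"
  let ?P = "metropolis_kernel n H \<beta> s"
  interpret IT: Ionescu_Tulcea ?P ?M
    by (rule Ionescu_Tulcea_metropolis) fact+
  let ?w = "\<lambda>m. restrict w {0..<m}"
  have w_space: "?w m \<in> space (PiM {0..<m} ?M)" for m
    using w by (auto simp: space_PiM)
  have sing: "{?w m} \<in> sets (PiM {0..<m} ?M)" for m
  proof -
    have "{?w m} = PiE {0..<m} (\<lambda>i. {w i})"
      by (auto simp: PiE_iff extensional_def fun_eq_iff)
    also have "\<dots> \<in> sets (PiM {0..<m} ?M)"
      using w by (intro sets_PiM_I_finite) auto
    finally show ?thesis .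
  qed
  have step: "emeasure (IT.C 0 (Suc m) (\<lambda>_. undefined)) {?w (Suc m)} =
      emeasure (?P m (?w m)) {w m} * emeasure (IT.C 0 m (\<lambda>_. undefined)) {?w m}" for m
  proof -
    have u: "(\<lambda>_. undefined) \<in> space (PiM {0..<0} ?M)" by (simp add: space_PiM)
    have sp: "space (IT.C 0 m (\<lambda>_. undefined)) = space (PiM {0..<m} ?M)"
      using IT.space_C[OF u, of m] by simp
    have st: "sets (IT.C 0 m (\<lambda>_. undefined)) = sets (PiM {0..<m} ?M)"
      using IT.sets_C[OF u, of m] by simp
    have eP: "emeasure (IT.eP m v) {?w (Suc m)} = emeasure (?P m (?w m)) {w m} * indicator {?w m} v"
      if v: "v \<in> space (PiM {0..<m} ?M)" for v
    proof -
      have v_ext: "v i = undefined" if "\<not> i < m" for i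
        using v that by (auto simp: space_PiM PiE_iff extensional_def)
      have eq: "v(m := x) = ?w (Suc m) \<longleftrightarrow> v = ?w m \<and> x = w m" for x
      proof
        assume "v(m := x) = ?w (Suc m)"
        then have *: "(v(m := x)) i = ?w (Suc m) i" for i by simp
        have "v i = ?w m i" for i
          using *[of i] v_ext[of i] by (cases "i < m") auto
        moreover have "x = w m" using *[of m] by simp
        ultimately show "v = ?w m \<and> x = w m" by blast
      qed (auto simp: fun_eq_iff restrict_def less_Suc_eq)
      have pre: "fun_upd v m -` {?w (Suc m)} \<inter> space (count_space (configs n)) =
          (if v = ?w m then {w m} else {})"
        using w[of m] by (auto simp: vimage_def eq simp del: fun_upd_apply)
      have "emeasure (IT.eP m v) {?w (Suc m)} = emeasure (?P m v) (if v = ?w m then {w m} else {})"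
        unfolding pre[symmetric] by (rule IT.emeasure_eP[OF v sing])
      then show ?thesis
        by (cases "v = ?w m") (simp_all only: if_True if_False indicator_simps singleton_iff
            emeasure_empty mult_1_right mult_zero_right simp_thms)
    qed
    have "emeasure (IT.C 0 (Suc m) (\<lambda>_. undefined)) {?w (Suc m)} =
        (\<integral>\<^sup>+v. emeasure (IT.eP m v) {?w (Suc m)} \<partial>IT.C 0 m (\<lambda>_. undefined))"
      using IT.measurable_eP[of m] w_space[of m] sing[of "Suc m"]
      by (auto simp: sp intro!: emeasure_bind[where N = "PiM {0..<Suc m} ?M"]
          cong: measurable_cong_sets[OF st refl])
    also have "\<dots> = (\<integral>\<^sup>+v. emeasure (?P m (?w m)) {w m} * indicator {?w m} v
        \<partial>IT.C 0 m (\<lambda>_. undefined))"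
      by (intro nn_integral_cong eP) (simp add: sp)
    also have "\<dots> = emeasure (?P m (?w m)) {w m} * emeasure (IT.C 0 m (\<lambda>_. undefined)) {?w m}"
      by (intro nn_integral_cmult_indicator) (simp add: st sing)
    finally show ?thesis .
  qed
  have P0: "emeasure (?P 0 v) {w 0} = (if w 0 = s then 1 else 0)" for v
    using s w by (auto simp: metropolis_kernel_def)
  have PSuc: "emeasure (?P (Suc m) (?w (Suc m))) {w (Suc m)} =
      ennreal (metropolis n H \<beta> (w m) (w (Suc m)))" for m
    using w by (simp add: metropolis_kernel_def emeasure_point_measure_finite finite_configs)
  have C: "emeasure (IT.C 0 (Suc m) (\<lambda>_. undefined)) {?w (Suc m)} =
      (if w 0 = s then \<Prod>i<m. ennreal (metropolis n H \<beta> (w i) (w (Suc i))) else 0)" for m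
  proof (induction m)
    case 0
    have "emeasure (IT.C 0 0 (\<lambda>_. undefined)) {?w 0} = 1"
      using sing[of 0] by (simp add: restrict_def emeasure_return)
    then show ?case
      by (simp only: step P0 mult_1_right lessThan_0 prod.empty)
  next
    case (Suc m)
    then show ?case
      by (simp only: step[of "Suc m"] PSuc) (simp add: mult.commute)
  qed
  have law: "metropolis_law n H \<beta> s = IT.PF.lim"
    by (simp add: metropolis_law_def)
  have "{v \<in> space (metropolis_law n H \<beta> s). \<forall>i\<le>k. v i = w i} =
      IT.PF.emb UNIV {0..<Suc k} {?w (Suc k)}"
  proof -
    have "(\<forall>i\<le>k. v i = w i) \<longleftrightarrow> restrict v {0..<Suc k} = ?w (Suc k)" for v
      unfolding restrict_def by (subst fun_eq_iff) (auto simp: less_Suc_eq_le simp del: restrict_apply)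
    then show ?thesis by (auto simp: law prod_emb_def space_PiM)
  qed
  then have "emeasure (metropolis_law n H \<beta> s) {v \<in> space (metropolis_law n H \<beta> s). \<forall>i\<le>k. v i = w i}
      = emeasure (IT.CI {0..<Suc k}) {?w (Suc k)}"
    using IT.lim[OF _ sing[of "Suc k"]] by (simp add: law)
  also have "\<dots> = emeasure (IT.C 0 (Suc k) (\<lambda>_. undefined))
      (IT.PF.emb {0..<Suc k} {0..<Suc k} {?w (Suc k)})"
    by (intro IT.emeasure_CI sing) auto
  also have "IT.PF.emb {0..<Suc k} {0..<Suc k} {?w (Suc k)} = {?w (Suc k)}"
    by (rule prod_emb_id) (use w_space in \<open>auto simp: space_PiM\<close>)
  finally show ?thesis by (simp only: C)
qed

end

theory Submission
  imports Defs "HOL-Real_Asymp.Real_Asymp"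
begin

text \<open>
  Upper bound: flipping the minus spins one after the other, every pair of vertices contributes at most once
  to the positive energy increments. Hence \<open>+1\<close> is reached within \<open>n\<close> steps with
  probability at least \<open>n\<^sup>-\<^sup>n e\<^sup>-\<^sup>\<beta>\<^sup>\<Gamma>\<close>, where
  \<open>\<Gamma>\<close> is twice the sum of all couplings; since a sphere of radius \<open>i\<close> has at
  most \<open>r (r - 1)\<^sup>i\<^sup>-\<^sup>1\<close> vertices, \<open>\<Gamma> \<le> J r f(r, \<lambda>)
  n\<close>. For fixed \<open>\<lambda>\<close> the case \<open>\<lambda> \<ge> diam\<close> disappears as
  \<open>n\<close> grows.

  Lower bound: every path from \<open>-1\<close> to a configuration of lower energy visits one with exactly
  \<open>n div 2\<close> plus spins, and so does not leave before the energy has risen by twice the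
  interaction across a bisection, minus the field. The nearest neighbour part of this interaction compensates
  the field, by the assumption on \<open>J\<close>. The rest is bounded below with high probability: a
  switching argument applied directly to the uniform measure shows that all cuts are within \<open>O(\<surd>r
  n)\<close> of their typical size, and a second one that all but a few vertices have a treelike
  neighbourhood; together they give many pairs across the bisection at distance two, or at any larger fixed
  distance. By reversibility, a state of energy \<open>\<Gamma>\<close> above the starting point has
  probability at most \<open>e\<^sup>-\<^sup>\<beta>\<^sup>\<Gamma>\<close> at any given time. A metastable
  state has at least the stability level of \<open>-1\<close>.
\<close>

section \<open>Trajectories of the Metropolis chain\<close>

text \<open>The leading term J r / 2 comes from the pairs at distance two: a bisection separates
  about n r^2 / 4 of them, each has exponential coupling J / r, and a separated pair costs twice its
  coupling. Pairs at distance one cannot be counted on, since J times the Cheeger constant may equal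
  h, and then the field uses up all that the hypothesis guarantees about them. The error J r^(3/4) n
  is a compromise. The union bound over all 2^n cuts leads to deviations of order sqrt(r) n. If a
  vertex is called poor when its degree into a large set falls short by u r, then these deviations
  allow a fraction of order r^(-1/2) / u of poor vertices. Both losses have the same order for u =
  r^(-1/4). The parameters J and h are quantified inside the event whose probability is estimated,
  so the exceptional graphs must not depend on them. Hence only cut sizes and treelike vertices are
  treated by probability; the rest holds for every graph that is good in both respects.\<close>

lemma metropolis_reversible:
  assumes "s \<in> configs n" "t \<in> configs n"
  shows "exp (- \<beta> * H s) * metropolis n H \<beta> s t = exp (- \<beta> * H t) * metropolis n H \<beta> t s"
proof (cases "s = t")
  case False
  have "single_flip n s t = single_flip n t s" by (simp add: single_flip_def eq_commute)
  moreover have "exp (- \<beta> * H s) * exp (- \<beta> * max 0 (H t - H s)) =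
      exp (- \<beta> * H t) * exp (- \<beta> * max 0 (H s - H t))"
    by (auto simp: max_def algebra_simps simp flip: exp_add)
  ultimately show ?thesis using False by (simp add: metropolis_def metropolis_move_def proposal_def)
qed simp

lemma is_path_snoc:
  assumes "is_path n s t p" "single_flip n t u" "u \<in> configs n"
  shows "is_path n s u (p @ [u])"
proof -
  have "single_flip n ((p @ [u]) ! i) ((p @ [u]) ! Suc i)" if "Suc i < length (p @ [u])" for i
  proof (cases "Suc i < length p")
    case True
    then show ?thesis using assms by (simp add: is_path_def nth_append)
  next
    case False
    with that have i: "Suc i = length p" by simp
    then have "i = length p - 1" by simp
    then have "p ! i = t" using assms by (auto simp: is_path_def last_conv_nth)
    then show ?thesis using i assms by (simp add: nth_append)
  qed
  then show ?thesis using assms by (auto simp: is_path_def)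
qed

lemma config_upd_plus:
  assumes "u \<in> configs n" "x \<in> vertices n"
  shows "u(x := 1) \<in> configs n"
  using assms by (auto simp: configs_def PiE_iff extensional_def)

lemma config_eq_all_plus_iff:
  assumes "u \<in> configs n"
  shows "u = all_plus n \<longleftrightarrow> {x \<in> vertices n. u x = -1} = {}"
proof
  assume "{x \<in> vertices n. u x = -1} = {}"
  then show "u = all_plus n"
    using assms by (intro ext) (auto simp: configs_def all_plus_def PiE_iff extensional_def)
qed (simp add: all_plus_def)

lemma metropolis_upd_ge:
  assumes u: "u \<in> configs n" "x \<in> vertices n" "u x = -1" and \<beta>: "\<beta> \<ge> 0"
    and c: "max 0 (H (u(x := 1)) - H u) \<le> c"
  shows "1 / real n * exp (- \<beta> * c) \<le> metropolis n H \<beta> u (u(x := 1))"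
proof -
  have ne: "u(x := 1) \<noteq> u" using u by (metis fun_upd_same one_neq_neg_one)
  have "{y \<in> vertices n. u y \<noteq> (u(x := 1)) y} = {x}" using u by auto
  then have "single_flip n u (u(x := 1))" by (simp add: single_flip_def)
  moreover have "exp (- \<beta> * c) \<le> exp (- \<beta> * max 0 (H (u(x := 1)) - H u))"
    using c \<beta> by (simp add: mult_left_mono)
  then have "1 / real n * exp (- \<beta> * c) \<le> 1 / real n * exp (- \<beta> * max 0 (H (u(x := 1)) - H u))"
    by (rule mult_left_mono) simp
  ultimately show ?thesis using ne by (simp add: metropolis_def metropolis_move_def proposal_def)
qed

section \<open>Hitting times expressed through trajectories\<close>

lemma hitting_time_cases:
  "(\<forall>k>0. w k \<noteq> t) \<and> hitting_time t w = \<infinity> \<or>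
   (\<exists>k>0. w k = t \<and> (\<forall>j. 0 < j \<and> w j = t \<longrightarrow> k \<le> j) \<and> hitting_time t w = enat k)"
proof (cases "\<forall>k>0. w k \<noteq> t")
  case True
  then have "{k. 0 < k \<and> w k = t} = {}" by auto
  then have "hitting_time t w = \<infinity>"
    unfolding hitting_time_def by (simp only: image_empty) (simp add: top_enat_def)
  with True show ?thesis by simp
next
  case False
  then have ex: "\<exists>k. 0 < k \<and> w k = t" by auto
  define k where "k = (LEAST k. 0 < k \<and> w k = t)"
  have k: "0 < k" "w k = t" using LeastI_ex[OF ex] by (auto simp: k_def)
  have least: "k \<le> j" if "0 < j" "w j = t" for j
    unfolding k_def using that by (intro Least_le) simp
  have "Inf (enat ` {k. 0 < k \<and> w k = t}) = enat k"
    using k least by (intro Inf_eqI) auto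
  then have "hitting_time t w = enat k" by (simp add: hitting_time_def)
  then show ?thesis using k least by auto
qed

lemma less_hitting_time_iff:
  "ereal a < ereal_of_enat (hitting_time t w) \<longleftrightarrow> (\<forall>j. 0 < j \<and> real j \<le> a \<longrightarrow> w j \<noteq> t)"
  using hitting_time_cases[of w t]
proof (elim disjE conjE exE)
  fix k assume k: "0 < k" "w k = t" "\<forall>j. 0 < j \<and> w j = t \<longrightarrow> k \<le> j" "hitting_time t w = enat k"
  have "a < real k \<longleftrightarrow> (\<forall>j. 0 < j \<and> real j \<le> a \<longrightarrow> w j \<noteq> t)"
  proof
    show "\<forall>j. 0 < j \<and> real j \<le> a \<longrightarrow> w j \<noteq> t" if "a < real k"
      using that k(3) by force
  next
    show "a < real k" if "\<forall>j. 0 < j \<and> real j \<le> a \<longrightarrow> w j \<noteq> t"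
    proof (rule ccontr)
      assume "\<not> a < real k"
      then have "real k \<le> a" by simp
      with that k(1,2) show False by blast
    qed
  qed
  then show ?thesis using k(4) by simp
qed simp

lemma hitting_time_less_iff:
  "ereal_of_enat (hitting_time t w) < ereal a \<longleftrightarrow> (\<exists>j. 0 < j \<and> real j < a \<and> w j = t)"
  using hitting_time_cases[of w t]
proof (elim disjE conjE exE)
  fix k assume k: "0 < k" "w k = t" "\<forall>j. 0 < j \<and> w j = t \<longrightarrow> k \<le> j" "hitting_time t w = enat k"
  have "real k < a \<longleftrightarrow> (\<exists>j. 0 < j \<and> real j < a \<and> w j = t)"
  proof
    show "real k < a" if "\<exists>j. 0 < j \<and> real j < a \<and> w j = t"
      using that k(3) by force
  qed (use k in blast)
  then show ?thesis using k(4) by simp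
qed auto

locale metropolis_chain =
  fixes n :: nat and H :: "config \<Rightarrow> real" and \<beta> :: real and s :: config
  assumes s: "s \<in> configs n" and \<beta>: "\<beta> \<ge> 0"
begin

abbreviation L where "L \<equiv> metropolis_law n H \<beta> s"
abbreviation P where "P \<equiv> metropolis n H \<beta>"

lemma space_metropolis_law:
  "space L = (\<Pi>\<^sub>E i\<in>UNIV. configs n)"
proof -
  interpret IT: Ionescu_Tulcea "metropolis_kernel n H \<beta> s" "\<lambda>_. count_space (configs n)"
    by (rule Ionescu_Tulcea_metropolis[OF s \<beta>])
  show ?thesis by (simp add: metropolis_law_def IT.PF.space_lim space_PiM)
qed

lemma sets_metropolis_law:
  "sets L = sets (\<Pi>\<^sub>M i\<in>UNIV. count_space (configs n))"
proof -
  interpret IT: Ionescu_Tulcea "metropolis_kernel n H \<beta> s" "\<lambda>_. count_space (configs n)"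
    by (rule Ionescu_Tulcea_metropolis[OF s \<beta>])
  show ?thesis by (simp add: metropolis_law_def IT.PF.sets_lim)
qed

lemma measurable_metropolis_law_component:
  "(\<lambda>w. w i) \<in> measurable L (count_space (configs n))"
  unfolding measurable_cong_sets[OF sets_metropolis_law refl]
  by (rule measurable_component_singleton) simp

lemma metropolis_law_state_sets:
  "{w \<in> space L. w i \<in> D} \<in> sets L"
proof -
  have "(\<lambda>w. w i) -` (D \<inter> configs n) \<inter> space L \<in> sets L"
    using measurable_metropolis_law_component by (rule measurable_sets) auto
  also have "(\<lambda>w. w i) -` (D \<inter> configs n) \<inter> space L = {w \<in> space L. w i \<in> D}"
    by (auto simp: space_metropolis_law)
  finally show ?thesis .
qed

section \<open>Finite-dimensional distributions of the chain\<close>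

definition path_prob :: "nat \<Rightarrow> (nat \<Rightarrow> config) \<Rightarrow> real" where
  "path_prob k p = (if p 0 = s then \<Prod>i<k. P (p i) (p (Suc i)) else 0)"

lemma path_prob_nonneg:
  assumes "\<And>i. i \<le> k \<Longrightarrow> p i \<in> configs n"
  shows "path_prob k p \<ge> 0"
proof -
  have "(\<Prod>i<k. P (p i) (p (Suc i))) \<ge> 0"
    by (intro prod_nonneg ballI metropolis_nonneg assms \<beta>) auto
  then show ?thesis by (simp add: path_prob_def)
qed

lemma emeasure_metropolis_law_paths:
  assumes F: "F \<subseteq> (\<Pi>\<^sub>E i\<in>{..k}. configs n)"
  shows "emeasure L {w \<in> space L. restrict w {..k} \<in> F} =
    ennreal (\<Sum>p\<in>F. path_prob k p)"
proof -
  have fin: "finite F"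
    by (rule finite_subset[OF F]) (auto intro!: finite_PiE finite_configs)
  let ?C = "\<lambda>p. {w \<in> space L. \<forall>i\<le>k. w i = p i}"
  have meas: "?C p \<in> sets L" for p
  proof -
    have "?C p = (\<Inter>i\<in>{..k}. {w \<in> space L. w i \<in> {p i}})" by auto
    also have "\<dots> \<in> sets L"
      by (intro sets.finite_INT metropolis_law_state_sets s \<beta>) auto
    finally show ?thesis .
  qed
  have eq: "{w \<in> space L. restrict w {..k} \<in> F} = (\<Union>p\<in>F. ?C p)"
  proof safe
    fix w assume "restrict w {..k} \<in> F"
    then show "w \<in> (\<Union>p\<in>F. ?C p)" if "w \<in> space L"
      using that by (intro UN_I[of "restrict w {..k}"]) auto
  next
    fix w p assume w: "w \<in> space L" "p \<in> F" "\<forall>i\<le>k. w i = p i"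
    have "restrict w {..k} = p"
    proof
      fix i show "restrict w {..k} i = p i"
        using w F by (cases "i \<le> k") (auto simp: PiE_iff extensional_def subset_eq)
    qed
    then show "restrict w {..k} \<in> F" using w by simp
  qed
  have disj: "disjoint_family_on ?C F"
  proof (unfold disjoint_family_on_def, safe)
    fix p q w assume pq: "p \<in> F" "q \<in> F" "p \<noteq> q" "\<forall>i\<le>k. w i = p i" "\<forall>i\<le>k. w i = q i"
    have "p i = q i" for i
      using pq F by (cases "i \<le> k") (auto simp: PiE_iff extensional_def subset_eq)
    with pq show "w \<in> {}" by auto
  qed
  have "emeasure L (?C p) = ennreal (path_prob k p)" if p: "p \<in> F" for p
  proof -
    \<comment> \<open>The cylinder formula wants a trajectory that lies in \<open>configs n\<close>
      at all times, whereas p is undefined beyond k; the filler s is arbitrary.\<close>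
    let ?p = "\<lambda>i. if i \<le> k then p i else s"
    have pi: "p i \<in> configs n" if "i \<le> k" for i using p F that by (auto simp: PiE_iff subset_eq)
    have C: "?C p = {w \<in> space L. \<forall>i\<le>k. w i = ?p i}" by auto
    have "emeasure L (?C p) = (if ?p 0 = s then \<Prod>i<k. ennreal (P (?p i) (?p (Suc i))) else 0)"
      unfolding C using pi s by (intro metropolis_law_cylinder s \<beta>) simp
    moreover have "(\<Prod>i<k. ennreal (P (?p i) (?p (Suc i)))) =
        (\<Prod>i<k. ennreal (P (p i) (p (Suc i))))"
      by (intro prod.cong refl) simp
    moreover have "\<dots> = ennreal (\<Prod>i<k. P (p i) (p (Suc i)))"
      by (intro prod_ennreal metropolis_nonneg pi \<beta>) simp
    ultimately show ?thesis
      by (simp add: path_prob_def)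
  qed
  then have "(\<Sum>p\<in>F. emeasure L (?C p)) = (\<Sum>p\<in>F. ennreal (path_prob k p))" by simp
  also have "\<dots> = ennreal (\<Sum>p\<in>F. path_prob k p)"
    using F \<beta> by (intro sum_ennreal path_prob_nonneg) (auto simp: PiE_iff subset_eq)
  finally have "(\<Sum>p\<in>F. emeasure L (?C p)) = ennreal (\<Sum>p\<in>F. path_prob k p)" .
  moreover have "?C ` F \<subseteq> sets L"
    by (rule image_subsetI) (rule meas)
  then have "(\<Sum>p\<in>F. emeasure L (?C p)) = emeasure L (\<Union>p\<in>F. ?C p)"
    by (rule sum_emeasure[OF _ disj fin])
  ultimately show ?thesis
    by (simp only: eq)
qed

lemma prob_space_metropolis_law:
  "prob_space L"
proof
  let ?F = "(\<Pi>\<^sub>E i\<in>{..0::nat}. configs n)"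
  have "space L = {w \<in> space L. restrict w {..0} \<in> ?F}"
    by (auto simp: space_metropolis_law)
  also have "emeasure L \<dots> = ennreal (\<Sum>p\<in>?F. path_prob 0 p)"
    by (rule emeasure_metropolis_law_paths) simp
  also have "(\<Sum>p\<in>?F. path_prob 0 p) = (\<Sum>p\<in>{\<lambda>i\<in>{..0}. s}. path_prob 0 p)"
  proof (rule sum.mono_neutral_right)
    show "\<forall>p\<in>?F - {\<lambda>i\<in>{..0}. s}. path_prob 0 p = 0"
    proof
      fix p assume p: "p \<in> ?F - {\<lambda>i\<in>{..0}. s}"
      have "p 0 \<noteq> s"
      proof
        assume "p 0 = s"
        then have "p = (\<lambda>i\<in>{..0}. s)" using p by (auto simp: PiE_iff extensional_def fun_eq_iff)
        with p show False by simp
      qed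
      then show "path_prob 0 p = 0" by (simp add: path_prob_def)
    qed
  qed (use s in \<open>auto intro!: finite_PiE finite_configs\<close>)
  also have "\<dots> = 1" by (simp add: path_prob_def)
  finally show "emeasure L (space L) = 1" by simp
qed

sublocale prob_space L by (rule prob_space_metropolis_law)

text \<open>The chain killed on entering D. Time 0 is exempt, as in the hitting time, and D = {}
  gives the ordinary law of the state at time k; both uses occur below.\<close>

definition avoid_prob :: "config set \<Rightarrow> nat \<Rightarrow> config \<Rightarrow> real" where
  "avoid_prob D k t = measure L
     {w \<in> space L. w k = t \<and> (\<forall>j. 0 < j \<and> j \<le> k \<longrightarrow> w j \<notin> D)}"

lemma avoid_prob_nonneg: "avoid_prob D k t \<ge> 0"
  by (simp add: avoid_prob_def)

lemma avoid_prob_sets: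
  "{w \<in> space L. w k = t \<and> (\<forall>j. 0 < j \<and> j \<le> k \<longrightarrow> w j \<notin> D)} \<in> sets L"
proof -
  have "{w \<in> space L. w k = t \<and> (\<forall>j. 0 < j \<and> j \<le> k \<longrightarrow> w j \<notin> D)} =
     {w \<in> space L. w k \<in> {t}} \<inter> (\<Inter>j\<in>{..k}. {w \<in> space L. w j \<in> {x. 0 < j \<longrightarrow> x \<notin> D}})"
    by (intro set_eqI) (simp, blast)
  also have "\<dots> \<in> sets L"
    by (intro sets.Int sets.finite_INT metropolis_law_state_sets s \<beta>) auto
  finally show ?thesis .
qed

lemma avoid_prob_paths:
  "avoid_prob D k t =
    (\<Sum>p | p \<in> (\<Pi>\<^sub>E i\<in>{..k}. configs n) \<and> p k = t \<and> (\<forall>j. 0 < j \<and> j \<le> k \<longrightarrow> p j \<notin> D).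
       path_prob k p)" (is "_ = sum _ ?F")
proof -
  have "{w \<in> space L. w k = t \<and> (\<forall>j. 0 < j \<and> j \<le> k \<longrightarrow> w j \<notin> D)} =
    {w \<in> space L. restrict w {..k} \<in> ?F}"
    by (auto simp: space_metropolis_law)
  then have "emeasure L {w \<in> space L. w k = t \<and> (\<forall>j. 0 < j \<and> j \<le> k \<longrightarrow> w j \<notin> D)} =
      ennreal (sum (path_prob k) ?F)"
    by (simp only:) (rule emeasure_metropolis_law_paths, auto)
  moreover have "sum (path_prob k) ?F \<ge> 0"
    using \<beta> by (intro sum_nonneg path_prob_nonneg) (auto simp: PiE_iff)
  ultimately show ?thesis by (simp add: avoid_prob_def measure_def)
qed

lemma avoid_prob_0:
  assumes t: "t \<in> configs n"
  shows "avoid_prob D 0 t = (if t = s then 1 else 0)"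
proof -
  have "{p. p \<in> (\<Pi>\<^sub>E i\<in>{..0::nat}. configs n) \<and> p 0 = t \<and> (\<forall>j. 0 < j \<and> j \<le> 0 \<longrightarrow> p j \<notin> D)} =
    {\<lambda>i\<in>{..0}. t}"
    using t by (auto simp: PiE_iff extensional_def intro!: ext)
  then show ?thesis
    unfolding avoid_prob_paths by (simp add: path_prob_def)
qed

text \<open>The Markov property of the killed chain: appending t is a bijection from the surviving
  paths of length k to those of length k + 1 that end in t.\<close>

lemma avoid_prob_Suc:
  assumes t: "t \<in> configs n"
  shows "avoid_prob D (Suc k) t =
    (if t \<in> D then 0 else \<Sum>u\<in>configs n. avoid_prob D k u * P u t)"
proof (cases "t \<in> D")
  case True
  then have "{w \<in> space L. w (Suc k) = t \<and> (\<forall>j. 0 < j \<and> j \<le> Suc k \<longrightarrow> w j \<notin> D)} = {}"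
    by auto
  then show ?thesis using True by (simp only: avoid_prob_def) simp
next
  case False
  define F where "F k u = {p. p \<in> (\<Pi>\<^sub>E i\<in>{..k}. configs n) \<and> p k = u \<and> (\<forall>j. 0 < j \<and> j \<le> k \<longrightarrow> p j \<notin> D)}"
    for k :: nat and u
  have finF: "finite (F k u)" for k u
    unfolding F_def
    by (rule finite_subset[of _ "\<Pi>\<^sub>E i\<in>{..k}. configs n"]) (auto intro!: finite_PiE finite_configs)
  have bij: "bij_betw (\<lambda>p. p(Suc k := t)) (\<Union>u\<in>configs n. F k u) (F (Suc k) t)"
  proof (rule bij_betw_byWitness[where f' = "\<lambda>p. restrict p {..k}"])
    show "\<forall>p\<in>\<Union>u\<in>configs n. F k u. restrict (p(Suc k := t)) {..k} = p"
    proof safe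
      fix p u assume p: "p \<in> F k u"
      show "restrict (p(Suc k := t)) {..k} = p"
      proof
        fix i show "restrict (p(Suc k := t)) {..k} i = p i"
          using p by (cases "i \<le> k") (auto simp: F_def PiE_iff extensional_def)
      qed
    qed
    show "\<forall>p\<in>F (Suc k) t. (restrict p {..k})(Suc k := t) = p"
    proof safe
      fix p assume p: "p \<in> F (Suc k) t"
      show "(restrict p {..k})(Suc k := t) = p"
      proof
        fix i show "((restrict p {..k})(Suc k := t)) i = p i"
          using p by (cases "i \<le> k"; cases "i = Suc k") (auto simp: F_def PiE_iff extensional_def)
      qed
    qed
    show "(\<lambda>p. p(Suc k := t)) ` (\<Union>u\<in>configs n. F k u) \<subseteq> F (Suc k) t"
      using t False by (auto simp: F_def PiE_iff extensional_def le_Suc_eq)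
    show "(\<lambda>p. restrict p {..k}) ` F (Suc k) t \<subseteq> (\<Union>u\<in>configs n. F k u)"
      by (auto simp: F_def PiE_iff)
  qed
  have pp: "path_prob (Suc k) (p(Suc k := t)) = path_prob k p * P u t"
    if "p \<in> F k u" for p u
    using that by (auto simp: path_prob_def F_def intro!: prod.cong)
  have "avoid_prob D (Suc k) t = (\<Sum>p\<in>F (Suc k) t. path_prob (Suc k) p)"
    by (simp add: avoid_prob_paths F_def)
  also have "\<dots> = (\<Sum>p\<in>(\<Union>u\<in>configs n. F k u). path_prob (Suc k) (p(Suc k := t)))"
    by (rule sum.reindex_bij_betw[OF bij, symmetric])
  also have "\<dots> = (\<Sum>u\<in>configs n. \<Sum>p\<in>F k u. path_prob (Suc k) (p(Suc k := t)))"
    by (rule sum.UNION_disjoint) (auto simp: finF finite_configs, auto simp: F_def)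
  also have "\<dots> = (\<Sum>u\<in>configs n. avoid_prob D k u * P u t)"
    by (intro sum.cong refl) (simp add: pp avoid_prob_paths sum_distrib_right flip: F_def)
  finally show ?thesis using False by simp
qed

text \<open>By reversibility the Gibbs weights, normalised to \<open>1\<close> at the starting point, form an invariant
  measure dominating the initial law, and the domination is preserved by the dynamics.\<close>

lemma avoid_prob_le_gibbs:
  assumes t: "t \<in> configs n"
  shows "avoid_prob D k t \<le> exp (- \<beta> * (H t - H s))"
  using t
proof (induction k arbitrary: t)
  case 0
  then show ?case by (simp add: avoid_prob_0)
next
  case (Suc k)
  have "avoid_prob D (Suc k) t \<le> (\<Sum>u\<in>configs n. avoid_prob D k u * P u t)"
    unfolding avoid_prob_Suc[OF Suc.prems]
    by (auto intro!: sum_nonneg mult_nonneg_nonneg avoid_prob_nonneg metropolis_nonneg \<beta>)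
  also have "\<dots> \<le> (\<Sum>u\<in>configs n. exp (- \<beta> * (H u - H s)) * P u t)"
    by (intro sum_mono mult_right_mono Suc.IH metropolis_nonneg \<beta>)
  also have "\<dots> = (\<Sum>u\<in>configs n. exp (- \<beta> * (H t - H s)) * P t u)"
  proof (intro sum.cong refl)
    have *: "exp (- \<beta> * (H v - H s)) = exp (\<beta> * H s) * exp (- \<beta> * H v)" for v
      by (simp add: algebra_simps flip: exp_add)
    fix u assume "u \<in> configs n"
    then show "exp (- \<beta> * (H u - H s)) * P u t =
        exp (- \<beta> * (H t - H s)) * P t u"
      unfolding * mult.assoc by (simp only: metropolis_reversible[OF _ Suc.prems])
  qed
  also have "\<dots> = exp (- \<beta> * (H t - H s))"
    using metropolis_sum[OF Suc.prems, of H \<beta>] by (simp flip: sum_distrib_left)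
  finally show ?case .
qed

lemma avoid_prob_full_sets:
  "{w \<in> space L. \<forall>j. 0 < j \<and> j \<le> k \<longrightarrow> w j \<notin> D} \<in> sets L"
proof -
  have "{w \<in> space L. \<forall>j. 0 < j \<and> j \<le> k \<longrightarrow> w j \<notin> D} =
     (\<Inter>j\<in>{..k}. {w \<in> space L. w j \<in> {x. 0 < j \<longrightarrow> x \<notin> D}})"
    by (intro set_eqI) (simp, blast)
  also have "\<dots> \<in> sets L"
    by (intro sets.finite_INT metropolis_law_state_sets s \<beta>) auto
  finally show ?thesis .
qed

text \<open>Mass at time k + 1 stems from some state with mass at time k and a move of positive
  probability. Such a move either stays put, leaving the path as it is, or is a flip that prolongs
  it.\<close>

lemma avoid_prob_reachable:
  assumes Hs: "H s < c" and t: "t \<in> configs n"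
    and pos: "avoid_prob {u. H u \<ge> c} k t \<noteq> 0"
  shows "\<exists>p. is_path n s t p \<and> (\<forall>x\<in>set p. H x < c)"
  using t pos
proof (induction k arbitrary: t)
  case 0
  then have "t = s" by (simp add: avoid_prob_0 split: if_splits)
  moreover have "is_path n s s [s]" using s by (simp add: is_path_def)
  ultimately show ?case using Hs by (intro exI[of _ "[s]"]) simp
next
  case (Suc k)
  let ?q = "avoid_prob {u. H u \<ge> c} k"
  have t: "H t < c"
    using Suc.prems by (auto simp: avoid_prob_Suc split: if_splits)
  then have "(\<Sum>u\<in>configs n. ?q u * P u t) \<noteq> 0"
    using Suc.prems by (auto simp: avoid_prob_Suc)
  then obtain u where u: "u \<in> configs n" "?q u * P u t \<noteq> 0"
    by (meson sum.neutral)
  then have "?q u \<noteq> 0" by simp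
  from Suc.IH[OF u(1) this]
  obtain p where p: "is_path n s u p" "\<forall>x\<in>set p. H x < c" by blast
  show ?case
  proof (cases "t = u")
    case False
    then have "single_flip n u t"
      using u by (auto simp: metropolis_def metropolis_move_def proposal_def split: if_splits)
    with p Suc.prems t show ?thesis
      by (intro exI[of _ "p @ [t]"]) (auto intro: is_path_snoc)
  qed (use p in blast)
qed

text \<open>A trajectory that reaches t has visited a state at height \<open>H s + \<Gamma>\<close>
  or above, because staying below has probability zero. The union bound over the T times and the
  configurations of that height then uses the Gibbs weight of each.\<close>

lemma prob_hit_early_le:
  assumes t: "t \<in> configs n"
    and barrier: "\<And>p. is_path n s t p \<Longrightarrow> \<exists>x\<in>set p. H x \<ge> H s + \<Gamma>"
  shows "measure L {w \<in> space L. \<exists>j. 0 < j \<and> j \<le> T \<and> w j = t}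
    \<le> real T * (real (card (configs n)) * exp (- \<beta> * \<Gamma>))" (is "measure L ?E \<le> _")
proof -
  let ?D = "{u. H u \<ge> H s + \<Gamma>}"
  let ?A = "\<lambda>j. {w \<in> space L. w j = t \<and> (\<forall>i. 0 < i \<and> i \<le> j \<longrightarrow> w i \<notin> ?D)}"
  let ?B = "\<lambda>j u. {w \<in> space L. w j = u \<and> (\<forall>i. 0 < i \<and> i \<le> j \<longrightarrow> w i \<notin> {})}"
  have card: "card (configs n) \<ge> 1"
    using s finite_configs[of n] by (simp add: Suc_le_eq card_gt_0_iff) blast
  have B: "prob (?B j u) \<le> exp (- \<beta> * \<Gamma>)" if "u \<in> configs n" "u \<in> ?D" for j u
  proof -
    have "prob (?B j u) \<le> exp (- \<beta> * (H u - H s))"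
      using avoid_prob_le_gibbs[OF that(1), of "{}" j] by (simp add: avoid_prob_def)
    also have "\<dots> \<le> exp (- \<beta> * \<Gamma>)"
      using that \<beta> by (auto simp: mult_left_mono)
    finally show ?thesis .
  qed
  show ?thesis
  \<comment> \<open>Reachability below the barrier presupposes that the start lies below it. For a
    nonpositive barrier the right-hand side is at least 1, or T = 0 and the event is empty.\<close>
  proof (cases "\<Gamma> \<le> 0")
    case True
    show ?thesis
    proof (cases "T = 0")
      case False
      have "1 * (1 * 1) \<le> real T * (real (card (configs n)) * exp (- \<beta> * \<Gamma>))"
        using False card True \<beta> by (intro mult_mono) (auto simp: mult_nonneg_nonpos)
      then show ?thesis using prob_le_1[of ?E] by linarith
    next
      case True
      have "?E = {}" unfolding True by auto
      then have "prob ?E = 0" by (simp only: measure_empty)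
      then show ?thesis by simp
    qed
  next
    case False
    have A: "prob (?A j) = 0" for j
      using avoid_prob_reachable[of "H s + \<Gamma>" t j] barrier False t
      by (force simp: avoid_prob_def)
    have sub: "?E \<subseteq> (\<Union>j\<in>{1..T}. ?A j \<union> (\<Union>u\<in>configs n \<inter> ?D. ?B j u))"
    proof
      fix w assume "w \<in> ?E"
      then obtain j where j: "w \<in> space L" "0 < j" "j \<le> T" "w j = t" by auto
      have c: "w i \<in> configs n" for i using j(1) by (auto simp: space_metropolis_law)
      show "w \<in> (\<Union>j\<in>{1..T}. ?A j \<union> (\<Union>u\<in>configs n \<inter> ?D. ?B j u))"
      proof (cases "\<forall>i. 0 < i \<and> i \<le> j \<longrightarrow> w i \<notin> ?D")
        case True
        then have "w \<in> ?A j" using j by auto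
        then show ?thesis using j by auto
      next
        case False
        then obtain i where i: "0 < i" "i \<le> j" "w i \<in> ?D" by auto
        then have "w \<in> ?B i (w i)" using j by auto
        moreover have "w i \<in> configs n \<inter> ?D" using i c by blast
        moreover have "i \<in> {1..T}" using i j by auto
        ultimately show ?thesis by blast
      qed
    qed
    have fin: "finite (configs n \<inter> ?D)" using finite_configs by blast
    have mB: "?B j u \<in> events" and mA: "?A j \<in> events" for j u
      by (rule avoid_prob_sets)+
    have "prob ?E \<le> prob (\<Union>j\<in>{1..T}. ?A j \<union> (\<Union>u\<in>configs n \<inter> ?D. ?B j u))"
      by (intro finite_measure_mono sub sets.finite_UN sets.Un mA mB fin) auto
    also have "\<dots> \<le> (\<Sum>j\<in>{1..T}. prob (?A j \<union> (\<Union>u\<in>configs n \<inter> ?D. ?B j u)))"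
      by (intro finite_measure_subadditive_finite image_subsetI sets.Un sets.finite_UN mA mB fin) auto
    also have "\<dots> \<le> (\<Sum>j\<in>{1..T}. prob (?A j) + prob (\<Union>u\<in>configs n \<inter> ?D. ?B j u))"
      by (intro sum_mono measure_Un_le sets.finite_UN mA mB fin)
    also have "\<dots> \<le> (\<Sum>j\<in>{1..T}. 0 + (\<Sum>u\<in>configs n \<inter> ?D. prob (?B j u)))"
      by (intro sum_mono add_mono finite_measure_subadditive_finite image_subsetI mB fin) (simp only: A order.refl)
    also have "\<dots> \<le> (\<Sum>j\<in>{1..T}. 0 + (\<Sum>u\<in>configs n \<inter> ?D. exp (- \<beta> * \<Gamma>)))"
      by (intro sum_mono add_mono B order.refl) auto
    also have "\<dots> = real T * (real (card (configs n \<inter> ?D)) * exp (- \<beta> * \<Gamma>))"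
      by (simp only: sum_constant card_atLeastAtMost) simp
    also have "\<dots> \<le> real T * (real (card (configs n)) * exp (- \<beta> * \<Gamma>))"
      by (intro mult_left_mono mult_right_mono of_nat_mono card_mono finite_configs) auto
    finally show ?thesis .
  qed
qed

text \<open>The probability of staying outside D at the times 1 to m from an arbitrary start u. It
  is defined by recursion because the law in this locale is tied to the start s.\<close>

primrec survival :: "config set \<Rightarrow> nat \<Rightarrow> config \<Rightarrow> real" where
  "survival D 0 u = 1"
| "survival D (Suc m) u = (\<Sum>v\<in>configs n - D. P u v * survival D m v)"

lemma survival_bounds:
  assumes "u \<in> configs n"
  shows "0 \<le> survival D m u \<and> survival D m u \<le> 1"
  using assms
proof (induction m arbitrary: u)
  case (Suc m)
  have "(\<Sum>v\<in>configs n - D. P u v * survival D m v) \<le>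
      (\<Sum>v\<in>configs n - D. P u v * 1)"
    using Suc \<beta> by (intro sum_mono mult_left_mono metropolis_nonneg) auto
  also have "\<dots> \<le> (\<Sum>v\<in>configs n. P u v)"
    using Suc.prems \<beta> by (simp, intro sum_mono2 finite_configs metropolis_nonneg) auto
  finally have "survival D (Suc m) u \<le> 1"
    using metropolis_sum[OF Suc.prems, of H \<beta>] by simp
  moreover have "survival D (Suc m) u \<ge> 0"
    using Suc \<beta> by (auto intro!: sum_nonneg mult_nonneg_nonneg metropolis_nonneg)
  ultimately show ?case by simp
qed simp

text \<open>The Markov property at time k. The induction moves one step at a time from the survival
  factor to the killed chain, by exchanging two sums.\<close>

lemma sum_avoid_prob_add:
  "(\<Sum>t\<in>configs n. avoid_prob D (k + m) t) =
    (\<Sum>t\<in>configs n. avoid_prob D k t * survival D m t)"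
proof (induction m arbitrary: k)
  case (Suc m)
  have "(\<Sum>t\<in>configs n. avoid_prob D (k + Suc m) t) =
      (\<Sum>t\<in>configs n. avoid_prob D (Suc k) t * survival D m t)"
    using Suc.IH[of "Suc k"] by simp
  also have "\<dots> = (\<Sum>t\<in>configs n. if t \<in> D then 0 else
      (\<Sum>u\<in>configs n. avoid_prob D k u * P u t) * survival D m t)"
    by (intro sum.cong refl) (simp add: avoid_prob_Suc)
  also have "\<dots> = (\<Sum>t\<in>configs n - D.
      (\<Sum>u\<in>configs n. avoid_prob D k u * P u t) * survival D m t)"
    by (rule sum.mono_neutral_cong_right) (auto simp: finite_configs)
  also have "\<dots> = (\<Sum>t\<in>configs n - D. \<Sum>u\<in>configs n.
      avoid_prob D k u * (P u t * survival D m t))"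
    by (simp add: sum_distrib_right mult.assoc)
  also have "\<dots> = (\<Sum>u\<in>configs n. \<Sum>t\<in>configs n - D.
      avoid_prob D k u * (P u t * survival D m t))"
    by (rule sum.swap)
  finally show ?case by (simp add: sum_distrib_left)
qed simp

lemma prob_avoid_eq_sum:
  "measure L {w \<in> space L. \<forall>j. 0 < j \<and> j \<le> k \<longrightarrow> w j \<notin> D} =
    (\<Sum>t\<in>configs n. avoid_prob D k t)" (is "measure L ?E = _")
proof -
  let ?A = "\<lambda>t. {w \<in> space L. w k = t \<and> (\<forall>i. 0 < i \<and> i \<le> k \<longrightarrow> w i \<notin> D)}"
  have "?E = (\<Union>t\<in>configs n. ?A t)"
    by (auto simp: space_metropolis_law)
  moreover have "prob (\<Union>t\<in>configs n. ?A t) = (\<Sum>t\<in>configs n. prob (?A t))"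
    by (intro finite_measure_finite_Union finite_configs image_subsetI avoid_prob_sets s \<beta>)
       (auto simp: disjoint_family_on_def)
  ultimately show ?thesis by (simp only: avoid_prob_def)
qed

text \<open>Time is cut into m blocks of length N. Whatever state outside D opens a block, the
  probability of getting through it without hitting D is at most 1 - p.\<close>

lemma prob_avoid_le_power:
  assumes sD: "s \<notin> D" and p1: "p \<le> 1"
    and p: "\<And>u. u \<in> configs n - D \<Longrightarrow> survival D N u \<le> 1 - p"
  shows "measure L {w \<in> space L. \<forall>j. 0 < j \<and> j \<le> m * N \<longrightarrow> w j \<notin> D} \<le> (1 - p) ^ m"
proof -
  have "(\<Sum>t\<in>configs n. avoid_prob D (m * N) t) \<le> (1 - p) ^ m"
  proof (induction m)
    case 0
    then show ?case using s sD by (simp add: avoid_prob_0 finite_configs)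
  next
    case (Suc m)
    \<comment> \<open>Because time 0 is exempt, the start itself must lie outside D for the killed
      chain to carry no mass on D.\<close>
    have zero: "avoid_prob D k t = 0" if "t \<in> configs n" "t \<in> D" for k t
      using that sD by (cases k) (auto simp: avoid_prob_0 avoid_prob_Suc)
    have "(\<Sum>t\<in>configs n. avoid_prob D (Suc m * N) t) =
       (\<Sum>t\<in>configs n. avoid_prob D (m * N) t * survival D N t)"
      using sum_avoid_prob_add[of D "m * N" N] by (simp add: add.commute)
    also have "\<dots> \<le> (\<Sum>t\<in>configs n. avoid_prob D (m * N) t * (1 - p))"
    proof (rule sum_mono)
      fix t assume t: "t \<in> configs n"
      show "avoid_prob D (m * N) t * survival D N t \<le> avoid_prob D (m * N) t * (1 - p)"
        using t p zero by (cases "t \<in> D") (auto intro: mult_left_mono avoid_prob_nonneg)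
    qed
    also have "\<dots> = (\<Sum>t\<in>configs n. avoid_prob D (m * N) t) * (1 - p)"
      by (simp add: sum_distrib_right)
    also have "\<dots> \<le> (1 - p) ^ m * (1 - p)"
      using p1 by (intro mult_right_mono Suc.IH) simp
    finally show ?case by (simp add: mult.commute)
  qed
  then show ?thesis by (simp add: prob_avoid_eq_sum)
qed

text \<open>Flipping the minus spins one after the other, the positive energy increments along this
  path are controlled by the decrements of the potential \<open>g\<close> of the set of minus spins.\<close>

lemma survival_le:
  assumes u: "u \<in> configs n" "u \<noteq> all_plus n"
    and g: "\<And>u x. u \<in> configs n \<Longrightarrow> x \<in> vertices n \<Longrightarrow> u x = -1 \<Longrightarrow>
      max 0 (H (u(x := 1)) - H u) \<le> g {y \<in> vertices n. u y = -1} - g ({y \<in> vertices n. u y = -1} - {x})"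
    and m: "card {y \<in> vertices n. u y = -1} \<le> m"
  shows "survival {all_plus n} m u \<le>
    1 - (1 / real n) ^ card {y \<in> vertices n. u y = -1} * exp (- \<beta> * (g {y \<in> vertices n. u y = -1} - g {}))"
  using u m
proof (induction m arbitrary: u)
  case 0
  have "finite {y \<in> vertices n. u y = -1}" by (simp add: vertices_def)
  with 0 show ?case using config_eq_all_plus_iff[of u n] by (simp only: card_0_eq le_zero_eq)
next
  case (Suc m)
  let ?M = "{y \<in> vertices n. u y = -1}"
  let ?S = "survival {all_plus n} m"
  have fin: "finite ?M" by (simp add: vertices_def)
  obtain x where x: "x \<in> vertices n" "u x = -1"
    using Suc.prems config_eq_all_plus_iff[of u n] by auto
  define v where "v = u(x := 1)"
  have v: "v \<in> configs n" using x Suc.prems by (simp add: v_def config_upd_plus)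
  have Mv: "{y \<in> vertices n. v y = -1} = ?M - {x}" by (auto simp: v_def)
  have cM: "card ?M = Suc (card (?M - {x}))"
    using x fin by (intro card.remove) auto
  let ?c = "g ?M - g (?M - {x})"
  have P: "1 / real n * exp (- \<beta> * ?c) \<le> P u v"
    unfolding v_def by (rule metropolis_upd_ge) (use Suc.prems x \<beta> g in auto)
  have P0: "P u w \<ge> 0" for w
    using Suc.prems \<beta> by (simp add: metropolis_nonneg)
  have S: "?S w \<le> 1" if "w \<in> configs n" for w using survival_bounds[OF that] by simp
  \<comment> \<open>The recursion omits the target, so a move into \<open>all_plus n\<close> counts
    as survival 0; this covers the last flip.\<close>
  define z where "z = (if v = all_plus n then 0 else ?S v)"
  have z: "z \<le> 1 - (1 / real n) ^ card (?M - {x}) * exp (- \<beta> * (g (?M - {x}) - g {}))"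
  proof (cases "v = all_plus n")
    case True
    then have "?M - {x} = {}" using config_eq_all_plus_iff[OF v] by (simp only: Mv)
    then show ?thesis using True unfolding z_def by (simp only:) simp
  next
    case False
    then show ?thesis
      using Suc.IH[OF v False] Suc.prems(3) cM by (simp add: Mv z_def)
  qed
  have "survival {all_plus n} (Suc m) u =
      (\<Sum>w\<in>configs n. P u w * (if w = all_plus n then 0 else ?S w))"
    unfolding survival.simps by (rule sum.mono_neutral_cong_left) (auto simp: finite_configs)
  \<comment> \<open>Only the chosen flip is followed; every other successor is bounded by 1.\<close>
  also have "\<dots> \<le> (\<Sum>w\<in>configs n. P u w * (if w = v then z else 1))"
    by (intro sum_mono mult_left_mono P0) (auto simp: z_def S)
  also have "\<dots> = (\<Sum>w\<in>configs n. P u w + (if w = v then P u w * (z - 1) else 0))"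
    by (intro sum.cong) (auto simp: algebra_simps)
  also have "\<dots> = 1 - P u v * (1 - z)"
    using v Suc.prems by (simp add: sum.distrib metropolis_sum finite_configs sum.delta algebra_simps)
  also have "\<dots> \<le> 1 - (1 / real n * exp (- \<beta> * ?c)) *
      ((1 / real n) ^ card (?M - {x}) * exp (- \<beta> * (g (?M - {x}) - g {})))"
    using P z by (intro diff_left_mono mult_mono P0) auto
  also have "\<dots> = 1 - (1 / real n) ^ card ?M * exp (- \<beta> * (g ?M - g {}))"
    unfolding cM by (simp add: algebra_simps flip: exp_add)
  finally show ?case .
qed

lemma hitting_time_sets:
  "{w \<in> space L. ereal a < ereal_of_enat (hitting_time t w) \<and>
      ereal_of_enat (hitting_time t w) < ereal b} \<in> sets L"
proof -
  have "{w \<in> space L. ereal a < ereal_of_enat (hitting_time t w) \<and> ereal_of_enat (hitting_time t w) < ereal b} =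
    (\<Inter>j. {w \<in> space L. w j \<in> {x. 0 < j \<and> real j \<le> a \<longrightarrow> x \<noteq> t}}) \<inter>
    (\<Union>j. {w \<in> space L. w j \<in> {x. 0 < j \<and> real j < b \<and> x = t}})"
    unfolding less_hitting_time_iff hitting_time_less_iff by (intro set_eqI) (simp, blast)
  also have "\<dots> \<in> sets L"
    by (intro sets.Int sets.countable_INT sets.countable_UN image_subsetI
        metropolis_law_state_sets s \<beta>) auto
  finally show ?thesis .
qed

lemma hitting_time_prob_ge:
  assumes "a \<ge> 0"
    and early: "measure L {w \<in> space L. \<exists>j. 0 < j \<and> j \<le> nat \<lfloor>a\<rfloor> \<and> w j = t} \<le> e1"
    and late: "measure L {w \<in> space L. \<forall>j. 0 < j \<and> j \<le> K \<longrightarrow> w j \<notin> {t}} \<le> e2"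
    and K: "real K < b"
  shows "measure L {w \<in> space L. ereal a < ereal_of_enat (hitting_time t w) \<and>
        ereal_of_enat (hitting_time t w) < ereal b} \<ge> 1 - e1 - e2" (is "measure L ?E \<ge> _")
proof -
  let ?A = "{w \<in> space L. \<exists>j. 0 < j \<and> j \<le> nat \<lfloor>a\<rfloor> \<and> w j = t}"
  let ?B = "{w \<in> space L. \<forall>j. 0 < j \<and> j \<le> K \<longrightarrow> w j \<notin> {t}}"
  have "?A = space L - {w \<in> space L. \<forall>j. 0 < j \<and> j \<le> nat \<lfloor>a\<rfloor> \<longrightarrow> w j \<notin> {t}}"
    by auto
  then have A: "?A \<in> events"
    by (simp only:) (intro sets.compl_sets avoid_prob_full_sets)
  have B: "?B \<in> events" by (rule avoid_prob_full_sets)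
  have sub: "space L - (?A \<union> ?B) \<subseteq> ?E"
  proof
    fix w assume w: "w \<in> space L - (?A \<union> ?B)"
    have "\<forall>j. 0 < j \<and> real j \<le> a \<longrightarrow> w j \<noteq> t"
    proof (intro allI impI)
      fix j assume j: "0 < j \<and> real j \<le> a"
      then have "j \<le> nat \<lfloor>a\<rfloor>" by (simp add: le_nat_floor)
      with w j show "w j \<noteq> t" by auto
    qed
    moreover obtain j where "0 < j" "j \<le> K" "w j = t" using w by auto
    then have "\<exists>j. 0 < j \<and> real j < b \<and> w j = t" using K by (intro exI[of _ j]) auto
    ultimately show "w \<in> ?E" using w by (simp add: less_hitting_time_iff hitting_time_less_iff)
  qed
  have "1 - prob (?A \<union> ?B) = prob (space L - (?A \<union> ?B))"
    by (rule prob_compl[OF sets.Un[OF A B], symmetric])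
  also have "\<dots> \<le> prob ?E"
    by (intro finite_measure_mono sub hitting_time_sets s \<beta>)
  finally have "1 - prob (?A \<union> ?B) \<le> prob ?E" .
  moreover have "prob (?A \<union> ?B) \<le> prob ?A + prob ?B"
    by (rule measure_Un_le) fact+
  ultimately show ?thesis using early late by linarith
qed

end

text \<open>The lower exponent needs a barrier only from s, but the potential g must control flips
  from every configuration: the chain may be anywhere when a block of n steps begins.\<close>

theorem hitting_time_tendsto:
  fixes \<Gamma>l \<Gamma>u :: real
  assumes s: "s \<in> configs n" and ne: "s \<noteq> all_plus n" and n: "n \<ge> 1" and \<epsilon>: "\<epsilon> > 0"
    and barrier: "\<And>p. is_path n s (all_plus n) p \<Longrightarrow> \<exists>x\<in>set p. H x \<ge> H s + \<Gamma>l"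
    and g: "\<And>u x. u \<in> configs n \<Longrightarrow> x \<in> vertices n \<Longrightarrow> u x = -1 \<Longrightarrow>
      max 0 (H (u(x := 1)) - H u) \<le> g {y \<in> vertices n. u y = -1} - g ({y \<in> vertices n. u y = -1} - {x})"
    and g_le: "\<And>M. M \<subseteq> vertices n \<Longrightarrow> g M - g {} \<le> \<Gamma>u"
  shows "((\<lambda>\<beta>. measure (metropolis_law n H \<beta> s)
      {w \<in> space (metropolis_law n H \<beta> s).
         ereal (exp (\<beta> * (\<Gamma>l - \<epsilon>))) < ereal_of_enat (hitting_time (all_plus n) w) \<and>
         ereal_of_enat (hitting_time (all_plus n) w) < ereal (exp (\<beta> * (\<Gamma>u + \<epsilon>)))}) \<longlongrightarrow> 1) at_top"
    (is "(?f \<longlongrightarrow> 1) _")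
proof -
  define C where "C = real (card (configs n))"
  define c where "c = (1 / real n) ^ n"
  have c: "c > 0" "c \<le> 1" using n by (auto simp: c_def intro!: power_le_one)
  \<comment> \<open>The first error is that of an early hit. The second is that of m failed blocks,
    (1 - p)^m \<le> exp (- p m); the summand 1 in its exponent pays for rounding m down.\<close>
  define lo where "lo \<beta> = 1 - C * exp (- \<beta> * \<epsilon>) - exp (1 - c / (2 * real n) * exp (\<beta> * \<epsilon>))" for \<beta>
  have "(lo \<longlongrightarrow> 1 - C * 0 - 0) at_top"
  proof -
    have pos: "c / (2 * real n) > 0" using c n by simp
    have 1: "filterlim (\<lambda>\<beta>. exp (\<beta> * \<epsilon>)) at_top at_top"
      using \<epsilon> by real_asymp
    have 2: "((\<lambda>\<beta>. exp (- \<beta> * \<epsilon>)) \<longlongrightarrow> 0) at_top"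
      using \<epsilon> by real_asymp
    have "((\<lambda>x. exp (1 - d * x)) \<longlongrightarrow> 0) at_top" if "d > 0" for d :: real
      using that by real_asymp
    from this[OF pos] have "((\<lambda>x. exp (1 - c / (2 * real n) * x)) \<longlongrightarrow> 0) at_top" .
    then have 3: "((\<lambda>\<beta>. exp (1 - c / (2 * real n) * exp (\<beta> * \<epsilon>))) \<longlongrightarrow> 0) at_top"
      by (rule filterlim_compose[OF _ 1])
    show ?thesis unfolding lo_def by (intro tendsto_intros 2 3)
  qed
  then have lim: "(lo \<longlongrightarrow> 1) at_top" by simp
  have lower: "lo \<beta> \<le> ?f \<beta>" if \<beta>: "\<beta> \<ge> 0" for \<beta>
  proof -
    interpret metropolis_chain n H \<beta> s by unfold_locales fact+
    define a where "a = exp (\<beta> * (\<Gamma>l - \<epsilon>))"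
    define b where "b = exp (\<beta> * (\<Gamma>u + \<epsilon>))"
    define p where "p = c * exp (- \<beta> * \<Gamma>u)"
    \<comment> \<open>Blocks of length n filling at most half of the time b, so that the strict
      bound m n < b holds.\<close>
    define m where "m = nat \<lfloor>b / (2 * real n)\<rfloor>"
    have Gu: "\<Gamma>u \<ge> 0" using g_le[of "{}"] by simp
    have p: "0 \<le> p" "p \<le> 1"
      using c \<beta> Gu by (auto simp: p_def intro!: mult_le_one)
    have e1: "measure L {w \<in> space L. \<exists>j. 0 < j \<and> j \<le> nat \<lfloor>a\<rfloor> \<and> w j = all_plus n} \<le> C * exp (- \<beta> * \<epsilon>)"
    proof -
      have "measure L {w \<in> space L. \<exists>j. 0 < j \<and> j \<le> nat \<lfloor>a\<rfloor> \<and> w j = all_plus n}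
        \<le> real (nat \<lfloor>a\<rfloor>) * (C * exp (- \<beta> * \<Gamma>l))"
        unfolding C_def by (rule prob_hit_early_le[OF _ barrier])
          (auto simp: all_plus_def configs_def)
      also have "\<dots> \<le> a * (C * exp (- \<beta> * \<Gamma>l))"
        by (intro mult_right_mono) (auto simp: a_def C_def)
      also have "\<dots> = C * exp (- \<beta> * \<epsilon>)"
        by (simp add: a_def algebra_simps flip: exp_add)
      finally show ?thesis .
    qed
    have surv: "survival {all_plus n} n u \<le> 1 - p" if u: "u \<in> configs n - {all_plus n}" for u
    proof -
      let ?M = "{y \<in> vertices n. u y = -1}"
      have "card ?M \<le> card (vertices n)" by (rule card_mono) (auto simp: vertices_def)
      then have cM: "card ?M \<le> n" by (simp add: vertices_def)
      have "survival {all_plus n} n u \<le> 1 - (1 / real n) ^ card ?M * exp (- \<beta> * (g ?M - g {}))"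
        using u by (intro survival_le[OF _ _ g cM]) auto
      also have "\<dots> \<le> 1 - p"
        unfolding p_def c_def using n \<beta> g_le[of ?M] cM
        by (intro diff_left_mono mult_mono power_decreasing) (auto intro!: mult_left_mono)
      finally show ?thesis .
    qed
    have e2: "measure L {w \<in> space L. \<forall>j. 0 < j \<and> j \<le> m * n \<longrightarrow> w j \<notin> {all_plus n}}
      \<le> exp (1 - c / (2 * real n) * exp (\<beta> * \<epsilon>))"
    proof -
      have "measure L {w \<in> space L. \<forall>j. 0 < j \<and> j \<le> m * n \<longrightarrow> w j \<notin> {all_plus n}} \<le> (1 - p) ^ m"
        using ne p surv by (intro prob_avoid_le_power) auto
      also have "\<dots> \<le> exp (- p) ^ m"
        using p exp_ge_add_one_self[of "- p"] by (intro power_mono) auto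
      also have "\<dots> = exp (- (p * real m))" by (simp add: mult.commute flip: exp_of_nat_mult)
      also have "\<dots> \<le> exp (1 - c / (2 * real n) * exp (\<beta> * \<epsilon>))"
      proof -
        have "b / (2 * real n) - 1 \<le> real m" unfolding m_def by linarith
        then have "p * (b / (2 * real n) - 1) \<le> p * real m" using p by (intro mult_left_mono)
        moreover have "p * (b / (2 * real n) - 1) = c / (2 * real n) * exp (\<beta> * \<epsilon>) - p"
          by (simp add: p_def b_def algebra_simps flip: exp_add)
        ultimately show ?thesis using p by simp
      qed
      finally show ?thesis .
    qed
    have "real m \<le> b / (2 * real n)" by (simp add: m_def b_def)
    then have "real m * real n \<le> b / (2 * real n) * real n" by (intro mult_right_mono) auto
    also have "\<dots> = b / 2" using n by simp
    also have "\<dots> < b" by (simp add: b_def)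
    finally have K: "real (m * n) < b" by simp
    have a: "a \<ge> 0" by (simp add: a_def)
    show ?thesis
      using hitting_time_prob_ge[OF a e1 e2 K] unfolding lo_def a_def b_def by simp
  qed
  have upper: "?f \<beta> \<le> 1" if "\<beta> \<ge> 0" for \<beta>
  proof -
    interpret metropolis_chain n H \<beta> s by unfold_locales fact+
    show ?thesis by (rule prob_le_1)
  qed
  show ?thesis
    by (rule tendsto_sandwich[OF _ _ lim tendsto_const])
       (auto intro!: eventually_mono[OF eventually_ge_at_top[of 0]] lower upper)
qed

section \<open>Switchings of regular graphs\<close>

lemma finite_vertices [simp]: "finite (vertices n)" and card_vertices [simp]: "card (vertices n) = n"
  by (simp_all add: vertices_def)

definition nbrs :: "nat \<Rightarrow> graph \<Rightarrow> nat \<Rightarrow> nat set" where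
  "nbrs n G v = {y \<in> vertices n. {v, y} \<in> G}"

text \<open>Ordered pairs: an edge inside the intersection of X and Y counts twice. Degree sums then
  need no correction, and the edge boundary is a special case.\<close>

definition arcs :: "graph \<Rightarrow> nat set \<Rightarrow> nat set \<Rightarrow> (nat \<times> nat) set" where
  "arcs G X Y = {(x, y). x \<in> X \<and> y \<in> Y \<and> {x, y} \<in> G}"

lemma finite_nbrs [simp]: "finite (nbrs n G v)"
  by (simp add: nbrs_def)

lemma nbrs_iff: "y \<in> nbrs n G v \<longleftrightarrow> y \<in> vertices n \<and> {v, y} \<in> G"
  by (simp add: nbrs_def)

lemma finite_arcs [simp]: "finite X \<Longrightarrow> finite Y \<Longrightarrow> finite (arcs G X Y)"
  by (rule finite_subset[of _ "X \<times> Y"]) (auto simp: arcs_def)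

lemma regular_graph_edgeD:
  assumes "G \<in> regular_graphs n r" "{x, y} \<in> G"
  shows "x \<in> vertices n" "y \<in> vertices n" "x \<noteq> y"
  using assms by (auto simp: regular_graphs_def doubleton_eq_iff dest!: subsetD)

lemma card_nbrs: "G \<in> regular_graphs n r \<Longrightarrow> v \<in> vertices n \<Longrightarrow> card (nbrs n G v) = r"
  by (simp add: regular_graphs_def nbrs_def)

lemma card_nbrs_le: "G \<in> regular_graphs n r \<Longrightarrow> card (nbrs n G v) \<le> r"
proof (cases "v \<in> vertices n")
  case False
  assume "G \<in> regular_graphs n r"
  with False have "nbrs n G v = {}" by (auto simp: nbrs_def dest: regular_graph_edgeD)
  then show ?thesis by simp
qed (simp add: card_nbrs)

lemma finite_regular_graphs [simp]: "finite (regular_graphs n r)"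
proof (rule finite_subset)
  show "regular_graphs n r \<subseteq> Pow (Pow (vertices n))" by (auto simp: regular_graphs_def)
qed simp

lemma arcs_Un: "arcs G X (Y \<union> Z) = arcs G X Y \<union> arcs G X Z"
  and arcs_Un_left: "arcs G (X \<union> Y) Z = arcs G X Z \<union> arcs G Y Z"
  by (auto simp: arcs_def)

lemma card_arcs_Un:
  assumes "finite X" "finite Y" "finite Z" "Y \<inter> Z = {}"
  shows "card (arcs G X (Y \<union> Z)) = card (arcs G X Y) + card (arcs G X Z)"
  unfolding arcs_Un using assms by (intro card_Un_disjoint finite_arcs) (auto simp: arcs_def)

lemma card_arcs_Un_left:
  assumes "finite X" "finite Y" "finite Z" "X \<inter> Y = {}"
  shows "card (arcs G (X \<union> Y) Z) = card (arcs G X Z) + card (arcs G Y Z)"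
  unfolding arcs_Un_left using assms by (intro card_Un_disjoint finite_arcs) (auto simp: arcs_def)

lemma card_arcs_swap: "card (arcs G X Y) = card (arcs G Y X)"
proof -
  have "bij_betw (\<lambda>(x, y). (y, x)) (arcs G X Y) (arcs G Y X)"
    by (rule bij_betw_byWitness[where f' = "\<lambda>(x, y). (y, x)"]) (auto simp: arcs_def insert_commute)
  then show ?thesis by (rule bij_betw_same_card)
qed

lemma card_arcs_sum:
  assumes "finite X" "Y \<subseteq> vertices n"
  shows "card (arcs G X Y) = (\<Sum>x\<in>X. card (nbrs n G x \<inter> Y))"
proof -
  have "arcs G X Y = (SIGMA x:X. nbrs n G x \<inter> Y)"
    using assms by (auto simp: arcs_def nbrs_def)
  then show ?thesis using assms(1) by simp
qed

lemma card_arcs_vertices: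
  assumes "G \<in> regular_graphs n r" "X \<subseteq> vertices n"
  shows "card (arcs G X (vertices n)) = r * card X"
proof -
  have "finite X" using assms(2) finite_subset finite_vertices by blast
  moreover have "nbrs n G x \<inter> vertices n = nbrs n G x" for x by (auto simp: nbrs_def)
  ultimately show ?thesis
    using assms by (simp add: card_arcs_sum[of X "vertices n" n] subset_eq card_nbrs)
qed

lemma edge_boundary_eq_arcs: "edge_boundary n G A = arcs G A (vertices n - A)"
  by (auto simp: edge_boundary_def arcs_def)

lemma card_arcs_inside:
  assumes "G \<in> regular_graphs n r" "A \<subseteq> vertices n"
  shows "card (arcs G A A) + card (edge_boundary n G A) = r * card A"
proof -
  have "finite A" using assms(2) finite_subset finite_vertices by blast
  moreover have "A \<union> (vertices n - A) = vertices n" using assms by auto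
  ultimately show ?thesis
    using card_arcs_Un[of A A "vertices n - A" G] card_arcs_vertices[OF assms]
    by (simp add: edge_boundary_eq_arcs)
qed

lemma card_Sigma_le:
  assumes "finite X" "\<And>x. x \<in> X \<Longrightarrow> finite (F x)" "\<And>x. x \<in> X \<Longrightarrow> card (F x) \<le> m"
  shows "card (Sigma X F) \<le> card X * m"
proof -
  have "card (Sigma X F) = (\<Sum>x\<in>X. card (F x))" using assms by (intro card_SigmaI) auto
  also have "\<dots> \<le> (\<Sum>x\<in>X. m)" by (intro sum_mono assms)
  finally show ?thesis by simp
qed

lemma card_le_image_Sigma:
  assumes "finite X" "\<And>x. x \<in> X \<Longrightarrow> finite (F x)" "\<And>x. x \<in> X \<Longrightarrow> card (F x) \<le> m"
    and "S \<subseteq> f ` Sigma X F"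
  shows "card S \<le> card X * m"
proof -
  have "card S \<le> card (Sigma X F)"
    using assms by (intro surj_card_le[where f = f] finite_SigmaI) auto
  then show ?thesis using card_Sigma_le[OF assms(1-3)] by (meson order.trans)
qed

text \<open>Each of the four vertices trades one neighbour for another, so degrees are preserved.
  The inverse is the same operation with b and c exchanged.\<close>

definition switch :: "graph \<Rightarrow> nat \<Rightarrow> nat \<Rightarrow> nat \<Rightarrow> nat \<Rightarrow> graph" where
  "switch G a b c d = (G - {{a, b}, {c, d}}) \<union> {{a, c}, {b, d}}"

definition switchable :: "graph \<Rightarrow> nat \<Rightarrow> nat \<Rightarrow> nat \<Rightarrow> nat \<Rightarrow> bool" where
  "switchable G a b c d \<longleftrightarrow> {a, b} \<in> G \<and> {c, d} \<in> G \<and> {a, c} \<notin> G \<and> {b, d} \<notin> G \<and>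
     distinct [a, b, c, d]"

lemma switch_switch:
  assumes "switchable G a b c d"
  shows "switchable (switch G a b c d) a c b d" "switch (switch G a b c d) a c b d = G"
proof -
  have d: "distinct [a, b, c, d]" and e: "{a, b} \<in> G" "{c, d} \<in> G" "{a, c} \<notin> G" "{b, d} \<notin> G"
    using assms by (auto simp: switchable_def)
  show "switchable (switch G a b c d) a c b d"
    using d e by (auto simp: switchable_def switch_def doubleton_eq_iff)
  have "{a, b} \<noteq> {a, c}" "{a, b} \<noteq> {b, d}" "{c, d} \<noteq> {a, c}" "{c, d} \<noteq> {b, d}"
    using d by (auto simp: doubleton_eq_iff)
  then show "switch (switch G a b c d) a c b d = G"
    unfolding switch_def using e by blast
qed

lemma switch_regular:
  assumes G: "G \<in> regular_graphs n r" and s: "switchable G a b c d"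
  shows "switch G a b c d \<in> regular_graphs n r"
proof -
  let ?V = "vertices n" and ?G = "switch G a b c d"
  have d: "a \<noteq> b" "a \<noteq> c" "a \<noteq> d" "b \<noteq> c" "b \<noteq> d" "c \<noteq> d"
    and e: "{a, b} \<in> G" "{c, d} \<in> G" "{a, c} \<notin> G" "{b, d} \<notin> G"
    using s by (auto simp: switchable_def)
  have V: "a \<in> ?V" "b \<in> ?V" "c \<in> ?V" "d \<in> ?V"
    using regular_graph_edgeD[OF G e(1)] regular_graph_edgeD[OF G e(2)] by auto
  have swap: "card (insert y (N - {x})) = card N" if "x \<in> N" "y \<notin> N" "finite N" for x y :: nat and N
    using that by (simp add: card.insert_remove card_Diff_singleton) (metis Suc_pred card_gt_0_iff empty_iff)
  have "?G \<subseteq> {{x, y} | x y. x \<in> ?V \<and> y \<in> ?V \<and> x \<noteq> y}"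
  proof
    fix e assume "e \<in> ?G"
    then consider "e \<in> G" | "e = {a, c}" | "e = {b, d}" by (auto simp: switch_def)
    then show "e \<in> {{x, y} | x y. x \<in> ?V \<and> y \<in> ?V \<and> x \<noteq> y}"
      using G V d by cases (auto simp: regular_graphs_def)
  qed
  moreover have "card (nbrs n ?G v) = r" if v: "v \<in> ?V" for v
  proof -
    have iff: "{v, y} \<in> ?G \<longleftrightarrow> {v, y} \<in> G \<and> {v, y} \<noteq> {a, b} \<and> {v, y} \<noteq> {c, d} \<or>
        {v, y} = {a, c} \<or> {v, y} = {b, d}" for y
      by (auto simp: switch_def)
    consider "v = a" | "v = b" | "v = c" | "v = d" | "v \<notin> {a, b, c, d}" by blast
    then show ?thesis
    proof cases
      case 1
      have "nbrs n ?G v = insert c (nbrs n G v - {b})"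
        by (intro set_eqI, unfold Diff_iff insert_iff nbrs_iff iff)
          (use d V 1 in \<open>auto simp: doubleton_eq_iff\<close>)
      also have "card \<dots> = card (nbrs n G v)"
        using 1 e V by (intro swap) (auto simp: nbrs_def)
      finally show ?thesis using card_nbrs[OF G v] by simp
    next
      case 2
      have "nbrs n ?G v = insert d (nbrs n G v - {a})"
        by (intro set_eqI, unfold Diff_iff insert_iff nbrs_iff iff)
          (use d V 2 in \<open>auto simp: doubleton_eq_iff\<close>)
      also have "card \<dots> = card (nbrs n G v)"
        using 2 e V by (intro swap) (auto simp: nbrs_def insert_commute)
      finally show ?thesis using card_nbrs[OF G v] by simp
    next
      case 3
      have "nbrs n ?G v = insert a (nbrs n G v - {d})"
        by (intro set_eqI, unfold Diff_iff insert_iff nbrs_iff iff)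
          (use d V 3 in \<open>auto simp: doubleton_eq_iff\<close>)
      also have "card \<dots> = card (nbrs n G v)"
        using 3 e V by (intro swap) (auto simp: nbrs_def insert_commute)
      finally show ?thesis using card_nbrs[OF G v] by simp
    next
      case 4
      have "nbrs n ?G v = insert b (nbrs n G v - {c})"
        by (intro set_eqI, unfold Diff_iff insert_iff nbrs_iff iff)
          (use d V 4 in \<open>auto simp: doubleton_eq_iff\<close>)
      also have "card \<dots> = card (nbrs n G v)"
        using 4 e V by (intro swap) (auto simp: nbrs_def insert_commute)
      finally show ?thesis using card_nbrs[OF G v] by simp
    next
      case 5
      have "nbrs n ?G v = nbrs n G v"
        by (intro set_eqI, unfold nbrs_iff iff)
          (use 5 in \<open>auto simp: doubleton_eq_iff\<close>)
      then show ?thesis using card_nbrs[OF G v] by simp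
    qed
  qed
  ultimately show ?thesis by (simp add: regular_graphs_def nbrs_def)
qed

text \<open>Double counting of pairs of a graph and an admissible quadruple. Sending such a pair to
  the switched graph with the same quadruple is injective, since the quadruple determines the
  reverse switching.\<close>

lemma switch_double_count:
  fixes L U :: real and T :: "(nat \<times> nat \<times> nat \<times> nat) set"
  assumes fin: "finite \<G>" "finite \<G>'" "finite T"
    and map: "\<And>G a b c d. G \<in> \<G> \<Longrightarrow> (a, b, c, d) \<in> T \<Longrightarrow> switchable G a b c d \<Longrightarrow> switch G a b c d \<in> \<G>'"
    and L: "\<And>G. G \<in> \<G> \<Longrightarrow> L \<le> card {(a, b, c, d). (a, b, c, d) \<in> T \<and> switchable G a b c d}"
    and U: "\<And>G. G \<in> \<G>' \<Longrightarrow> card {(a, b, c, d). (a, b, c, d) \<in> T \<and> switchable G a c b d} \<le> U"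
  shows "card \<G> * L \<le> card \<G>' * U"
proof -
  let ?A = "\<lambda>G. {(a, b, c, d). (a, b, c, d) \<in> T \<and> switchable G a b c d}"
  let ?B = "\<lambda>G. {(a, b, c, d). (a, b, c, d) \<in> T \<and> switchable G a c b d}"
  let ?f = "\<lambda>(G, a, b, c, d). (switch G a b c d, a, b, c, d)"
  have finAB: "finite (?A G)" "finite (?B G)" for G
    by (auto intro: finite_subset[OF _ fin(3)])
  have inj: "inj_on ?f (Sigma \<G> ?A)"
  proof (rule inj_onI)
    fix p q assume p: "p \<in> Sigma \<G> ?A" and q: "q \<in> Sigma \<G> ?A" and eq: "?f p = ?f q"
    obtain G a b c d where p': "p = (G, a, b, c, d)" by (cases p) auto
    obtain G' where q': "q = (G', a, b, c, d)" using eq p' by (cases q) auto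
    have "switch G a b c d = switch G' a b c d" using eq p' q' by simp
    moreover have "switchable G a b c d" "switchable G' a b c d" using p q p' q' by auto
    ultimately have "G = G'" by (metis switch_switch(2))
    then show "p = q" using p' q' by simp
  qed
  have sub: "?f ` Sigma \<G> ?A \<subseteq> Sigma \<G>' ?B"
    using map switch_switch(1) by force
  have "card \<G> * L = (\<Sum>G\<in>\<G>. L)" by simp
  also have "\<dots> \<le> (\<Sum>G\<in>\<G>. real (card (?A G)))" by (intro sum_mono L)
  also have "\<dots> = card (Sigma \<G> ?A)"
    by (subst card_SigmaI) (use fin finAB in auto)
  also have "\<dots> \<le> card (Sigma \<G>' ?B)"
    by (intro of_nat_mono card_inj_on_le[OF inj sub] finite_SigmaI fin finAB)
  also have "\<dots> = (\<Sum>G\<in>\<G>'. real (card (?B G)))"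
    by (subst card_SigmaI) (use fin finAB in auto)
  also have "\<dots> \<le> (\<Sum>G\<in>\<G>'. U)" by (intro sum_mono U)
  finally show ?thesis by simp
qed

section \<open>Regular graphs counted by the size of a cut\<close>

definition cut_graphs :: "nat \<Rightarrow> nat \<Rightarrow> nat set \<Rightarrow> nat \<Rightarrow> graph set" where
  "cut_graphs n r A k = {G \<in> regular_graphs n r. card (edge_boundary n G A) = k}"

lemma finite_cut_graphs [simp]: "finite (cut_graphs n r A k)"
  by (simp add: cut_graphs_def)

lemma cut_switch_up:
  assumes G: "G \<in> cut_graphs n r A k" and "switchable G a b c d"
    and "a \<in> A" "b \<in> A" "c \<in> vertices n - A" "d \<in> vertices n - A"
  shows "switch G a b c d \<in> cut_graphs n r A (k + 2)"
proof -
  have R: "G \<in> regular_graphs n r" using G by (simp add: cut_graphs_def)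
  have ac: "(a, c) \<notin> edge_boundary n G A" "(b, d) \<notin> edge_boundary n G A" "a \<noteq> b"
    using assms by (auto simp: edge_boundary_def switchable_def)
  have "edge_boundary n (switch G a b c d) A = insert (a, c) (insert (b, d) (edge_boundary n G A))"
    using assms by (auto simp: edge_boundary_def switch_def doubleton_eq_iff)
  moreover have "finite (edge_boundary n G A)"
    by (rule finite_subset[of _ "vertices n \<times> vertices n"])
       (auto simp: edge_boundary_def dest: regular_graph_edgeD[OF R])
  ultimately have "card (edge_boundary n (switch G a b c d) A) = k + 2"
    using ac G by (simp add: cut_graphs_def)
  then show ?thesis using switch_regular[OF R assms(2)] by (simp add: cut_graphs_def)
qed

lemma cut_switch_down:
  assumes G: "G \<in> cut_graphs n r A (k + 2)" and s: "switchable G a b c d"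
    and "a \<in> A" "b \<in> vertices n - A" "c \<in> A" "d \<in> vertices n - A"
  shows "switch G a b c d \<in> cut_graphs n r A k"
proof -
  have R: "G \<in> regular_graphs n r" using G by (simp add: cut_graphs_def)
  have ab: "(a, b) \<in> edge_boundary n G A" "(c, d) \<in> edge_boundary n G A - {(a, b)}"
    using assms by (auto simp: edge_boundary_def switchable_def)
  have "edge_boundary n (switch G a b c d) A = edge_boundary n G A - {(a, b)} - {(c, d)}"
    using assms by (auto simp: edge_boundary_def switch_def doubleton_eq_iff)
  moreover have "finite (edge_boundary n G A)"
    by (rule finite_subset[of _ "vertices n \<times> vertices n"])
       (auto simp: edge_boundary_def dest: regular_graph_edgeD[OF R])
  ultimately have "card (edge_boundary n (switch G a b c d) A) = k"
    using ab G by (simp add: cut_graphs_def card_Diff_singleton)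
  then show ?thesis using switch_regular[OF R s] by (simp add: cut_graphs_def)
qed

text \<open>Forward, one arc inside A and one outside are chosen, in (r a - k) (r b - k) ways. The
  choice is bad only if ac or bd is already an edge; each case fixes a crossing arc and one
  neighbour of either end, so at most k r^2 choices. Backward, the switching is determined by two
  crossing arcs.\<close>

lemma card_cut_up:
  fixes a b :: real
  assumes A: "A \<subseteq> vertices n"
  defines "a \<equiv> real (card A)" and "b \<equiv> real (n - card A)"
  shows "real (card (cut_graphs n r A k)) * ((real r * a - real k) * (real r * b - real k) - 2 * real k * (real r)\<^sup>2) \<le>
    real (card (cut_graphs n r A (k + 2))) * (real k + 2)\<^sup>2"
proof -
  let ?V = "vertices n" and ?B = "vertices n - A"
  define T where "T = A \<times> A \<times> ?B \<times> ?B"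
  have finA: "finite A" using A finite_subset finite_vertices by blast
  have cB: "card ?B = n - card A" using A by (simp add: card_Diff_subset finA)
  show ?thesis
  proof (rule switch_double_count[where T = T])
    show "finite T" using finA by (simp add: T_def)
  next
    fix G a b c d assume "G \<in> cut_graphs n r A k" "(a, b, c, d) \<in> T" "switchable G a b c d"
    then show "switch G a b c d \<in> cut_graphs n r A (k + 2)"
      by (intro cut_switch_up) (auto simp: T_def simp del: add_2_eq_Suc')
  next
    fix G assume G: "G \<in> cut_graphs n r A k"
    then have R: "G \<in> regular_graphs n r" and k: "card (arcs G A ?B) = k"
      by (auto simp: cut_graphs_def edge_boundary_eq_arcs)
    have inA: "real (card (arcs G A A)) = real r * a - real k"
      using card_arcs_inside[OF R A] k by (simp add: a_def edge_boundary_eq_arcs flip: of_nat_mult)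
    have "?V - ?B = A" using A by auto
    then have inB: "real (card (arcs G ?B ?B)) = real r * b - real k"
      using card_arcs_inside[OF R, of ?B] k card_arcs_swap[of G A ?B] cB
      by (simp add: b_def edge_boundary_eq_arcs flip: of_nat_mult)
    let ?S = "{(a, b, c, d). (a, b, c, d) \<in> T \<and> switchable G a b c d}"
    let ?P = "(\<lambda>((a, b), (c, d)). (a, b, c, d)) ` (arcs G A A \<times> arcs G ?B ?B)"
    let ?B1 = "{(a, b, c, d). (a, b, c, d) \<in> T \<and> {a, b} \<in> G \<and> {c, d} \<in> G \<and> {a, c} \<in> G}"
    let ?B2 = "{(a, b, c, d). (a, b, c, d) \<in> T \<and> {a, b} \<in> G \<and> {c, d} \<in> G \<and> {b, d} \<in> G}"
    have cP: "card ?P = card (arcs G A A) * card (arcs G ?B ?B)"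
      by (subst card_image) (auto simp: inj_on_def card_cartesian_product)
    have cB1: "card ?B1 \<le> k * (r * r)"
      unfolding k[symmetric]
    proof (rule card_le_image_Sigma)
      show "?B1 \<subseteq> (\<lambda>((a, c), b, d). (a, b, c, d)) `
          (SIGMA p:arcs G A ?B. nbrs n G (fst p) \<times> nbrs n G (snd p))"
        using A by (force simp: arcs_def nbrs_def T_def image_iff)
    qed (use finA R in \<open>auto simp: card_cartesian_product intro!: mult_le_mono card_nbrs_le\<close>)
    have cB2: "card ?B2 \<le> k * (r * r)"
      unfolding k[symmetric]
    proof (rule card_le_image_Sigma)
      show "?B2 \<subseteq> (\<lambda>((b, d), a, c). (a, b, c, d)) `
          (SIGMA p:arcs G A ?B. nbrs n G (fst p) \<times> nbrs n G (snd p))"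
        using A by (force simp: arcs_def nbrs_def T_def image_iff insert_commute)
    qed (use finA R in \<open>auto simp: card_cartesian_product intro!: mult_le_mono card_nbrs_le\<close>)
    have fin: "finite ?S" "finite ?B1" "finite ?B2"
      by (rule finite_subset[of _ T]; auto simp: T_def finA)+
    have "?P \<subseteq> ?S \<union> (?B1 \<union> ?B2)"
      using regular_graph_edgeD(3)[OF R] by (auto simp: arcs_def T_def switchable_def)
    then have "card ?P \<le> card (?S \<union> (?B1 \<union> ?B2))" using fin by (intro card_mono) auto
    also have "\<dots> \<le> card ?S + (card ?B1 + card ?B2)"
      by (meson card_Un_le add_left_mono order.trans)
    also have "\<dots> \<le> card ?S + (k * (r * r) + k * (r * r))" by (intro add_mono cB1 cB2 order.refl)
    finally have "real (card ?P) \<le> real (card ?S + (k * (r * r) + k * (r * r)))" by (rule of_nat_mono)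
    then show "(real r * a - real k) * (real r * b - real k) - 2 * real k * (real r)\<^sup>2 \<le> real (card ?S)"
      unfolding cP by (simp add: inA inB power2_eq_square)
  next
    fix G assume G: "G \<in> cut_graphs n r A (k + 2)"
    then have k: "card (arcs G A ?B) = k + 2"
      by (auto simp: cut_graphs_def edge_boundary_eq_arcs)
    let ?S = "{(a, b, c, d). (a, b, c, d) \<in> T \<and> switchable G a c b d}"
    have "?S \<subseteq> (\<lambda>((a, c), b, d). (a, b, c, d)) ` (arcs G A ?B \<times> arcs G A ?B)"
      by (force simp: T_def switchable_def arcs_def image_iff)
    then have "card ?S \<le> card (arcs G A ?B \<times> arcs G A ?B)"
      using finA by (intro surj_card_le finite_cartesian_product finite_arcs) auto
    then have "real (card ?S) \<le> real ((k + 2) * (k + 2))"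
      unfolding card_cartesian_product k by (rule of_nat_mono)
    then show "real (card ?S) \<le> (real k + 2)\<^sup>2" by (simp add: power2_eq_square algebra_simps)
  qed simp_all
qed

text \<open>Forward, two crossing arcs are chosen. They may share an end on either side, which costs
  k + 2 times r each, or their ends on one side may be adjacent, which costs k + 2 times r^2 each.
  Backward, an arc inside A and one outside determine the switching.\<close>

lemma card_cut_down:
  fixes a b :: real
  assumes A: "A \<subseteq> vertices n"
  defines "a \<equiv> real (card A)" and "b \<equiv> real (n - card A)"
  shows "real (card (cut_graphs n r A (k + 2))) * ((real k + 2)\<^sup>2 - 2 * (real k + 2) * real r - 2 * (real k + 2) * (real r)\<^sup>2) \<le>
    real (card (cut_graphs n r A k)) * ((real r * a - real k) * (real r * b - real k))"
proof -
  let ?V = "vertices n" and ?B = "vertices n - A"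
  define T where "T = A \<times> ?B \<times> A \<times> ?B"
  have finA: "finite A" using A finite_subset finite_vertices by blast
  have cB: "card ?B = n - card A" using A by (simp add: card_Diff_subset finA)
  show ?thesis
  proof (rule switch_double_count[where T = T])
    show "finite T" using finA by (simp add: T_def)
  next
    fix G a b c d assume "G \<in> cut_graphs n r A (k + 2)" "(a, b, c, d) \<in> T" "switchable G a b c d"
    then show "switch G a b c d \<in> cut_graphs n r A k"
      by (intro cut_switch_down) (auto simp: T_def simp del: add_2_eq_Suc')
  next
    fix G assume G: "G \<in> cut_graphs n r A k"
    then have R: "G \<in> regular_graphs n r" and k: "card (arcs G A ?B) = k"
      by (auto simp: cut_graphs_def edge_boundary_eq_arcs)
    have inA: "real (card (arcs G A A)) = real r * a - real k"
      using card_arcs_inside[OF R A] k by (simp add: a_def edge_boundary_eq_arcs flip: of_nat_mult)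
    have "?V - ?B = A" using A by auto
    then have inB: "real (card (arcs G ?B ?B)) = real r * b - real k"
      using card_arcs_inside[OF R, of ?B] k card_arcs_swap[of G A ?B] cB
      by (simp add: b_def edge_boundary_eq_arcs flip: of_nat_mult)
    let ?S = "{(a, b, c, d). (a, b, c, d) \<in> T \<and> switchable G a c b d}"
    have "?S \<subseteq> (\<lambda>((a, c), b, d). (a, b, c, d)) ` (arcs G A A \<times> arcs G ?B ?B)"
      by (force simp: T_def switchable_def arcs_def image_iff)
    then have "card ?S \<le> card (arcs G A A \<times> arcs G ?B ?B)"
      using finA by (intro surj_card_le finite_cartesian_product finite_arcs) auto
    then have "real (card ?S) \<le> real (card (arcs G A A) * card (arcs G ?B ?B))"
      unfolding card_cartesian_product by (rule of_nat_mono)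
    then show "real (card ?S) \<le> (real r * a - real k) * (real r * b - real k)" by (simp add: inA inB)
  next
    fix G assume G: "G \<in> cut_graphs n r A (k + 2)"
    define m where "m = k + 2"
    have R: "G \<in> regular_graphs n r" and m: "card (arcs G A ?B) = m"
      using G by (auto simp: cut_graphs_def edge_boundary_eq_arcs m_def)
    let ?S = "{(a, b, c, d). (a, b, c, d) \<in> T \<and> switchable G a b c d}"
    let ?P = "(\<lambda>((a, b), (c, d)). (a, b, c, d)) ` (arcs G A ?B \<times> arcs G A ?B)"
    let ?B1 = "{(a, b, c, d). (a, b, c, d) \<in> T \<and> {a, b} \<in> G \<and> {c, d} \<in> G \<and> a = c}"
    let ?B2 = "{(a, b, c, d). (a, b, c, d) \<in> T \<and> {a, b} \<in> G \<and> {c, d} \<in> G \<and> b = d}"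
    let ?B3 = "{(a, b, c, d). (a, b, c, d) \<in> T \<and> {a, b} \<in> G \<and> {c, d} \<in> G \<and> {a, c} \<in> G}"
    let ?B4 = "{(a, b, c, d). (a, b, c, d) \<in> T \<and> {a, b} \<in> G \<and> {c, d} \<in> G \<and> {b, d} \<in> G}"
    have cP: "card ?P = m * m"
      by (subst card_image) (auto simp: inj_on_def card_cartesian_product m)
    have c1: "card ?B1 \<le> m * r"
      unfolding m[symmetric]
    proof (rule card_le_image_Sigma)
      show "?B1 \<subseteq> (\<lambda>((a, b), d). (a, b, a, d)) ` (SIGMA p:arcs G A ?B. nbrs n G (fst p))"
        using A by (force simp: arcs_def nbrs_def T_def image_iff)
    qed (use finA R in \<open>auto intro!: card_nbrs_le\<close>)
    have c2: "card ?B2 \<le> m * r"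
      unfolding m[symmetric]
    proof (rule card_le_image_Sigma)
      show "?B2 \<subseteq> (\<lambda>((a, b), c). (a, b, c, b)) ` (SIGMA p:arcs G A ?B. nbrs n G (snd p))"
        using A by (force simp: arcs_def nbrs_def T_def image_iff insert_commute)
    qed (use finA R in \<open>auto intro!: card_nbrs_le\<close>)
    have c3: "card ?B3 \<le> m * (r * r)"
      unfolding m[symmetric]
    proof (rule card_le_image_Sigma)
      show "?B3 \<subseteq> (\<lambda>((a, b), c, d). (a, b, c, d)) `
          (SIGMA p:arcs G A ?B. SIGMA c:nbrs n G (fst p). nbrs n G c)"
        using A by (force simp: arcs_def nbrs_def T_def image_iff)
    next
      show "card (SIGMA c:nbrs n G (fst p). nbrs n G c) \<le> r * r" for p :: "nat \<times> nat"
        by (rule order.trans[OF card_Sigma_le[where m = r]]) (use R in \<open>auto intro!: card_nbrs_le\<close>)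
    qed (use finA R in \<open>auto\<close>)
    have c4: "card ?B4 \<le> m * (r * r)"
      unfolding m[symmetric]
    proof (rule card_le_image_Sigma)
      show "?B4 \<subseteq> (\<lambda>((a, b), d, c). (a, b, c, d)) `
          (SIGMA p:arcs G A ?B. SIGMA d:nbrs n G (snd p). nbrs n G d)"
        using A by (force simp: arcs_def nbrs_def T_def image_iff insert_commute)
    next
      show "card (SIGMA c:nbrs n G (snd p). nbrs n G c) \<le> r * r" for p :: "nat \<times> nat"
        by (rule order.trans[OF card_Sigma_le[where m = r]]) (use R in \<open>auto intro!: card_nbrs_le\<close>)
    qed (use finA R in \<open>auto\<close>)
    have fin: "finite ?S" "finite ?B1" "finite ?B2" "finite ?B3" "finite ?B4"
      by (rule finite_subset[of _ T]; auto simp: T_def finA)+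
    have "?P \<subseteq> ?S \<union> (?B1 \<union> (?B2 \<union> (?B3 \<union> ?B4)))"
      using regular_graph_edgeD(3)[OF R] by (auto simp: arcs_def T_def switchable_def)
    then have "card ?P \<le> card (?S \<union> (?B1 \<union> (?B2 \<union> (?B3 \<union> ?B4))))" using fin by (intro card_mono) auto
    also have "\<dots> \<le> card ?S + (card ?B1 + (card ?B2 + (card ?B3 + card ?B4)))"
      by (meson card_Un_le add_left_mono order.trans)
    also have "\<dots> \<le> card ?S + (m * r + (m * r + (m * (r * r) + m * (r * r))))"
      by (intro add_mono c1 c2 c3 c4 order.refl)
    finally have "real (card ?P) \<le> real (card ?S + (m * r + (m * r + (m * (r * r) + m * (r * r)))))"
      by (rule of_nat_mono)
    then have "real m * real m \<le> real (card ?S) + (m * r + (m * r + (m * (r * r) + m * (r * r))))"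
      unfolding cP by simp
    moreover have "real m = real k + 2" by (simp add: m_def)
    ultimately show "(real k + 2)\<^sup>2 - 2 * (real k + 2) * real r - 2 * (real k + 2) * (real r)\<^sup>2 \<le> real (card ?S)"
      by (simp add: power2_eq_square algebra_simps)
  qed simp_all
qed

text \<open>A circulant graph with the symmetric set S of differences; for odd r the degree is
  completed by n / 2, as n is then even. Without a regular graph the uniform distribution would be
  unspecified.\<close>

lemma regular_graphs_nonempty:
  assumes "n > r" "even (n * r)"
  shows "regular_graphs n r \<noteq> {}"
proof -
  define k where "k = r div 2"
  define S where "S = {1..k} \<union> {n - k..n - 1} \<union> (if odd r then {n div 2} else {})"
  have k: "2 * k < n" "odd r \<Longrightarrow> k < n div 2 \<and> 2 * (n div 2) = n"
    using assms by (auto simp: k_def elim!: oddE)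
  have S: "d \<in> S \<Longrightarrow> 1 \<le> d \<and> d < n" "d \<in> S \<Longrightarrow> n - d \<in> S" for d
    using k by (auto simp: S_def split: if_splits)
  have cS: "card S = r"
  proof -
    have "card ({1..k} \<union> {n - k..n - 1}) = 2 * k"
      using k by (subst card_Un_disjoint) auto
    moreover have "n div 2 \<notin> {1..k} \<union> {n - k..n - 1}" if "odd r"
      using k that by auto
    ultimately have "card S = 2 * k + (if odd r then 1 else 0)"
      by (simp add: S_def)
    then show ?thesis by (simp add: k_def)
  qed
  define G where "G = {{x, y} | x y. x \<in> vertices n \<and> y \<in> vertices n \<and> x < y \<and> y - x \<in> S}"
  have edge: "{x, y} \<in> G \<longleftrightarrow> x \<in> vertices n \<and> y \<in> vertices n \<and> (x < y \<and> y - x \<in> S \<or> y < x \<and> x - y \<in> S)" for x y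
    unfolding G_def by (auto simp: doubleton_eq_iff)
  have "card {y \<in> vertices n. {x, y} \<in> G} = r" if x: "x \<in> vertices n" for x
  proof -
    let ?f = "\<lambda>d. if d < x then x - d else x + n - d"
    have "bij_betw ?f S {y \<in> vertices n. {x, y} \<in> G}"
    proof (rule bij_betw_byWitness[where f' = "\<lambda>y. if y < x then x - y else x + n - y"])
      show "\<forall>d\<in>S. (if ?f d < x then x - ?f d else x + n - ?f d) = d"
        using S(1) x by (fastforce simp: vertices_def)
      show "\<forall>y\<in>{y \<in> vertices n. {x, y} \<in> G}. ?f (if y < x then x - y else x + n - y) = y"
        unfolding edge using x by (auto simp: vertices_def)
      show "?f ` S \<subseteq> {y \<in> vertices n. {x, y} \<in> G}"
      proof safe
        fix d assume d: "d \<in> S"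
        show "?f d \<in> vertices n" using S(1)[OF d] x by (auto simp: vertices_def)
        show "{x, ?f d} \<in> G"
          unfolding edge using S[OF d] d x by (auto simp: vertices_def)
      qed
      show "(\<lambda>y. if y < x then x - y else x + n - y) ` {y \<in> vertices n. {x, y} \<in> G} \<subseteq> S"
      proof safe
        fix y assume y: "y \<in> vertices n" "{x, y} \<in> G"
        show "(if y < x then x - y else x + n - y) \<in> S"
        proof (cases "y < x")
          case True
          then show ?thesis using y by (simp add: edge)
        next
          case False
          then have "x < y" "y - x \<in> S" using y by (auto simp: edge)
          moreover have "n - (y - x) = x + n - y" using \<open>x < y\<close> by simp
          ultimately show ?thesis using S(2)[of "y - x"] by simp
        qed
      qed
    qed
    then show ?thesis using cS by (simp add: bij_betw_same_card)
  qed
  then have "G \<in> regular_graphs n r"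
    by (auto simp: regular_graphs_def G_def)
  then show ?thesis by blast
qed

lemma sum_card_cut_graphs:
  assumes "finite K" and inj: "inj_on f K"
  shows "(\<Sum>k\<in>K. real (card (cut_graphs n r A (f k)))) \<le> real (card (regular_graphs n r))"
proof -
  have "(\<Sum>k\<in>K. real (card (cut_graphs n r A (f k)))) = real (\<Sum>k\<in>K. card (cut_graphs n r A (f k)))"
    by simp
  also have "(\<Sum>k\<in>K. card (cut_graphs n r A (f k))) = card (\<Union>k\<in>K. cut_graphs n r A (f k))"
    using assms by (intro card_UN_disjoint[symmetric]) (auto simp: cut_graphs_def inj_on_def)
  also have "\<dots> \<le> card (regular_graphs n r)"
    by (intro card_mono) (auto simp: cut_graphs_def)
  finally show ?thesis by simp
qed

text \<open>If shifting the cut by f multiplies the counts by at least q, the shifted classes still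
  fit disjointly into all regular graphs. So the classes in K have at most the proportion 1 /
  q.\<close>

lemma card_shift_tail:
  fixes q :: real
  assumes q: "q > 0" and inj: "inj_on f K"
    and step: "\<And>k. k \<in> K \<Longrightarrow> real (card (cut_graphs n r A k)) * q \<le> real (card (cut_graphs n r A (f k)))"
  shows "real (card {G \<in> regular_graphs n r. card (edge_boundary n G A) \<in> K}) * q \<le>
    real (card (regular_graphs n r))"
proof -
  let ?E = "{G \<in> regular_graphs n r. card (edge_boundary n G A) \<in> K}"
  define K' where "K' = (\<lambda>G. card (edge_boundary n G A)) ` ?E"
  have K': "finite K'" "K' \<subseteq> K" by (auto simp: K'_def)
  have "?E = (\<Union>k\<in>K'. cut_graphs n r A k)" by (auto simp: K'_def cut_graphs_def)
  then have "card ?E = (\<Sum>k\<in>K'. card (cut_graphs n r A k))"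
    using K' by (simp only:) (intro card_UN_disjoint, auto simp: cut_graphs_def)
  then have "real (card ?E) * q = (\<Sum>k\<in>K'. real (card (cut_graphs n r A k)) * q)"
    by (simp add: sum_distrib_right)
  also have "\<dots> \<le> (\<Sum>k\<in>K'. real (card (cut_graphs n r A (f k))))"
    using K' by (intro sum_mono step) auto
  also have "\<dots> \<le> real (card (regular_graphs n r))"
    using K' inj by (intro sum_card_cut_graphs) (auto intro: inj_on_subset)
  finally show ?thesis .
qed

lemma power_ratio_chain:
  fixes N :: "nat \<Rightarrow> real" and q :: real
  assumes "q \<ge> 0" "\<And>i. i < m \<Longrightarrow> N i * q \<le> N (Suc i)"
  shows "N 0 * q ^ m \<le> N m"
  using assms(2)
proof (induction m)
  case (Suc m)
  have "N 0 * q ^ Suc m = (N 0 * q ^ m) * q" by simp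
  also have "\<dots> \<le> N m * q" using Suc assms(1) by (intro mult_right_mono) auto
  also have "\<dots> \<le> N (Suc m)" using Suc.prems by simp
  finally show ?case .
qed simp

text \<open>Bernoulli gives (1 + 2 / s)^s \<ge> 3. Any base above 2 would beat the 2^n vertex sets
  in the later union bound.\<close>

lemma nine_power_le:
  assumes "s \<ge> (1::nat)"
  shows "(9::real) ^ n \<le> (1 + 2 / real s) ^ (2 * s * n)"
proof -
  have "3 = 1 + real s * (2 / real s)" using assms by simp
  also have "\<dots> \<le> (1 + 2 / real s) ^ s"
    by (rule Bernoulli_inequality) (use assms in \<open>auto simp: field_simps\<close>)
  finally have "(3::real) ^ (2 * n) \<le> ((1 + 2 / real s) ^ s) ^ (2 * n)" by (intro power_mono) auto
  moreover have "(3::real) ^ (2 * n) = 9 ^ n" by (simp add: power_mult)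
  moreover have "((1 + 2 / real s) ^ s) ^ (2 * n) = (1 + 2 / real s) ^ (2 * s * n)"
    by (simp add: mult_ac flip: power_mult)
  ultimately show ?thesis by simp
qed

text \<open>A switching moves the size of the cut of \<open>A\<close> by two, and double counting compares the numbers of
  graphs with cuts \<open>k\<close> and \<open>k + 2\<close>. The comparison rests on the identity
  \<open>(r a - k) (r b - k) - k\<^sup>2 = r n (X - k)\<close>, where \<open>X = r a b / n\<close> is the typical size of the cut: at distance at
  least \<open>4 s n\<close> from \<open>X\<close> the counts grow towards \<open>X\<close> by the factor \<open>1 + 2 / s\<close> in each step.\<close>

locale cut_concentration =
  fixes n r s :: nat and A :: "nat set"
  assumes A: "A \<subseteq> vertices n" and r3: "r \<ge> 3" and s1: "s \<ge> 1" and sr: "r \<le> s\<^sup>2" and nr: "r\<^sup>2 \<le> n"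
begin

definition a :: real where "a = real (card A)"
definition b :: real where "b = real (n - card A)"
definition X :: real where "X = real r * a * b / real n"

lemma basic: "a \<ge> 0" "b \<ge> 0" "a + b = real n" "real n \<ge> 9" "4 * X \<le> real r * real n" "X \<ge> 0"
  "real r * real n * X = (real r)\<^sup>2 * a * b"
  "2 / real s \<le> 2 * real s / real r" "(real r)\<^sup>2 \<le> real n"
proof -
  have "card A \<le> n" using card_mono[OF finite_vertices A] by simp
  then show ab: "a \<ge> 0" "b \<ge> 0" "a + b = real n" by (auto simp: a_def b_def)
  have "9 \<le> r\<^sup>2" using power_mono[OF r3, of 2] by simp
  then have "9 \<le> n" using nr by linarith
  then show n9: "real n \<ge> 9" by simp
  have "4 * (a * b) \<le> (a + b)\<^sup>2" using sum_squares_ge_zero[of "a - b" 0] by (simp add: power2_eq_square algebra_simps)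
  then have "real r * (4 * (a * b)) \<le> real r * (real n)\<^sup>2" using ab by (intro mult_left_mono) auto
  then show "4 * X \<le> real r * real n" using n9 by (simp add: X_def field_simps power2_eq_square)
  show "X \<ge> 0" using ab by (simp add: X_def)
  show "real r * real n * X = (real r)\<^sup>2 * a * b" using n9 by (simp add: X_def power2_eq_square)
  have "real r \<le> (real s)\<^sup>2" using sr by (metis of_nat_le_iff of_nat_power)
  then show "2 / real s \<le> 2 * real s / real r" using s1 r3 by (simp add: field_simps power2_eq_square)
  show "(real r)\<^sup>2 \<le> real n" using nr by (metis of_nat_le_iff of_nat_power)
qed

lemma poly_bounds:
  "real r ^ 3 * real n \<le> real s * real r * (real n)\<^sup>2"
  "9 * (real r * real n) \<le> real r ^ 3 * real n" "3 * (real r ^ 2 * real n) \<le> real r ^ 3 * real n"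
  "27 \<le> real r * real n"
proof -
  have r: "real r \<ge> 3" "real s \<ge> 1" using r3 s1 by auto
  have "real r ^ 3 * real n = real r * real n * (real r)\<^sup>2" by (simp add: power2_eq_square power3_eq_cube)
  also have "\<dots> \<le> real r * real n * real n" using basic by (intro mult_left_mono) auto
  also have "\<dots> \<le> real s * (real r * real n * real n)" using r mult_right_mono[of 1 "real s" "real r * real n * real n"] by simp
  finally show "real r ^ 3 * real n \<le> real s * real r * (real n)\<^sup>2" by (simp add: power2_eq_square mult.assoc)
  have "3 * 3 \<le> real r * real r" using r by (intro mult_mono) auto
  then have "(3 * 3) * (real r * real n) \<le> (real r * real r) * (real r * real n)" by (intro mult_right_mono) auto
  then show "9 * (real r * real n) \<le> real r ^ 3 * real n" by (simp add: power3_eq_cube)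
  have "3 * (real r ^ 2 * real n) \<le> real r * (real r ^ 2 * real n)" using r by (intro mult_right_mono) auto
  then show "3 * (real r ^ 2 * real n) \<le> real r ^ 3 * real n" by (simp add: power3_eq_cube power2_eq_square)
  have "3 * 9 \<le> real r * real n" using r basic by (intro mult_mono) auto
  then show "27 \<le> real r * real n" by simp
qed

lemma ratio_up:
  assumes k: "real k \<le> X - 4 * real s * real n"
  shows "real (card (cut_graphs n r A k)) * (1 + 2 / real s) \<le> real (card (cut_graphs n r A (k + 2)))"
proof -
  let ?N = "\<lambda>k. real (card (cut_graphs n r A k))"
  let ?L = "(real r * a - real k) * (real r * b - real k) - 2 * real k * (real r)\<^sup>2"
  have r: "real r > 0" "real s > 0" using r3 s1 by auto
  have "?L = (real r)\<^sup>2 * a * b - real r * (a + b) * real k + (real k)\<^sup>2 - 2 * real k * (real r)\<^sup>2"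
    by (simp add: algebra_simps power2_eq_square)
  also have "\<dots> = real r * real n * (X - real k) + (real k)\<^sup>2 - 2 * real k * (real r)\<^sup>2"
    unfolding basic(3) using basic(7) by (simp add: algebra_simps)
  finally have L: "?L = real r * real n * (X - real k) + (real k)\<^sup>2 - 2 * real k * (real r)\<^sup>2" .
  \<comment> \<open>The gain 4 s r n^2 must pay for (2 / s) (k + 2)^2, for 2 k r^2 and for 4 k + 4.
    The first is at most s r n^2 / 2 by r \<le> s^2, the second likewise by r^2 \<le> n.\<close>
  have D: "real r * real n * (4 * real s * real n) \<le> real r * real n * (X - real k)"
    using k by (intro mult_left_mono) auto
  have k4: "4 * real k \<le> real r * real n" using k basic(5) mult_nonneg_nonneg[of "real s" "real n"] by linarith
  have k2: "real k + 2 \<le> real r * real n / 2" using k4 poly_bounds(4) by linarith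
  have "(2 / real s) * (real k + 2)\<^sup>2 \<le> (2 * real s / real r) * (real r * real n / 2)\<^sup>2"
    using k2 by (intro mult_mono power_mono basic) auto
  also have "\<dots> = real s * real r * (real n)\<^sup>2 / 2" using r by (simp add: field_simps power2_eq_square)
  finally have t: "(2 / real s) * (real k + 2)\<^sup>2 \<le> real s * real r * (real n)\<^sup>2 / 2" .
  have "4 * real k * (real r)\<^sup>2 \<le> real r * real n * (real r)\<^sup>2"
    using k4 by (intro mult_right_mono) auto
  then have kr: "4 * (real k * (real r)\<^sup>2) \<le> real r ^ 3 * real n" by (simp add: power2_eq_square power3_eq_cube mult_ac)
  have D': "real r * real n * (4 * real s * real n) = 4 * (real s * real r * (real n)\<^sup>2)"
    by (simp add: power2_eq_square)
  have "(1 + 2 / real s) * (real k + 2)\<^sup>2 = (real k)\<^sup>2 + 4 * real k + 4 + (2 / real s) * (real k + 2)\<^sup>2"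
    by (simp add: algebra_simps power2_eq_square)
  also have "\<dots> \<le> ?L"
    unfolding L using D D' t kr k4 poly_bounds by linarith
  finally have "?N k * ((1 + 2 / real s) * (real k + 2)\<^sup>2) \<le> ?N k * ?L" by (intro mult_left_mono) auto
  also have "\<dots> \<le> ?N (k + 2) * (real k + 2)\<^sup>2"
    unfolding a_def b_def by (rule card_cut_up[OF A])
  finally have "(?N k * (1 + 2 / real s)) * (real k + 2)\<^sup>2 \<le> ?N (k + 2) * (real k + 2)\<^sup>2" by (simp only: mult.assoc)
  then show ?thesis by (rule mult_right_le_imp_le) auto
qed

lemma cut_le:
  assumes "G \<in> cut_graphs n r A k"
  shows "real k \<le> real r * a" "real k \<le> real r * b"
proof -
  have R: "G \<in> regular_graphs n r" and k: "card (edge_boundary n G A) = k"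
    using assms by (auto simp: cut_graphs_def)
  have "k \<le> r * card A" using card_arcs_inside[OF R A] k by simp
  then show "real k \<le> real r * a" unfolding a_def by (metis of_nat_le_iff of_nat_mult)
  have "vertices n - (vertices n - A) = A" "card (vertices n - A) = n - card A"
    using A finite_subset[OF A] by (auto simp: card_Diff_subset)
  then have "k \<le> r * (n - card A)"
    using card_arcs_inside[OF R, of "vertices n - A"] k card_arcs_swap[of G A "vertices n - A"]
    by (simp add: edge_boundary_eq_arcs)
  then show "real k \<le> real r * b" unfolding b_def by (metis of_nat_le_iff of_nat_mult)
qed

lemma ratio_down:
  assumes k: "real (k + 2) \<ge> X + 4 * real s * real n"
  shows "real (card (cut_graphs n r A (k + 2))) * (1 + 2 / real s) \<le> real (card (cut_graphs n r A k))"
\<comment> \<open>A graph with cut k + 2 shows that k + 2 is at most r a and r b. This makes the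
  factor \<open>?U\<close> positive, so that it can be cancelled at the end.\<close>
proof (cases "cut_graphs n r A (k + 2) = {}")
  case True
  then show ?thesis by simp
next
  case False
  let ?N = "\<lambda>k. real (card (cut_graphs n r A k))"
  define y where "y = real k + 2"
  let ?L = "y\<^sup>2 - 2 * y * real r - 2 * y * (real r)\<^sup>2"
  let ?U = "(real r * a - real k) * (real r * b - real k)"
  have r: "real r > 0" "real s > 0" using r3 s1 by auto
  obtain G where "G \<in> cut_graphs n r A (k + 2)" using False by blast
  then have y: "y \<le> real r * a" "y \<le> real r * b"
    using cut_le[of G "k + 2"] by (auto simp: y_def)
  then have "2 * y \<le> real r * (a + b)" by (simp add: algebra_simps)
  then have yn: "2 * y \<le> real r * real n" by (simp only: basic)
  have Upos: "?U > 0" using y by (intro mult_pos_pos) (auto simp: y_def)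
  have "?U \<le> (real r * a) * (real r * b)"
    using y basic by (intro mult_mono) (auto simp: y_def)
  also have "\<dots> = real r * real n * X" by (simp add: basic(7) power2_eq_square)
  also have "\<dots> \<le> real r * real n * (real r * real n / 4)" using basic(5) by (intro mult_left_mono) auto
  finally have U: "?U \<le> real r * real n * (real r * real n / 4)" .
  have "(2 / real s) * ?U \<le> (2 * real s / real r) * (real r * real n * (real r * real n / 4))"
    using Upos by (intro mult_mono[OF basic(8) U]) auto
  also have "\<dots> = real s * real r * (real n)\<^sup>2 / 2" using r by (simp add: field_simps power2_eq_square)
  finally have t: "(2 / real s) * ?U \<le> real s * real r * (real n)\<^sup>2 / 2" .
  have "?U = (real r)\<^sup>2 * a * b - real r * (a + b) * y + y\<^sup>2 + 2 * (real r * (a + b) - 2 * y) + 4"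
    by (simp add: y_def algebra_simps power2_eq_square)
  also have "\<dots> = real r * real n * X - real r * real n * y + y\<^sup>2 + 2 * (real r * real n - 2 * y) + 4"
    by (simp only: basic(3) basic(7))
  also have "\<dots> = y\<^sup>2 - real r * real n * (y - X) + 2 * (real r * real n - 2 * y) + 4"
    by (simp add: algebra_simps)
  finally have U': "?U = y\<^sup>2 - real r * real n * (y - X) + 2 * (real r * real n - 2 * y) + 4" .
  have D: "real r * real n * (4 * real s * real n) \<le> real r * real n * (y - X)"
    using k by (intro mult_left_mono) (auto simp: y_def)
  have D': "real r * real n * (4 * real s * real n) = 4 * (real s * real r * (real n)\<^sup>2)"
    by (simp add: power2_eq_square)
  have "2 * y * (real r)\<^sup>2 \<le> real r * real n * (real r)\<^sup>2" using yn by (intro mult_right_mono) auto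
  then have y2: "2 * y * (real r)\<^sup>2 \<le> real r ^ 3 * real n" by (simp add: power2_eq_square power3_eq_cube mult_ac)
  have "2 * y * real r \<le> real r * real n * real r" using yn by (intro mult_right_mono) auto
  then have y1: "2 * y * real r \<le> (real r)\<^sup>2 * real n" by (simp add: power2_eq_square mult_ac)
  have y0: "y \<ge> 0" by (simp add: y_def)
  \<comment> \<open>The inequality is linear once every product is treated as an atom; the variables
    stand for these products.\<close>
  have "U + T \<le> L" if "T \<le> Q / 2" "U = Y - P + 2 * (R - 2 * y) + 4" "4 * Q \<le> P" "A1 \<le> R2" "A2 \<le> R3"
      "R3 \<le> Q" "9 * R \<le> R3" "3 * R2 \<le> R3" "27 \<le> R" "L = Y - A1 - A2"
    for U T L Q Y P R A1 A2 R2 R3 :: real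
    using that y0 by simp
  note arith = this[OF t U' _ y1 y2 poly_bounds refl]
  have "(1 + 2 / real s) * ?U = ?U + (2 / real s) * ?U" by (simp only: distrib_right mult_1)
  also have "\<dots> \<le> ?L"
    by (rule arith) (use D D' in simp)
  finally have "?N (k + 2) * ((1 + 2 / real s) * ?U) \<le> ?N (k + 2) * ?L" by (intro mult_left_mono) auto
  also have "\<dots> \<le> ?N k * ?U"
    unfolding a_def b_def y_def by (rule card_cut_down[OF A])
  finally have "(?N (k + 2) * (1 + 2 / real s)) * ?U \<le> ?N k * ?U" by (simp only: mult.assoc)
  then show ?thesis using Upos by (rule mult_right_le_imp_le)
qed

text \<open>The distance 8 s n leaves room for 2 s n switchings: they move the cut by 4 s n and keep
  it at distance at least 4 s n from X, where each gains the factor 1 + 2 / s.\<close>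

lemma lower_tail:
  "real (card {G \<in> regular_graphs n r. real (card (edge_boundary n G A)) \<le> X - 8 * real s * real n}) * 9 ^ n
    \<le> real (card (regular_graphs n r))"
proof -
  let ?m = "2 * s * n" and ?N = "\<lambda>k. real (card (cut_graphs n r A k))"
  let ?K = "{k. real k \<le> X - 8 * real s * real n}"
  have "?N k * 9 ^ n \<le> ?N (k + 2 * ?m)" if k: "k \<in> ?K" for k
  proof -
    have "?N k * 9 ^ n \<le> ?N k * (1 + 2 / real s) ^ ?m"
      using nine_power_le[OF s1] by (intro mult_left_mono) auto
    also have "?N k = ?N (k + 2 * 0)" by simp
    also have "?N (k + 2 * 0) * (1 + 2 / real s) ^ ?m \<le> ?N (k + 2 * ?m)"
    proof (rule power_ratio_chain[where N = "\<lambda>i. ?N (k + 2 * i)"])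
      fix i assume "i < ?m"
      then have "real i \<le> real (2 * (s * n))" by (intro of_nat_mono) simp
      then have "real i \<le> 2 * (real s * real n)" by simp
      then have "real (k + 2 * i) \<le> X - 4 * real s * real n" using k by simp
      from ratio_up[OF this] show "?N (k + 2 * i) * (1 + 2 / real s) \<le> ?N (k + 2 * Suc i)"
        by (simp add: add.assoc)
    qed simp
    finally show ?thesis by simp
  qed
  then show ?thesis
    using card_shift_tail[of "9 ^ n" "\<lambda>k. k + 2 * ?m" ?K n r A] by (simp add: inj_on_def)
qed

lemma upper_tail:
  "real (card {G \<in> regular_graphs n r. real (card (edge_boundary n G A)) \<ge> X + 8 * real s * real n}) * 9 ^ n
    \<le> real (card (regular_graphs n r))"
proof -
  let ?m = "2 * s * n" and ?N = "\<lambda>k. real (card (cut_graphs n r A k))"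
  let ?K = "{k. real k \<ge> X + 8 * real s * real n}"
  \<comment> \<open>The downward shift must not be truncated at zero, otherwise it would fail to be
    injective.\<close>
  have big: "k \<ge> 2 * ?m" if k: "k \<in> ?K" for k
  proof -
    have "real k \<ge> 4 * (real s * real n)" using k basic(6) mult_nonneg_nonneg[of "real s" "real n"] by simp
    then have "real (2 * ?m) \<le> real k" by simp
    then show ?thesis by (simp only: of_nat_le_iff)
  qed
  have "?N k * 9 ^ n \<le> ?N (k - 2 * ?m)" if k: "k \<in> ?K" for k
  proof -
    have "?N k * 9 ^ n \<le> ?N k * (1 + 2 / real s) ^ ?m"
      using nine_power_le[OF s1] by (intro mult_left_mono) auto
    also have "?N k = ?N (k - 2 * 0)" by simp
    also have "?N (k - 2 * 0) * (1 + 2 / real s) ^ ?m \<le> ?N (k - 2 * ?m)"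
    proof (rule power_ratio_chain[where N = "\<lambda>i. ?N (k - 2 * i)"])
      fix i assume i: "i < ?m"
      then have "real (Suc i) \<le> real (2 * (s * n))" by (intro of_nat_mono) simp
      then have ri: "real i + 1 \<le> 2 * (real s * real n)" by simp
      have i': "2 * Suc i \<le> k" using i big[OF k] by simp
      have "real (k - 2 * Suc i + 2) = real k - 2 * real i"
        using i' by (simp add: of_nat_diff)
      then have "real (k - 2 * Suc i + 2) \<ge> X + 4 * real s * real n" using k ri by simp
      then have "?N (k - 2 * Suc i + 2) * (1 + 2 / real s) \<le> ?N (k - 2 * Suc i)"
        by (rule ratio_down)
      moreover have "k - 2 * Suc i + 2 = k - 2 * i" using i' by simp
      ultimately show "?N (k - 2 * i) * (1 + 2 / real s) \<le> ?N (k - 2 * Suc i)"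
        by (simp only:)
    qed simp
    finally show ?thesis by simp
  qed
  moreover have "inj_on (\<lambda>k. k - 2 * ?m) ?K"
    using big by (intro inj_onI) (metis le_add_diff_inverse)
  ultimately show ?thesis
    using card_shift_tail[of "9 ^ n" "\<lambda>k. k - 2 * ?m" ?K n r A] by simp
qed

end

definition uniform_cuts :: "nat \<Rightarrow> nat \<Rightarrow> nat \<Rightarrow> graph \<Rightarrow> bool" where
  "uniform_cuts n r s G \<longleftrightarrow> (\<forall>A\<subseteq>vertices n.
     \<bar>real (card (edge_boundary n G A)) - real r * real (card A) * real (n - card A) / real n\<bar>
       \<le> 8 * real s * real n)"

text \<open>Each of the 2^n sets fails with probability at most 2 / 9^n.\<close>

lemma card_not_uniform_cuts:
  assumes "r \<ge> 3" "s \<ge> 1" "r \<le> s\<^sup>2" "r\<^sup>2 \<le> n"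
  shows "real (card {G \<in> regular_graphs n r. \<not> uniform_cuts n r s G}) \<le>
    real (card (regular_graphs n r)) * (2 * (2 / 9) ^ n)"
proof -
  let ?R = "regular_graphs n r"
  let ?X = "\<lambda>A. real r * real (card A) * real (n - card A) / real n"
  let ?L = "\<lambda>A. {G \<in> ?R. real (card (edge_boundary n G A)) \<le> ?X A - 8 * real s * real n}"
  let ?U = "\<lambda>A. {G \<in> ?R. real (card (edge_boundary n G A)) \<ge> ?X A + 8 * real s * real n}"
  have each: "real (card (?L A \<union> ?U A)) \<le> real (card ?R) * 2 / 9 ^ n" if A: "A \<subseteq> vertices n" for A
  proof -
    interpret cut_concentration n r s A using A assms by unfold_locales
    have "real (card (?L A \<union> ?U A)) \<le> real (card (?L A)) + real (card (?U A))"
      using card_Un_le[of "?L A" "?U A"] by linarith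
    moreover have "real (card (?L A)) \<le> real (card ?R) / 9 ^ n" "real (card (?U A)) \<le> real (card ?R) / 9 ^ n"
      using lower_tail upper_tail by (simp_all add: X_def a_def b_def field_simps)
    ultimately show ?thesis by linarith
  qed
  have "{G \<in> ?R. \<not> uniform_cuts n r s G} \<subseteq> (\<Union>A\<in>Pow (vertices n). ?L A \<union> ?U A)"
  proof
    fix G assume G: "G \<in> {G \<in> ?R. \<not> uniform_cuts n r s G}"
    then obtain A where A: "A \<subseteq> vertices n"
      "\<not> \<bar>real (card (edge_boundary n G A)) - ?X A\<bar> \<le> 8 * real s * real n"
      unfolding uniform_cuts_def by blast
    then have "real (card (edge_boundary n G A)) \<le> ?X A - 8 * real s * real n \<or>
        real (card (edge_boundary n G A)) \<ge> ?X A + 8 * real s * real n"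
      by linarith
    with G A(1) show "G \<in> (\<Union>A\<in>Pow (vertices n). ?L A \<union> ?U A)" by blast
  qed
  then have "card {G \<in> ?R. \<not> uniform_cuts n r s G} \<le> card (\<Union>A\<in>Pow (vertices n). ?L A \<union> ?U A)"
    by (intro card_mono) auto
  also have "\<dots> \<le> (\<Sum>A\<in>Pow (vertices n). card (?L A \<union> ?U A))"
    by (intro card_UN_le) simp
  finally have "real (card {G \<in> ?R. \<not> uniform_cuts n r s G}) \<le> (\<Sum>A\<in>Pow (vertices n). real (card (?L A \<union> ?U A)))"
    by (simp only: of_nat_sum[symmetric] of_nat_le_iff)
  also have "\<dots> \<le> (\<Sum>A\<in>Pow (vertices n). real (card ?R) * 2 / 9 ^ n)"
    by (intro sum_mono each) simp
  also have "\<dots> = real (card ?R) * (2 * (2 / 9) ^ n)"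
    by (simp add: card_Pow power_divide)
  finally show ?thesis .
qed

text \<open>Given the edges \<open>F\<close>, a further edge is present with probability of order \<open>r / n\<close>; hence closing edges
  of walks are rare and most vertices are treelike.\<close>

lemma card_adjoin_edge:
  assumes F: "finite F"  and uv: "{u, v} \<notin> F"
  shows "real (card {G \<in> regular_graphs n r. insert {u, v} F \<subseteq> G}) *
      (real (r * n) - real (2 * card F + 2 * (r * (r + 2)))) \<le>
    real (card {G \<in> regular_graphs n r. F \<subseteq> G}) * real (r * r)"
proof -
  let ?V = "vertices n" and ?\<G> = "{G \<in> regular_graphs n r. insert {u, v} F \<subseteq> G}"
  \<comment> \<open>The edge uv is switched away against an arc cd outside F. Of the r n arcs, at
    most 2 \<open>card F\<close> lie in F and at most 2 r (r + 2) come too close to u or v.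
    Backward, c and d are neighbours of u and v, which leaves r^2 choices.\<close>
  define T where "T = {(a, b, c, d). a = u \<and> b = v \<and> c \<in> ?V \<and> d \<in> ?V \<and> {c, d} \<notin> F}"
  have finT: "finite T"
    by (rule finite_subset[of _ "{u} \<times> {v} \<times> ?V \<times> ?V"]) (auto simp: T_def)
  show ?thesis
  proof (rule switch_double_count[where T = T])
    fix G a b c d assume *: "G \<in> ?\<G>" "(a, b, c, d) \<in> T" "switchable G a b c d"
    then have "switch G a b c d \<in> regular_graphs n r" by (intro switch_regular) auto
    moreover have "F \<subseteq> switch G a b c d" using * uv by (auto simp: T_def switch_def)
    ultimately show "switch G a b c d \<in> {G \<in> regular_graphs n r. F \<subseteq> G}" by simp
  next
    fix G assume "G \<in> ?\<G>"
    then have R: "G \<in> regular_graphs n r" and uvG: "{u, v} \<in> G" by auto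
    let ?S = "{(a, b, c, d). (a, b, c, d) \<in> T \<and> switchable G a b c d}"
    let ?W = "(\<lambda>(c, d). (u, v, c, d)) ` arcs G ?V ?V"
    let ?B1 = "\<Union>e\<in>F. {(a, b, c, d). a = u \<and> b = v \<and> {c, d} = e}"
    let ?B2 = "(\<lambda>(c, d). (u, v, c, d)) ` (SIGMA c:insert u (insert v (nbrs n G u)). nbrs n G c)"
    let ?B3 = "(\<lambda>(d, c). (u, v, c, d)) ` (SIGMA d:insert u (insert v (nbrs n G v)). nbrs n G d)"
    have cW: "card ?W = r * n"
      using card_arcs_vertices[OF R, of ?V] by (subst card_image) (auto simp: inj_on_def)
    have B1: "finite {(a, b, c, d). a = u \<and> b = v \<and> {c, d} = e}
        \<and> card {(a, b, c, d). a = u \<and> b = v \<and> {c, d} = e} \<le> 2" for e :: "nat set"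
    proof (cases "\<exists>c d. {c, d} = e")
      case True
      then obtain c d where e: "{c, d} = e" by blast
      have sub: "{(a, b, c, d). a = u \<and> b = v \<and> {c, d} = e} \<subseteq> {(u, v, c, d), (u, v, d, c)}"
        unfolding e[symmetric] by (auto simp: doubleton_eq_iff)
      have fin2: "finite {(u, v, c, d), (u, v, d, c)}" by simp
      have "card {(u, v, c, d), (u, v, d, c)} \<le> 2" by (cases "c = d") auto
      with card_mono[OF fin2 sub] finite_subset[OF sub fin2] show ?thesis by linarith
    next
      case False
      then have "{(a, b, c, d). a = u \<and> b = v \<and> {c, d} = e} = {}" by auto
      then show ?thesis by (simp only: card.empty finite.emptyI) simp
    qed
    have "card ?B1 \<le> (\<Sum>e\<in>F. card {(a, b, c, d). a = u \<and> b = v \<and> {c, d} = e})"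
      by (rule card_UN_le[OF F])
    also have "\<dots> \<le> (\<Sum>e\<in>F. 2)" using B1 by (intro sum_mono) blast
    finally have c1: "card ?B1 \<le> 2 * card F" by simp
    have c23: "card ?B2 \<le> (r + 2) * r" "card ?B3 \<le> (r + 2) * r"
    proof -
      have i: "card (insert u (insert v (nbrs n G w))) \<le> r + 2" for w
        using card_nbrs_le[OF R, of w] by (simp add: card_insert_if)
      show "card ?B2 \<le> (r + 2) * r"
        by (rule order.trans[OF card_le_image_Sigma[where m = r, OF _ _ _ order.refl] mult_le_mono1[OF i]])
          (use card_nbrs_le[OF R] in auto)
      show "card ?B3 \<le> (r + 2) * r"
        by (rule order.trans[OF card_le_image_Sigma[where m = r, OF _ _ _ order.refl] mult_le_mono1[OF i]])
          (use card_nbrs_le[OF R] in auto)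
    qed
    have fin: "finite ?S" "finite ?B1" "finite ?B2" "finite ?B3"
      using B1 F by (auto intro: finite_subset[OF _ finT])
    have uv': "u \<noteq> v" using regular_graph_edgeD[OF R uvG] by simp
    have "?W \<subseteq> ?S \<union> (?B1 \<union> (?B2 \<union> ?B3))"
    proof
      fix t assume "t \<in> ?W"
      then obtain c d where t: "t = (u, v, c, d)" "c \<in> ?V" "d \<in> ?V" "{c, d} \<in> G" by (auto simp: arcs_def)
      have "c \<noteq> d" using regular_graph_edgeD[OF R t(4)] by simp
      consider "{c, d} \<in> F" | "c \<in> insert u (insert v (nbrs n G u))" | "d \<in> insert u (insert v (nbrs n G v))"
        | "{c, d} \<notin> F" "c \<notin> insert u (insert v (nbrs n G u))" "d \<notin> insert u (insert v (nbrs n G v))"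
        by blast
      then show "t \<in> ?S \<union> (?B1 \<union> (?B2 \<union> ?B3))"
      proof cases
        case 1
        then show ?thesis using t by auto
      next
        case 2
        then have "t \<in> ?B2" using t by (intro image_eqI[of _ _ "(c, d)"]) (auto simp: nbrs_iff)
        then show ?thesis by blast
      next
        case 3
        then have "t \<in> ?B3" using t by (intro image_eqI[of _ _ "(d, c)"]) (auto simp: nbrs_iff insert_commute)
        then show ?thesis by blast
      next
        case 4
        then have "t \<in> ?S" using t uvG uv' \<open>c \<noteq> d\<close> by (auto simp: T_def switchable_def nbrs_iff)
        then show ?thesis by blast
      qed
    qed
    then have "card ?W \<le> card (?S \<union> (?B1 \<union> (?B2 \<union> ?B3)))" using fin by (intro card_mono finite_UnI) auto
    also have "\<dots> \<le> card ?S + (card ?B1 + (card ?B2 + card ?B3))"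
      by (meson card_Un_le add_left_mono order.trans)
    also have "\<dots> \<le> card ?S + (2 * card F + ((r + 2) * r + (r + 2) * r))"
      by (intro add_mono c1 c23 order.refl)
    finally have "r * n \<le> card ?S + (2 * card F + ((r + 2) * r + (r + 2) * r))" unfolding cW .
    then have "r * n \<le> card ?S + (2 * card F + 2 * (r * (r + 2)))" by (simp add: algebra_simps)
    then show "real (r * n) - real (2 * card F + 2 * (r * (r + 2))) \<le> real (card ?S)"
      by (simp only: diff_le_eq of_nat_add[symmetric] of_nat_le_iff)
  next
    fix G assume "G \<in> {G \<in> regular_graphs n r. F \<subseteq> G}"
    then have R: "G \<in> regular_graphs n r" by simp
    let ?S = "{(a, b, c, d). (a, b, c, d) \<in> T \<and> switchable G a c b d}"
    have "?S \<subseteq> (\<lambda>(c, d). (u, v, c, d)) ` (nbrs n G u \<times> nbrs n G v)"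
      by (force simp: T_def switchable_def nbrs_iff image_iff)
    then have "card ?S \<le> card (nbrs n G u \<times> nbrs n G v)"
      by (intro surj_card_le) auto
    also have "\<dots> \<le> r * r" by (simp add: card_cartesian_product mult_le_mono card_nbrs_le[OF R])
    finally show "real (card ?S) \<le> real (r * r)" by (rule of_nat_mono)
  qed (use finT in simp_all)
qed

section \<open>Walks and the edges that close them\<close>

fun wedges :: "nat list \<Rightarrow> nat set set" where
  "wedges (x # y # p) = insert {x, y} (wedges (y # p))"
| "wedges _ = {}"

text \<open>Walks are listed backwards: they end in their last element \<open>x\<close>, so that prolonging a walk
  away from \<open>x\<close> is a \<open>Cons\<close>.\<close>

definition walks :: "nat \<Rightarrow> graph \<Rightarrow> nat \<Rightarrow> nat \<Rightarrow> nat list set" where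
  "walks n G x k = {p. length p = Suc k \<and> last p = x \<and> set p \<subseteq> vertices n \<and> wedges p \<subseteq> G}"

text \<open>An edge between the ends of two short walks from \<open>x\<close> must already lie on one of them; otherwise
  it would close a short cycle near \<open>x\<close>.\<close>

definition treelike :: "nat \<Rightarrow> graph \<Rightarrow> nat \<Rightarrow> nat \<Rightarrow> bool" where
  "treelike n G k x \<longleftrightarrow> (\<forall>i\<le>k. \<forall>j\<le>k. \<forall>p\<in>walks n G x i. \<forall>q\<in>walks n G x j.
     {hd p, hd q} \<in> G \<longrightarrow> {hd p, hd q} \<in> wedges p \<union> wedges q)"

lemma wedges_Cons: "p \<noteq> [] \<Longrightarrow> wedges (x # p) = insert {x, hd p} (wedges p)"
  by (cases p) auto

lemma finite_wedges [simp]: "finite (wedges p)"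
  by (induction p rule: wedges.induct) auto

lemma card_wedges_le: "card (wedges p) \<le> length p"
proof (induction p rule: wedges.induct)
  case (1 x y p)
  then show ?case using card_insert_le_m1[of "Suc (length (y # p))" "wedges (y # p)" "{x, y}"] by simp
qed auto

lemma finite_lists_vertices: "finite {p. length p = m \<and> set p \<subseteq> vertices n}"
  using finite_lists_length_eq[OF finite_vertices[of n], of m] by (simp add: conj_commute)

lemma finite_walks [simp]: "finite (walks n G x k)"
  by (rule finite_subset[OF _ finite_lists_vertices[of "Suc k" n]]) (auto simp: walks_def)

lemma walks_0: "walks n G x 0 \<subseteq> {[x]}"
  by (auto simp: walks_def length_Suc_conv)

lemma walks_Suc: "walks n G x (Suc k) \<subseteq> (\<lambda>(p, v). v # p) ` (SIGMA p:walks n G x k. nbrs n G (hd p))"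
proof
  fix w assume w: "w \<in> walks n G x (Suc k)"
  then obtain v p where p: "w = v # p" "length p = Suc k" by (auto simp: walks_def length_Suc_conv)
  then have "p \<noteq> []" by auto
  then have "p \<in> walks n G x k" "v \<in> nbrs n G (hd p)"
    using w p by (auto simp: walks_def wedges_Cons nbrs_iff insert_commute)
  then show "w \<in> (\<lambda>(p, v). v # p) ` (SIGMA p:walks n G x k. nbrs n G (hd p))"
    using p by (intro image_eqI[of _ _ "(p, v)"]) auto
qed

lemma card_walks_le:
  assumes "G \<in> regular_graphs n r"
  shows "card (walks n G x k) \<le> r ^ k"
proof (induction k)
  case 0
  then show ?case using card_mono[OF _ walks_0[of n G x]] by simp
next
  case (Suc k)
  have "card (walks n G x (Suc k)) \<le> card (walks n G x k) * r"
    by (rule card_le_image_Sigma[OF _ _ _ walks_Suc]) (use card_nbrs_le[OF assms] in auto)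
  also have "\<dots> \<le> r ^ k * r" by (intro mult_right_mono Suc) simp
  finally show ?case by (simp add: mult.commute)
qed

lemma sum_card_swap:
  assumes "finite X" "finite Y"
  shows "(\<Sum>x\<in>X. card {y \<in> Y. P x y}) = (\<Sum>y\<in>Y. card {x \<in> X. P x y})"
proof -
  have "(\<Sum>x\<in>X. card {y \<in> Y. P x y}) = (\<Sum>x\<in>X. \<Sum>y\<in>Y. if P x y then 1 else 0)"
    using assms by (simp add: sum.If_cases Int_def)
  also have "\<dots> = (\<Sum>y\<in>Y. \<Sum>x\<in>X. if P x y then 1 else 0)" by (rule sum.swap)
  finally show ?thesis using assms by (simp add: sum.If_cases Int_def)
qed

text \<open>The witnesses against \<open>treelike\<close> for fixed walk lengths i and j.\<close>

definition excess :: "nat \<Rightarrow> graph \<Rightarrow> nat \<Rightarrow> nat \<Rightarrow> (nat \<times> nat list \<times> nat list) set" where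
  "excess n G i j = {(x, p, q). x \<in> vertices n \<and> p \<in> walks n G x i \<and> q \<in> walks n G x j \<and>
     {hd p, hd q} \<in> G \<and> {hd p, hd q} \<notin> wedges p \<union> wedges q}"

text \<open>A first moment bound. Triples of a vertex and two vertex lists are fixed before the
  graph; given the edges of the two walks, the closing edge has probability at most 2 r / n. A graph
  contains at most n r^(i + j) such triples, so n cancels. The second assumption lets the error in
  \<open>card_adjoin_edge\<close> consume at most half of r n.\<close>

lemma sum_card_excess_le:
  assumes n: "n \<ge> 1" "2 * (2 * (i + j + 2) + 2 * (r * (r + 2))) \<le> r * n"
  shows "(\<Sum>G\<in>regular_graphs n r. real (card (excess n G i j))) \<le>
    real (card (regular_graphs n r)) * (2 * real r ^ (i + j + 1))"
proof -
  let ?R = "regular_graphs n r" and ?V = "vertices n"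
  define \<Omega> where "\<Omega> = {(x, p, q). x \<in> ?V \<and> (length p = Suc i \<and> last p = x \<and> set p \<subseteq> ?V) \<and>
      (length q = Suc j \<and> last q = x \<and> set q \<subseteq> ?V)}"
  have fin\<Omega>: "finite \<Omega>"
    by (rule finite_subset[of _ "?V \<times> {p. length p = Suc i \<and> set p \<subseteq> ?V} \<times> {p. length p = Suc j \<and> set p \<subseteq> ?V}"])
       (auto simp: \<Omega>_def intro!: finite_cartesian_product finite_lists_vertices)
  define F where "F = (\<lambda>(x::nat, p, q). wedges p \<union> wedges q)"
  define e where "e = (\<lambda>(x::nat, p, q). {hd p, hd q :: nat})"
  define N where "N t = card {G \<in> ?R. F t \<subseteq> G}" for t
  have ex: "excess n G i j = {t \<in> \<Omega>. insert (e t) (F t) \<subseteq> G \<and> e t \<notin> F t}" for G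
    by (auto simp: excess_def \<Omega>_def walks_def F_def e_def)
  have each: "real (card {G \<in> ?R. insert (e t) (F t) \<subseteq> G \<and> e t \<notin> F t}) \<le> 2 * real r / real n * real (N t)"
    if t: "t \<in> \<Omega>" for t
  proof (cases "e t \<in> F t")
    case True
    then show ?thesis by simp
  next
    case False
    obtain x p q where xpq: "t = (x, p, q)" by (cases t)
    let ?M = "real (card {G \<in> ?R. insert (e t) (F t) \<subseteq> G})"
    have "card (F t) \<le> card (wedges p) + card (wedges q)" unfolding xpq F_def by (simp add: card_Un_le)
    also have "\<dots> \<le> i + j + 2" using card_wedges_le[of p] card_wedges_le[of q] t by (simp add: \<Omega>_def xpq)
    finally have "2 * (2 * card (F t) + 2 * (r * (r + 2))) \<le> r * n" using n(2) by simp
    then have "2 * real (2 * card (F t) + 2 * (r * (r + 2))) \<le> real (r * n)"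
      by (metis of_nat_le_iff of_nat_mult of_nat_numeral)
    then have "real r * real n / 2 \<le> real (r * n) - real (2 * card (F t) + 2 * (r * (r + 2)))"
    proof -
      have "w / 2 \<le> w - z" if "2 * z \<le> w" for w z :: real using that by simp
      then show ?thesis using \<open>2 * real (2 * card (F t) + 2 * (r * (r + 2))) \<le> real (r * n)\<close>
        by (simp only: of_nat_mult[of r n])
    qed
    then have "?M * (real r * real n / 2) \<le> ?M * (real (r * n) - real (2 * card (F t) + 2 * (r * (r + 2))))"
      by (rule mult_left_mono) simp
    also have "\<dots> \<le> real (N t) * real (r * r)"
      using card_adjoin_edge[of "F t" "hd p" "hd q" n r] False
      unfolding N_def by (simp add: xpq e_def F_def)
    finally have *: "?M * (real r * real n) \<le> real (N t) * (real r * real r) * 2" by simp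
    have "r > 0" using n by (cases r) auto
    then have "?M * real n \<le> real (N t) * real r * 2"
      using * by (simp add: mult_ac)
    then have "?M \<le> 2 * real r / real n * real (N t)"
      using n by (simp add: field_simps)
    then show ?thesis using False by simp
  qed
  have sub: "card {t \<in> \<Omega>. F t \<subseteq> G} \<le> n * (r ^ i * r ^ j)" if G: "G \<in> ?R" for G
  proof -
    have "{t \<in> \<Omega>. F t \<subseteq> G} \<subseteq> id ` (SIGMA x:?V. walks n G x i \<times> walks n G x j)"
      by (auto simp: \<Omega>_def F_def walks_def)
    then have "card {t \<in> \<Omega>. F t \<subseteq> G} \<le> card ?V * (r ^ i * r ^ j)"
      by (rule card_le_image_Sigma[rotated 3])
         (auto simp: card_cartesian_product intro!: mult_le_mono card_walks_le[OF G])
    then show ?thesis by simp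
  qed
  have "(\<Sum>G\<in>?R. real (card (excess n G i j))) = real (\<Sum>G\<in>?R. card (excess n G i j))" by simp
  also have "(\<Sum>G\<in>?R. card (excess n G i j)) = (\<Sum>t\<in>\<Omega>. card {G \<in> ?R. insert (e t) (F t) \<subseteq> G \<and> e t \<notin> F t})"
    unfolding ex by (rule sum_card_swap) (simp_all add: fin\<Omega>)
  also have "real \<dots> \<le> (\<Sum>t\<in>\<Omega>. 2 * real r / real n * real (N t))"
    unfolding of_nat_sum by (intro sum_mono each)
  also have "\<dots> = 2 * real r / real n * real (\<Sum>t\<in>\<Omega>. N t)" by (simp add: sum_distrib_left)
  also have "(\<Sum>t\<in>\<Omega>. N t) = (\<Sum>G\<in>?R. card {t \<in> \<Omega>. F t \<subseteq> G})"
    unfolding N_def by (rule sum_card_swap[symmetric]) (simp_all add: fin\<Omega>)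
  also have "2 * real r / real n * real \<dots> \<le> 2 * real r / real n * real (\<Sum>G\<in>?R. n * (r ^ i * r ^ j))"
    by (intro mult_left_mono of_nat_mono sum_mono sub) auto
  also have "\<dots> = real (card ?R) * (2 * real r ^ (i + j + 1))"
    using n by (simp add: power_add)
  finally show ?thesis .
qed

lemma card_not_treelike_le:
  "card {x \<in> vertices n. \<not> treelike n G k x} \<le> (\<Sum>i\<le>k. \<Sum>j\<le>k. card (excess n G i j))"
proof -
  have fin: "finite (excess n G i j)" for i j
    by (rule finite_subset[of _ "SIGMA x:vertices n. walks n G x i \<times> walks n G x j"])
       (auto simp: excess_def)
  have "{x \<in> vertices n. \<not> treelike n G k x} \<subseteq> (\<Union>i\<le>k. \<Union>j\<le>k. fst ` excess n G i j)"
  proof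
    fix x assume "x \<in> {x \<in> vertices n. \<not> treelike n G k x}"
    then obtain i j p q where *: "i \<le> k" "j \<le> k" "(x, p, q) \<in> excess n G i j"
      by (auto simp: treelike_def excess_def)
    then show "x \<in> (\<Union>i\<le>k. \<Union>j\<le>k. fst ` excess n G i j)" by force
  qed
  then have "card {x \<in> vertices n. \<not> treelike n G k x} \<le> card (\<Union>i\<le>k. \<Union>j\<le>k. fst ` excess n G i j)"
    using fin by (intro card_mono) auto
  also have "\<dots> \<le> (\<Sum>i\<le>k. card (\<Union>j\<le>k. fst ` excess n G i j))" by (intro card_UN_le) simp
  also have "\<dots> \<le> (\<Sum>i\<le>k. \<Sum>j\<le>k. card (fst ` excess n G i j))" by (intro sum_mono card_UN_le) simp
  also have "\<dots> \<le> (\<Sum>i\<le>k. \<Sum>j\<le>k. card (excess n G i j))" by (intro sum_mono card_image_le fin)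
  finally show ?thesis .
qed

text \<open>Markov's inequality; for fixed r, k and \<gamma> the proportion is of order 1 /
  n.\<close>

lemma card_many_not_treelike:
  fixes \<gamma> :: real
  assumes n: "n \<ge> 1" "2 * (2 * (2 * k + 2) + 2 * (r * (r + 2))) \<le> r * n" and "\<gamma> > 0"
  shows "real (card {G \<in> regular_graphs n r. real (card {x \<in> vertices n. \<not> treelike n G k x}) > \<gamma> * real n}) \<le>
    real (card (regular_graphs n r)) * ((\<Sum>i\<le>k. \<Sum>j\<le>k. 2 * real r ^ (i + j + 1)) / (\<gamma> * real n))"
proof -
  let ?R = "regular_graphs n r" and ?b = "\<lambda>G. real (card {x \<in> vertices n. \<not> treelike n G k x})"
  let ?C = "\<Sum>i\<le>k. \<Sum>j\<le>k. 2 * real r ^ (i + j + 1)"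
  let ?E = "{G \<in> ?R. ?b G > \<gamma> * real n}"
  have "real (card ?E) * (\<gamma> * real n) = (\<Sum>G\<in>?E. \<gamma> * real n)" by simp
  also have "\<dots> \<le> (\<Sum>G\<in>?E. ?b G)" by (intro sum_mono) auto
  also have "\<dots> \<le> (\<Sum>G\<in>?R. ?b G)" by (intro sum_mono2) auto
  also have "\<dots> \<le> (\<Sum>G\<in>?R. \<Sum>i\<le>k. \<Sum>j\<le>k. real (card (excess n G i j)))"
    using of_nat_mono[OF card_not_treelike_le, where 'a = real] by (intro sum_mono) simp
  also have "\<dots> = (\<Sum>i\<le>k. \<Sum>G\<in>?R. \<Sum>j\<le>k. real (card (excess n G i j)))" by (rule sum.swap)
  also have "\<dots> = (\<Sum>i\<le>k. \<Sum>j\<le>k. \<Sum>G\<in>?R. real (card (excess n G i j)))"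
    by (intro sum.cong refl) (rule sum.swap)
  also have "\<dots> \<le> (\<Sum>i\<le>k. \<Sum>j\<le>k. real (card ?R) * (2 * real r ^ (i + j + 1)))"
    by (intro sum_mono sum_card_excess_le n(1) order.trans[OF _ n(2)]) auto
  also have "\<dots> = real (card ?R) * ?C" by (simp add: sum_distrib_left)
  finally show ?thesis using n assms(3) by (simp add: field_simps)
qed

section \<open>Graph distance and treelike vertices\<close>

abbreviation adj :: "graph \<Rightarrow> (nat \<times> nat) set" where
  "adj G \<equiv> {(u, v). {u, v} \<in> G}"

definition connected_graph :: "nat \<Rightarrow> graph \<Rightarrow> bool" where
  "connected_graph n G \<longleftrightarrow> (\<forall>x\<in>vertices n. \<forall>y\<in>vertices n. \<exists>k. (x, y) \<in> adj G ^^ k)"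

lemma cheeger_le:
  assumes "A \<subseteq> vertices n" "1 \<le> card A" "real (card A) \<le> real n / 2"
  shows "cheeger n G * real (card A) \<le> real (card (edge_boundary n G A))"
proof -
  let ?f = "\<lambda>A. real (card (edge_boundary n G A)) / real (card A)"
  let ?P = "{A. A \<subseteq> vertices n \<and> 1 \<le> card A \<and> real (card A) \<le> real n / 2}"
  have "finite ?P" by (rule finite_subset[of _ "Pow (vertices n)"]) auto
  then have "Min (?f ` ?P) \<le> ?f A" using assms by (intro Min_le) auto
  moreover have "cheeger n G = Min (?f ` ?P)"
    unfolding cheeger_def by (rule arg_cong[where f = Min]) auto
  ultimately show ?thesis using assms by (simp add: field_simps)
qed

text \<open>If some vertex is unreachable from x, then the component of x or its complement has at
  most n / 2 vertices, and both have empty boundary.\<close>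

lemma connected_graph_if_cheeger_pos:
  assumes "cheeger n G > 0"
  shows "connected_graph n G"
  unfolding connected_graph_def
proof (intro ballI, rule ccontr)
  fix x y assume x: "x \<in> vertices n" and y: "y \<in> vertices n" and no: "\<nexists>k. (x, y) \<in> adj G ^^ k"
  define C where "C = {z \<in> vertices n. \<exists>k. (x, z) \<in> adj G ^^ k}"
  have xC: "x \<in> C" using x by (auto simp: C_def intro: exI[of _ 0])
  have yC: "y \<notin> C" using no by (auto simp: C_def)
  have step: "w \<in> C" if uw: "u \<in> C" "{u, w} \<in> G" "w \<in> vertices n" for u w
  proof -
    obtain k where "(x, u) \<in> adj G ^^ k" using uw(1) unfolding C_def by blast
    then have "(x, w) \<in> adj G ^^ Suc k" by (rule relpow_Suc_I) (simp add: uw)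
    then show ?thesis using uw unfolding C_def by blast
  qed
  have sub: "C \<subseteq> vertices n" by (auto simp: C_def)
  then have finC: "finite C" using finite_subset finite_vertices by blast
  have b1: "edge_boundary n G C = {}" using step by (auto simp: edge_boundary_def)
  have b2: "edge_boundary n G (vertices n - C) = {}"
    using step by (auto simp: edge_boundary_def insert_commute)
  have c: "card C + card (vertices n - C) = n"
    using card_mono[OF finite_vertices sub] by (simp add: card_Diff_subset finC sub)
  have "card C \<ge> 1" "card (vertices n - C) \<ge> 1"
    using xC yC y finC by (auto simp: Suc_le_eq card_gt_0_iff)
  moreover have "real (card C) \<le> real n / 2 \<or> real (card (vertices n - C)) \<le> real n / 2"
  proof -
    have "a \<le> m / 2 \<or> b \<le> m / 2" if "a + b = m" for a b m :: real using that by simp argo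
    then show ?thesis using c by (metis of_nat_add)
  qed
  ultimately consider "1 \<le> card C" "real (card C) \<le> real n / 2"
    | "1 \<le> card (vertices n - C)" "real (card (vertices n - C)) \<le> real n / 2" by blast
  then show False
  proof cases
    case 1
    from cheeger_le[OF sub this, of G] have "cheeger n G * real (card C) \<le> 0" by (simp add: b1)
    moreover have "cheeger n G * real (card C) > 0" using 1 assms by (intro mult_pos_pos) auto
    ultimately show False by linarith
  next
    case 2
    from cheeger_le[OF Diff_subset this, of G] have "cheeger n G * real (card (vertices n - C)) \<le> 0"
      by (simp only: b2) simp
    moreover have "cheeger n G * real (card (vertices n - C)) > 0" using 2 assms by (intro mult_pos_pos) auto
    ultimately show False by linarith
  qed
qed

lemma adj_relpow_sym: "(x, y) \<in> adj G ^^ k \<Longrightarrow> (y, x) \<in> adj G ^^ k"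
proof (induction k arbitrary: y)
  case (Suc k)
  obtain z where z: "(x, z) \<in> adj G ^^ k" "(z, y) \<in> adj G"
    using Suc.prems by (rule relpow_Suc_E)
  have "(y, z) \<in> adj G" using z(2) by (simp add: insert_commute)
  then show ?case using Suc.IH[OF z(1)] by (rule relpow_Suc_I2)
qed simp

lemma graph_dist_sym: "graph_dist G x y = graph_dist G y x"
proof -
  have "(x, y) \<in> adj G ^^ k \<longleftrightarrow> (y, x) \<in> adj G ^^ k" for k
    by (rule iffI) (erule adj_relpow_sym)+
  then show ?thesis unfolding graph_dist_def by presburger
qed

lemma graph_dist_le: "(x, y) \<in> adj G ^^ k \<Longrightarrow> graph_dist G x y \<le> k"
  unfolding graph_dist_def by (rule Least_le)

lemma graph_dist_self [simp]: "graph_dist G x x = 0"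
  using graph_dist_le[of x x 0 G] by simp

section \<open>Spheres around a vertex\<close>

definition level :: "nat \<Rightarrow> graph \<Rightarrow> nat \<Rightarrow> nat \<Rightarrow> nat set" where
  "level n G x j = {y \<in> vertices n. graph_dist G x y = j}"

lemma finite_level [simp]: "finite (level n G x j)"
  by (simp add: level_def)

locale connected_regular =
  fixes n r :: nat and G :: graph
  assumes regular: "G \<in> regular_graphs n r" and connected: "connected_graph n G"
begin

abbreviation V where "V \<equiv> vertices n"
abbreviation dist where "dist \<equiv> graph_dist G"

lemma dist_relpow:
  assumes "x \<in> V" "y \<in> V"
  shows "(x, y) \<in> adj G ^^ dist x y"
  unfolding graph_dist_def
  by (rule LeastI_ex) (use connected assms in \<open>unfold connected_graph_def, blast\<close>)

lemma dist_eq_0: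
  assumes "x \<in> V" "y \<in> V" "dist x y = 0"
  shows "x = y"
  using dist_relpow[OF assms(1,2)] unfolding assms(3) by simp

lemma dist_edge:
  assumes "x \<in> V" "{y, z} \<in> G"
  shows "dist x z \<le> Suc (dist x y)"
proof -
  have "y \<in> V" using regular_graph_edgeD[OF regular assms(2)] by simp
  then have "(x, y) \<in> adj G ^^ dist x y" using assms by (intro dist_relpow)
  then have "(x, z) \<in> adj G ^^ Suc (dist x y)" by (rule relpow_Suc_I) (simp add: assms)
  then show ?thesis by (rule graph_dist_le)
qed

lemma dist_pred:
  assumes "x \<in> V" "y \<in> V" "dist x y = Suc j"
  obtains z where "z \<in> V" "{z, y} \<in> G" "dist x z = j"
proof -
  have "(x, y) \<in> adj G ^^ Suc j" using dist_relpow[OF assms(1,2)] unfolding assms(3) .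
  then obtain z where "(x, z) \<in> adj G ^^ j" "(z, y) \<in> adj G" by (rule relpow_Suc_E)
  then have z: "(x, z) \<in> adj G ^^ j" "{z, y} \<in> G" by simp_all
  have "dist x z \<le> j" using z(1) by (rule graph_dist_le)
  moreover have "dist x y \<le> Suc (dist x z)" using assms(1) z(2) by (rule dist_edge)
  ultimately show ?thesis
    using that[of z] z(2) assms(3) regular_graph_edgeD[OF regular z(2)] by simp
qed

lemma dist_eq_1_iff:
  assumes "x \<in> V" "y \<in> V"
  shows "dist x y = 1 \<longleftrightarrow> {x, y} \<in> G"
proof
  assume "dist x y = 1"
  then obtain z where "z \<in> V" "{z, y} \<in> G" "dist x z = 0" using dist_pred[OF assms, of 0] by auto
  then show "{x, y} \<in> G" using dist_eq_0[of x z] assms by simp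
next
  assume e: "{x, y} \<in> G"
  then have "dist x y \<le> 1" using dist_edge[OF assms(1) e] by simp
  moreover have "dist x y \<noteq> 0" using dist_eq_0[OF assms] regular_graph_edgeD(3)[OF regular e] by auto
  ultimately show "dist x y = 1" by simp
qed

text \<open>Beyond the first sphere, every vertex spends one of its r neighbours on a
  predecessor.\<close>

lemma card_level_Suc_le:
  assumes "x \<in> V"
  shows "card (level n G x (Suc j)) \<le> r * (r - 1) ^ j"
proof (induction j)
  case 0
  have "level n G x (Suc 0) \<subseteq> nbrs n G x"
    using dist_eq_1_iff[OF assms] by (auto simp: level_def nbrs_iff)
  then have "card (level n G x (Suc 0)) \<le> card (nbrs n G x)" by (rule card_mono[OF finite_nbrs])
  then show ?case using card_nbrs_le[OF regular, of x] by simp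
next
  case (Suc j)
  have "level n G x (Suc (Suc j)) \<subseteq> snd ` (SIGMA y:level n G x (Suc j). nbrs n G y - level n G x j)"
  proof
    fix z assume z: "z \<in> level n G x (Suc (Suc j))"
    then obtain y where y: "y \<in> V" "{y, z} \<in> G" "dist x y = Suc j"
      using dist_pred[OF assms, of z "Suc j"] by (auto simp: level_def)
    then have "(y, z) \<in> (SIGMA y:level n G x (Suc j). nbrs n G y - level n G x j)"
      using z by (auto simp: level_def nbrs_iff)
    then show "z \<in> snd ` (SIGMA y:level n G x (Suc j). nbrs n G y - level n G x j)"
      by (intro image_eqI[of _ _ "(y, z)"]) simp_all
  qed
  then have "card (level n G x (Suc (Suc j))) \<le> card (level n G x (Suc j)) * (r - 1)"
  proof (rule card_le_image_Sigma[rotated 3])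
    fix y assume y: "y \<in> level n G x (Suc j)"
    then obtain u where u: "u \<in> V" "{u, y} \<in> G" "dist x u = j"
      using dist_pred[OF assms, of y j] by (auto simp: level_def)
    then have "u \<in> nbrs n G y \<inter> level n G x j" by (auto simp: nbrs_iff level_def insert_commute)
    then have "card (nbrs n G y - level n G x j) < card (nbrs n G y)"
      by (intro psubset_card_mono) auto
    then show "card (nbrs n G y - level n G x j) \<le> r - 1"
      using card_nbrs_le[OF regular, of y] by linarith
  qed auto
  also have "\<dots> \<le> r * (r - 1) ^ j * (r - 1)" by (intro mult_right_mono Suc) simp
  finally show ?case by (simp add: mult_ac)
qed

text \<open>The condition on the edges is what makes geodesics useful here: neither an edge within a
  sphere nor one reaching beyond distance j can lie on such a walk.\<close>

lemma geodesic:
  assumes "x \<in> V" "y \<in> V" "dist x y = j"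
  shows "\<exists>p\<in>walks n G x j. hd p = y \<and>
    (\<forall>e\<in>wedges p. \<exists>u v. e = {u, v} \<and> dist x u < dist x v \<and> dist x v \<le> j)"
  using assms(2,3)
proof (induction j arbitrary: y)
  case 0
  then have "y = x" using dist_eq_0[of x y] assms(1) by simp
  then show ?case using assms(1) by (intro bexI[of _ "[x]"]) (auto simp: walks_def)
next
  case (Suc j)
  obtain z where z: "z \<in> V" "{z, y} \<in> G" "dist x z = j" using dist_pred[OF assms(1) Suc.prems] .
  obtain p where p: "p \<in> walks n G x j" "hd p = z"
    "\<forall>e\<in>wedges p. \<exists>u v. e = {u, v} \<and> dist x u < dist x v \<and> dist x v \<le> j"
    using Suc.IH[OF z(1,3)] by blast
  have ne: "p \<noteq> []" using p by (auto simp: walks_def)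
  have w: "wedges (y # p) = insert {z, y} (wedges p)" using ne p by (simp add: wedges_Cons insert_commute)
  show ?case
  proof (intro bexI conjI ballI)
    show "y # p \<in> walks n G x (Suc j)" using p(1) z Suc.prems ne by (simp add: walks_def w)
    fix e assume "e \<in> wedges (y # p)"
    then consider "e = {z, y}" | "e \<in> wedges p" using w by auto
    then show "\<exists>u v. e = {u, v} \<and> dist x u < dist x v \<and> dist x v \<le> Suc j"
    proof cases
      case 1
      then show ?thesis using z Suc.prems by (intro exI[of _ z] exI[of _ y]) simp
    next
      case 2
      then show ?thesis using p(3) by (meson le_SucI)
    qed
  qed simp
qed

text \<open>An edge yz within a sphere would have to lie on a geodesic to y or z, but the edges of
  geodesics join different distances.\<close>

lemma treelike_no_sibling:
  assumes t: "treelike n G k x" and x: "x \<in> V" and d: "dist x y = j" "dist x z = j" "j \<le> k"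
  shows "{y, z} \<notin> G"
proof
  assume e: "{y, z} \<in> G"
  then have yz: "y \<in> V" "z \<in> V" using regular_graph_edgeD[OF regular] by auto
  obtain p where p: "p \<in> walks n G x j" "hd p = y"
    "\<forall>e\<in>wedges p. \<exists>u v. e = {u, v} \<and> dist x u < dist x v \<and> dist x v \<le> j"
    using geodesic[OF x yz(1) d(1)] by blast
  obtain q where q: "q \<in> walks n G x j" "hd q = z"
    "\<forall>e\<in>wedges q. \<exists>u v. e = {u, v} \<and> dist x u < dist x v \<and> dist x v \<le> j"
    using geodesic[OF x yz(2) d(2)] by blast
  have "{y, z} \<in> wedges p \<union> wedges q" using t p q e d(3) unfolding treelike_def by blast
  then obtain u v where "{y, z} = {u, v}" "dist x u < dist x v" using p(3) q(3) by blast
  then show False using d by (auto simp: doubleton_eq_iff)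
qed

text \<open>If v were a second parent, the geodesic to u prolonged by y, together with a geodesic to
  v, would have to contain the edge yv. That edge differs from uy, and the geodesics themselves do
  not reach distance j + 1.\<close>

lemma treelike_parent_unique:
  assumes t: "treelike n G k x" and x: "x \<in> V" and y: "dist x y = Suc j" "Suc j \<le> k"
    and u: "dist x u = j" "{u, y} \<in> G" and v: "dist x v = j" "{v, y} \<in> G"
  shows "u = v"
proof (rule ccontr)
  assume "u \<noteq> v"
  have V: "u \<in> V" "v \<in> V" "y \<in> V"
    using regular_graph_edgeD[OF regular u(2)] regular_graph_edgeD[OF regular v(2)] by auto
  obtain p where p: "p \<in> walks n G x j" "hd p = u"
    "\<forall>e\<in>wedges p. \<exists>u v. e = {u, v} \<and> dist x u < dist x v \<and> dist x v \<le> j"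
    using geodesic[OF x V(1) u(1)] by blast
  obtain q where q: "q \<in> walks n G x j" "hd q = v"
    "\<forall>e\<in>wedges q. \<exists>u v. e = {u, v} \<and> dist x u < dist x v \<and> dist x v \<le> j"
    using geodesic[OF x V(2) v(1)] by blast
  have ne: "p \<noteq> []" using p by (auto simp: walks_def)
  have w: "wedges (y # p) = insert {u, y} (wedges p)" using ne p by (simp add: wedges_Cons insert_commute)
  have yp: "y # p \<in> walks n G x (Suc j)" using p(1) u V ne by (simp add: walks_def w)
  have "{hd (y # p), hd q} \<in> G" using v q by (simp add: insert_commute)
  moreover have "j \<le> k" using y by simp
  ultimately have "{y, v} \<in> wedges (y # p) \<union> wedges q"
    using t yp q(1,2) y(2) unfolding treelike_def by fastforce
  moreover have "{y, v} \<noteq> {u, y}" using \<open>u \<noteq> v\<close> by (auto simp: doubleton_eq_iff)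
  ultimately have "{y, v} \<in> wedges p \<union> wedges q" by (simp add: w)
  then obtain a b where ab: "{y, v} = {a, b}" "dist x a < dist x b" "dist x b \<le> j" using p(3) q(3) by blast
  then have "dist x y \<le> j" by (auto simp: doubleton_eq_iff)
  then show False using y by simp
qed

text \<open>Neighbours of y have distance j - 1, j or j + 1; the middle case is a sibling and the
  first a parent.\<close>

lemma treelike_back_neighbour:
  assumes t: "treelike n G k x" and x: "x \<in> V" and y: "y \<in> level n G x j" "j < k"
  shows "card (nbrs n G y - level n G x (Suc j)) \<le> 1"
proof -
  have "u = v" if u: "u \<in> nbrs n G y - level n G x (Suc j)" and v: "v \<in> nbrs n G y - level n G x (Suc j)" for u v
  proof -
    have bk: "\<exists>i. j = Suc i \<and> dist x w = i \<and> {w, y} \<in> G" if w: "w \<in> nbrs n G y - level n G x (Suc j)" for w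
    proof -
      have e: "{y, w} \<in> G" "{w, y} \<in> G" "w \<in> V" using w by (auto simp: nbrs_iff insert_commute)
      have "dist x w \<le> Suc j" "j \<le> Suc (dist x w)"
        using dist_edge[OF x e(1)] dist_edge[OF x e(2)] y by (auto simp: level_def)
      moreover have "dist x w \<noteq> Suc j" using w e by (auto simp: level_def)
      moreover have "dist x w \<noteq> j"
        using treelike_no_sibling[OF t x, of y j w] y e by (auto simp: level_def)
      ultimately have "j = Suc (dist x w)" by simp
      then show ?thesis using e by blast
    qed
    obtain i where i: "j = Suc i" "dist x u = i" "{u, y} \<in> G" using bk[OF u] by blast
    have "dist x v = i" "{v, y} \<in> G" using bk[OF v] i by auto
    then show "u = v" using treelike_parent_unique[OF t x, of y i u v] i y by (auto simp: level_def)
  qed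
  then show ?thesis by (subst One_nat_def, subst card_le_Suc0_iff_eq) auto
qed

text \<open>Of c neighbours in T at most one fails to lie in the next sphere, and by uniqueness of
  parents different vertices have disjoint sets of children. Hence the factor c - 1.\<close>

lemma treelike_level_growth:
  fixes c :: real
  assumes t: "treelike n G k x" and x: "x \<in> V" and j: "j < k"
    and S: "\<And>y. y \<in> S \<Longrightarrow> c \<le> real (card (nbrs n G y \<inter> T))"
  shows "real (card (level n G x j \<inter> S)) * (c - 1) \<le> real (card (level n G x (Suc j) \<inter> T))"
proof -
  let ?D = "\<lambda>y. nbrs n G y \<inter> T \<inter> level n G x (Suc j)"
  have each: "c - 1 \<le> real (card (?D y))" if y: "y \<in> level n G x j \<inter> S" for y
  proof -
    have "nbrs n G y \<inter> T \<subseteq> ?D y \<union> (nbrs n G y - level n G x (Suc j))" by auto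
    then have "card (nbrs n G y \<inter> T) \<le> card (?D y \<union> (nbrs n G y - level n G x (Suc j)))"
      by (intro card_mono) auto
    also have "\<dots> \<le> card (?D y) + card (nbrs n G y - level n G x (Suc j))" by (rule card_Un_le)
    also have "\<dots> \<le> card (?D y) + 1"
      using treelike_back_neighbour[OF t x _ j, of y] y by simp
    finally show ?thesis using S[of y] y by simp
  qed
  have "real (card (level n G x j \<inter> S)) * (c - 1) = (\<Sum>y\<in>level n G x j \<inter> S. c - 1)" by simp
  also have "\<dots> \<le> (\<Sum>y\<in>level n G x j \<inter> S. real (card (?D y)))" by (intro sum_mono each)
  also have "\<dots> = real (card (\<Union>y\<in>level n G x j \<inter> S. ?D y))"
  proof (subst card_UN_disjoint)
    show "\<forall>y\<in>level n G x j \<inter> S. \<forall>z\<in>level n G x j \<inter> S. y \<noteq> z \<longrightarrow> ?D y \<inter> ?D z = {}"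
    proof (intro ballI impI equals0I)
      fix y z w assume yz: "y \<in> level n G x j \<inter> S" "z \<in> level n G x j \<inter> S" "y \<noteq> z" and w: "w \<in> ?D y \<inter> ?D z"
      have "y = z"
        by (rule treelike_parent_unique[OF t x, of w j]) (use yz w j in \<open>auto simp: level_def nbrs_iff\<close>)
      then show False using yz by simp
    qed
  qed auto
  also have "\<dots> \<le> real (card (level n G x (Suc j) \<inter> T))"
    by (intro of_nat_mono card_mono) auto
  finally show ?thesis .
qed

text \<open>The index of S falls as the distance grows: the root lies in \<open>S k\<close>, its
  tree at distance j is counted in \<open>S (k - j)\<close>, and the leaves arrive in
  \<open>S 0\<close>.\<close>

lemma treelike_level_chain:
  fixes c :: "nat \<Rightarrow> real"
  assumes t: "treelike n G k x" and x: "x \<in> V" "x \<in> S k" and c: "\<And>i. i < k \<Longrightarrow> c i \<ge> 1"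
    and S: "\<And>i y. i < k \<Longrightarrow> y \<in> S (Suc i) \<Longrightarrow> c i \<le> real (card (nbrs n G y \<inter> S i))"
  shows "(\<Prod>i<k. c i - 1) \<le> real (card (level n G x k \<inter> S 0))"
proof -
  have "(\<Prod>i\<in>{k - j..<k}. c i - 1) \<le> real (card (level n G x j \<inter> S (k - j)))" if "j \<le> k" for j
    using that
  proof (induction j)
    case 0
    have "x \<in> level n G x 0 \<inter> S k" using x by (simp add: level_def)
    then have "card (level n G x 0 \<inter> S k) \<ge> 1" by (auto simp: Suc_le_eq card_gt_0_iff)
    then show ?case by simp
  next
    case (Suc j)
    have eq: "{k - Suc j..<k} = insert (k - Suc j) {k - j..<k}" "k - j = Suc (k - Suc j)" using Suc.prems by auto
    have "(\<Prod>i\<in>{k - Suc j..<k}. c i - 1) = (\<Prod>i\<in>{k - j..<k}. c i - 1) * (c (k - Suc j) - 1)"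
      unfolding eq(1) using eq(2) by (subst prod.insert) auto
    also have "\<dots> \<le> real (card (level n G x j \<inter> S (k - j))) * (c (k - Suc j) - 1)"
      using Suc c[of "k - Suc j"] by (intro mult_right_mono) auto
    also have "\<dots> \<le> real (card (level n G x (Suc j) \<inter> S (k - Suc j)))"
    proof (rule treelike_level_growth[OF t x(1)])
      show "c (k - Suc j) \<le> real (card (nbrs n G y \<inter> S (k - Suc j)))" if "y \<in> S (k - j)" for y
        using S[of "k - Suc j" y] that eq(2) Suc.prems by simp
    qed (use Suc.prems in simp)
    finally show ?case .
  qed
  from this[of k] show ?thesis by (simp add: atLeast0LessThan)
qed

end

section \<open>Edge counts between vertex sets, deduced from cuts\<close>

context connected_regular
begin

text \<open>An edge between X and Y belongs to both cuts on the left but not to the cut of the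
  union.\<close>

lemma cut_Un_disjoint:
  assumes "X \<subseteq> V" "Y \<subseteq> V" "X \<inter> Y = {}"
  shows "card (edge_boundary n G X) + card (edge_boundary n G Y) =
    card (edge_boundary n G (X \<union> Y)) + 2 * card (arcs G X Y)"
proof -
  let ?Z = "V - (X \<union> Y)"
  have fin: "finite X" "finite Y" using assms finite_subset finite_vertices by blast+
  have "V - X = Y \<union> ?Z" "V - Y = X \<union> ?Z" using assms by auto
  moreover have "card (arcs G X (Y \<union> ?Z)) = card (arcs G X Y) + card (arcs G X ?Z)"
    by (rule card_arcs_Un) (use fin in auto)
  moreover have "card (arcs G Y (X \<union> ?Z)) = card (arcs G Y X) + card (arcs G Y ?Z)"
    by (rule card_arcs_Un) (use fin in auto)
  moreover have "card (arcs G (X \<union> Y) ?Z) = card (arcs G X ?Z) + card (arcs G Y ?Z)"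
    by (rule card_arcs_Un_left) (use fin assms in auto)
  ultimately show ?thesis
    unfolding edge_boundary_eq_arcs using card_arcs_swap[of G Y X] by simp
qed

text \<open>The typical cut size r x (n - x) / n obeys the same identity as the cuts themselves,
  with r x y / n for the edges between. Three errors of 8 s n, halved, make 12 s n.\<close>

lemma arcs_disjoint_bounds:
  assumes cuts: "uniform_cuts n r s G" and n: "n > 0"
    and XY: "X \<subseteq> V" "Y \<subseteq> V" "X \<inter> Y = {}"
  shows "\<bar>real (card (arcs G X Y)) - real r * real (card X) * real (card Y) / real n\<bar> \<le> 12 * real s * real n"
proof -
  have fin: "finite X" "finite Y" using XY finite_subset finite_vertices by blast+
  let ?f = "\<lambda>x. real r * x * (real n - x) / real n"
  have cut: "\<bar>real (card (edge_boundary n G A)) - ?f (real (card A))\<bar> \<le> 8 * real s * real n"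
    if "A \<subseteq> V" for A
  proof -
    have "card A \<le> n" using card_mono[OF finite_vertices that] by simp
    then have "real (n - card A) = real n - real (card A)" by (rule of_nat_diff)
    then show ?thesis using cuts[unfolded uniform_cuts_def, rule_format, OF that] by (simp only:)
  qed
  define x where "x = real (card X)"
  define y where "y = real (card Y)"
  have cXY: "real (card (X \<union> Y)) = x + y" using fin XY by (simp add: card_Un_disjoint x_def y_def)
  have "real (card (edge_boundary n G X)) + real (card (edge_boundary n G Y)) =
      real (card (edge_boundary n G (X \<union> Y))) + 2 * real (card (arcs G X Y))"
    using cut_Un_disjoint[OF XY] by (metis of_nat_add of_nat_mult of_nat_numeral)
  moreover have "?f x + ?f y - ?f (x + y) = 2 * (real r * x * y / real n)"
    using n by (simp add: field_simps)
  moreover have "\<bar>real (card (edge_boundary n G X)) - ?f x\<bar> \<le> 8 * real s * real n"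
    "\<bar>real (card (edge_boundary n G Y)) - ?f y\<bar> \<le> 8 * real s * real n"
    using cut[OF XY(1)] cut[OF XY(2)] by (simp_all add: x_def y_def)
  moreover have "\<bar>real (card (edge_boundary n G (X \<union> Y))) - ?f (x + y)\<bar> \<le> 8 * real s * real n"
    using cut[of "X \<union> Y"] XY(1,2) unfolding cXY by simp
  ultimately show ?thesis unfolding x_def[symmetric] y_def[symmetric] by argo
qed

text \<open>Here B and S may overlap. The arcs from the overlap into S are all its arcs except those
  into the complement of S, again a disjoint pair; two errors of 12 s n add up.\<close>

lemma arcs_lower:
  assumes cuts: "uniform_cuts n r s G" and n: "n > 0" and BS: "B \<subseteq> V" "S \<subseteq> V"
  shows "real (card (arcs G B S)) \<ge> real r * real (card B) * real (card S) / real n - 24 * real s * real n"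
proof -
  let ?B1 = "B - S" and ?B2 = "B \<inter> S"
  have fin: "finite B" "finite S" using BS finite_subset finite_vertices by blast+
  have "card (arcs G (?B1 \<union> ?B2) S) = card (arcs G ?B1 S) + card (arcs G ?B2 S)"
    by (rule card_arcs_Un_left) (use fin in auto)
  moreover have "?B1 \<union> ?B2 = B" by auto
  ultimately have 1: "real (card (arcs G B S)) = real (card (arcs G ?B1 S)) + real (card (arcs G ?B2 S))" by simp
  have "card (arcs G ?B2 (S \<union> (V - S))) = card (arcs G ?B2 S) + card (arcs G ?B2 (V - S))"
    by (rule card_arcs_Un) (use fin in auto)
  moreover have "S \<union> (V - S) = V" using BS by auto
  ultimately have "real r * real (card ?B2) = real (card (arcs G ?B2 S)) + real (card (arcs G ?B2 (V - S)))"
    using card_arcs_vertices[OF regular, of ?B2] BS by (metis le_infI1 of_nat_add of_nat_mult)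
  moreover have "\<bar>real (card (arcs G ?B1 S)) - real r * real (card ?B1) * real (card S) / real n\<bar> \<le> 12 * real s * real n"
    by (rule arcs_disjoint_bounds[OF cuts n]) (use BS in auto)
  moreover have "\<bar>real (card (arcs G ?B2 (V - S))) - real r * real (card ?B2) * real (card (V - S)) / real n\<bar> \<le> 12 * real s * real n"
    by (rule arcs_disjoint_bounds[OF cuts n]) (use BS in auto)
  moreover have "real (card (V - S)) = real n - real (card S)"
    using BS card_mono[OF finite_vertices BS(2)] by (simp add: card_Diff_subset fin of_nat_diff)
  moreover have "real (card B) = real (card ?B1) + real (card ?B2)"
    using card_Un_disjoint[of ?B1 ?B2] fin \<open>?B1 \<union> ?B2 = B\<close> by (simp flip: of_nat_add) (metis Diff_disjoint Int_Diff_disjoint inf_commute)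
  moreover have "real r * real (card ?B2) * (real n - real (card S)) / real n =
      real r * real (card ?B2) - real r * real (card ?B2) * real (card S) / real n"
    using n by (simp add: field_simps)
  moreover have "real r * (real (card ?B1) + real (card ?B2)) * real (card S) / real n =
      real r * real (card ?B1) * real (card S) / real n + real r * real (card ?B2) * real (card S) / real n"
    by (simp add: ring_distribs add_divide_distrib)
  ultimately show ?thesis using 1 by simp argo
qed

text \<open>The b deficient vertices send at most b (\<sigma> - u) r arcs into S, whereas the cuts
  force b \<sigma> r up to 24 s n. Comparison leaves b u r \<le> 24 s n.\<close>

lemma few_low_degree:
  assumes cuts: "uniform_cuts n r s G" and n: "n > 0" and S: "S \<subseteq> V" "\<sigma> * real n \<le> real (card S)"
    and \<tau>: "\<tau> \<le> (\<sigma> - u) * real r"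
  shows "real (card {v \<in> V. real (card (nbrs n G v \<inter> S)) < \<tau>}) * (u * real r) \<le> 24 * real s * real n"
proof -
  let ?B = "{v \<in> V. real (card (nbrs n G v \<inter> S)) < \<tau>}"
  define b where "b = real (card ?B)"
  have "real (card (arcs G ?B S)) = (\<Sum>v\<in>?B. real (card (nbrs n G v \<inter> S)))"
    by (subst card_arcs_sum[OF _ S(1)]) auto
  also have "\<dots> \<le> (\<Sum>v\<in>?B. \<tau>)" by (intro sum_mono) auto
  finally have 1: "real (card (arcs G ?B S)) \<le> b * \<tau>" by (simp add: b_def)
  have "b * \<tau> \<le> b * ((\<sigma> - u) * real r)" using \<tau> by (intro mult_left_mono) (auto simp: b_def)
  moreover have "real r * b * real (card S) / real n \<ge> real r * b * (\<sigma> * real n) / real n"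
    using S by (intro divide_right_mono mult_left_mono) (auto simp: b_def)
  moreover have "real r * b * (\<sigma> * real n) / real n = b * (\<sigma> * real r)" using n by simp
  moreover have "real (card (arcs G ?B S)) \<ge> real r * b * real (card S) / real n - 24 * real s * real n"
    unfolding b_def by (rule arcs_lower[OF cuts n _ S(1)]) auto
  ultimately show ?thesis using 1 unfolding b_def[symmetric] by (simp add: algebra_simps)
qed

definition crossing :: "nat set \<Rightarrow> nat \<Rightarrow> (nat \<times> nat) set" where
  "crossing A k = {(x, y). x \<in> A \<and> y \<in> V - A \<and> dist x y = k}"

text \<open>With \<open>S 0\<close> the complement of \<open>A\<close> and \<open>S (i + 1)\<close> the vertices with many neighbours in \<open>S i\<close>, the cut
  estimates keep every \<open>S i\<close> large, so most vertices of \<open>A\<close> are the root of a large tree of paths into the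
  complement.\<close>

lemma card_crossing_ge:
  fixes u \<epsilon> \<gamma> c0 c1 :: real
  assumes cuts: "uniform_cuts n r s G" and n: "n > 0" and u: "u > 0" and r: "r > 0"
    and \<epsilon>: "24 * real s \<le> \<epsilon> * (u * real r)"
    and tree: "real (card {x \<in> V. \<not> treelike n G (Suc k) x}) \<le> \<gamma> * real n"
    and A: "A \<subseteq> V" "card A = n div 2"
    and c0: "1 \<le> c0" "c0 \<le> (1 / 2 - u) * real r" and c1: "1 \<le> c1" "c1 \<le> (1 - \<epsilon> - u) * real r"
  shows "(real (n div 2) - \<epsilon> * real n - \<gamma> * real n) * ((c0 - 1) * (c1 - 1) ^ k)
    \<le> real (card (crossing A (Suc k)))"
proof -
  have finA: "finite A" using A(1) finite_subset finite_vertices by blast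
  \<comment> \<open>Only the last step of a path aims at the complement of A, half of the vertices,
    so its threshold is about r / 2. The earlier steps aim at sets containing nearly all vertices,
    with a threshold near r.\<close>
  define c where "c = (\<lambda>i::nat. if i = 0 then c0 else c1)"
  define S where "S = rec_nat (V - A) (\<lambda>i T. {v \<in> V. c i \<le> real (card (nbrs n G v \<inter> T))})"
  have S0: "S 0 = V - A" and S_Suc: "S (Suc i) = {v \<in> V. c i \<le> real (card (nbrs n G v \<inter> S i))}" for i
    by (simp_all add: S_def)
  have SV: "S i \<subseteq> V" for i by (cases i) (auto simp: S0 S_Suc)
  have low: "real (card (V - S (Suc i))) \<le> \<epsilon> * real n" if "\<sigma> * real n \<le> real (card (S i))" "c i \<le> (\<sigma> - u) * real r" for i \<sigma>
  proof -
    have "V - S (Suc i) = {v \<in> V. real (card (nbrs n G v \<inter> S i)) < c i}" by (auto simp: S_Suc)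
    then have "real (card (V - S (Suc i))) * (u * real r) \<le> 24 * real s * real n"
      using few_low_degree[OF cuts n SV that] by simp
    also have "\<dots> \<le> \<epsilon> * (u * real r) * real n" using \<epsilon> by (intro mult_right_mono) auto
    finally have "real (card (V - S (Suc i))) * (u * real r) \<le> (\<epsilon> * real n) * (u * real r)" by (simp add: mult_ac)
    then show ?thesis using u r by (simp only: mult_le_cancel_right) auto
  qed
  \<comment> \<open>The exceptional sets do not accumulate: every step starts from a set missing at
    most \<epsilon> n vertices and loses at most \<epsilon> n again.\<close>
  have size: "real (card (V - S (Suc i))) \<le> \<epsilon> * real n" for i
  proof (induction i)
    case 0
    have "real (card (S 0)) = real n - real (n div 2)"
      using A by (simp add: S0 card_Diff_subset finA of_nat_diff)
    moreover have "real (n div 2) \<le> real n / 2" by simp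
    ultimately have "1 / 2 * real n \<le> real (card (S 0))" by simp
    then show ?case using low[of "1 / 2" 0] c0 by (simp add: c_def)
  next
    case (Suc i)
    have "real (card (V - S (Suc i))) = real n - real (card (S (Suc i)))"
      using SV[of "Suc i"] card_mono[OF finite_vertices SV[of "Suc i"]] finite_subset[OF SV[of "Suc i"]]
      by (simp add: card_Diff_subset of_nat_diff)
    then have "(1 - \<epsilon>) * real n \<le> real (card (S (Suc i)))" using Suc by (simp add: algebra_simps)
    then show ?case using low[of "1 - \<epsilon>" "Suc i"] c1 by (simp add: c_def)
  qed
  let ?P = "(c0 - 1) * (c1 - 1) ^ k"
  let ?X = "{x \<in> A \<inter> S (Suc k). treelike n G (Suc k) x}"
  have P0: "?P \<ge> 0" using c0 c1 by simp
  have prod: "(\<Prod>i<Suc k. c i - 1) = ?P"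
    unfolding lessThan_Suc_eq_insert_0 by (subst prod.insert) (auto simp: c_def prod.reindex)
  have each: "?P \<le> real (card (level n G x (Suc k) \<inter> (V - A)))" if x: "x \<in> ?X" for x
  proof -
    have "(\<Prod>i<Suc k. c i - 1) \<le> real (card (level n G x (Suc k) \<inter> S 0))"
      by (rule treelike_level_chain[where S = S and c = c])
        (use x A c0 c1 in \<open>auto simp: S_Suc c_def\<close>)
    then show ?thesis by (simp only: prod S0)
  qed
  have "A \<subseteq> ?X \<union> ((V - S (Suc k)) \<union> {x \<in> V. \<not> treelike n G (Suc k) x})" using A by auto
  then have "card A \<le> card (?X \<union> ((V - S (Suc k)) \<union> {x \<in> V. \<not> treelike n G (Suc k) x}))"
    using finA by (intro card_mono) auto
  also have "\<dots> \<le> card ?X + (card (V - S (Suc k)) + card {x \<in> V. \<not> treelike n G (Suc k) x})"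
    by (meson card_Un_le add_left_mono order.trans)
  finally have "real (card A) \<le> real (card ?X + (card (V - S (Suc k)) + card {x \<in> V. \<not> treelike n G (Suc k) x}))"
    by (rule of_nat_mono)
  then have "real (n div 2) - \<epsilon> * real n - \<gamma> * real n \<le> real (card ?X)"
    using size[of k] tree A(2) by simp
  then have "(real (n div 2) - \<epsilon> * real n - \<gamma> * real n) * ?P \<le> real (card ?X) * ?P"
    using P0 by (rule mult_right_mono)
  also have "\<dots> = (\<Sum>x\<in>?X. ?P)" by simp
  also have "\<dots> \<le> (\<Sum>x\<in>?X. real (card (level n G x (Suc k) \<inter> (V - A))))" by (intro sum_mono each)
  also have "\<dots> = real (card (SIGMA x:?X. level n G x (Suc k) \<inter> (V - A)))"
    using finA by (subst card_SigmaI) auto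
  also have "\<dots> \<le> real (card (crossing A (Suc k)))"
  proof (intro of_nat_mono card_mono)
    show "finite (crossing A (Suc k))"
      by (rule finite_subset[of _ "A \<times> V"]) (auto simp: crossing_def finA)
    show "(SIGMA x:?X. level n G x (Suc k) \<inter> (V - A)) \<subseteq> crossing A (Suc k)"
      by (auto simp: crossing_def level_def)
  qed
  finally show ?thesis .
qed

section \<open>Diameter and sums over spheres\<close>

lemma dist_le_diam:
  assumes "x \<in> V" "y \<in> V"
  shows "dist x y \<le> graph_diam n G"
proof -
  have "finite {dist x y | x y. x \<in> V \<and> y \<in> V}"
    by (rule finite_subset[of _ "(\<lambda>(x, y). dist x y) ` (V \<times> V)"]) auto
  then show ?thesis unfolding graph_diam_def using assms by (intro Max_ge) auto
qed

lemma vertices_minus_eq_levels: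
  assumes "x \<in> V"
  shows "V - {x} = (\<Union>j<graph_diam n G. level n G x (Suc j))"
proof (intro set_eqI iffI)
  fix y assume y: "y \<in> V - {x}"
  then have "dist x y \<noteq> 0" using dist_eq_0[of x y] assms by auto
  then obtain j where "dist x y = Suc j" by (cases "dist x y") auto
  then show "y \<in> (\<Union>j<graph_diam n G. level n G x (Suc j))"
    using dist_le_diam[of x y] y assms by (intro UN_I[of j]) (auto simp: level_def)
qed (auto simp: level_def)

lemma sum_over_levels:
  fixes c :: "nat \<Rightarrow> real"
  assumes x: "x \<in> V" and c: "\<And>j. c j \<ge> 0"
  shows "(\<Sum>y\<in>V - {x}. c (dist x y)) \<le> (\<Sum>j<graph_diam n G. real (r * (r - 1) ^ j) * c (Suc j))"
proof -
  have "(\<Sum>y\<in>V - {x}. c (dist x y)) = (\<Sum>j<graph_diam n G. \<Sum>y\<in>level n G x (Suc j). c (dist x y))"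
    unfolding vertices_minus_eq_levels[OF x]
    by (rule sum.UNION_disjoint) (auto simp: level_def)
  also have "\<dots> = (\<Sum>j<graph_diam n G. real (card (level n G x (Suc j))) * c (Suc j))"
    by (intro sum.cong refl) (simp add: level_def)
  also have "\<dots> \<le> (\<Sum>j<graph_diam n G. real (r * (r - 1) ^ j) * c (Suc j))"
    by (intro sum_mono mult_right_mono c of_nat_mono card_level_Suc_le[OF x])
  finally show ?thesis .
qed

text \<open>A coarse Moore bound. For fixed r it makes the diameter exceed any given \<lambda> once
  n is large.\<close>

lemma card_vertices_le_power_diam:
  assumes "r \<ge> 2" "n > 0"
  shows "n \<le> r ^ Suc (graph_diam n G)"
proof -
  have x: "n \<in> V" using assms by (simp add: vertices_def)
  have "n - 1 = card (V - {n})" using x by (simp add: card_Diff_singleton)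
  also have "\<dots> \<le> (\<Sum>j<graph_diam n G. card (level n G n (Suc j)))"
    unfolding vertices_minus_eq_levels[OF x] by (rule card_UN_le) simp
  also have "\<dots> \<le> (\<Sum>j<graph_diam n G. r * (r - 1) ^ j)" by (intro sum_mono card_level_Suc_le[OF x])
  finally have 1: "n \<le> Suc (\<Sum>j<graph_diam n G. r * (r - 1) ^ j)" by simp
  have "Suc (\<Sum>j<d. r * (r - 1) ^ j) \<le> r ^ Suc d" for d
  proof (induction d)
    case (Suc d)
    have "(r - 1) ^ d \<le> r ^ d" by (intro power_mono) auto
    then have "r * (r - 1) ^ d \<le> r * r ^ d" by (rule mult_left_mono) simp
    then have "Suc (\<Sum>j<d. r * (r - 1) ^ j) + r * (r - 1) ^ d \<le> r ^ Suc d + r * r ^ d"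
      by (rule add_mono[OF Suc])
    then have "Suc (\<Sum>j<Suc d. r * (r - 1) ^ j) \<le> r ^ Suc d + r ^ Suc d" by simp
    also have "\<dots> \<le> r * r ^ Suc d" unfolding mult_2[symmetric] using assms(1) by (rule mult_right_mono) simp
    finally show ?case by simp
  qed (use assms in simp)
  with 1 show ?thesis using order.trans by blast
qed

end

section \<open>Energy landscape\<close>

definition ordered_pairs :: "nat set \<Rightarrow> (nat \<times> nat) set" where
  "ordered_pairs Q = {(a, b). a \<in> Q \<and> b \<in> Q \<and> a < b}"

lemma finite_ordered_pairs [simp]: "finite Q \<Longrightarrow> finite (ordered_pairs Q)"
  by (rule finite_subset[of _ "Q \<times> Q"]) (auto simp: ordered_pairs_def)

lemma sum_ordered_pairs_remove:
  fixes \<phi> :: "nat \<Rightarrow> nat \<Rightarrow> real"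
  assumes Q: "finite Q" "x \<in> Q" and sym: "\<And>a b. \<phi> a b = \<phi> b a"
  shows "(\<Sum>(a, b)\<in>ordered_pairs Q. \<phi> a b) =
    (\<Sum>(a, b)\<in>ordered_pairs (Q - {x}). \<phi> a b) + (\<Sum>y\<in>Q - {x}. \<phi> x y)"
proof -
  let ?P = "{(a, b). a \<in> Q \<and> b \<in> Q \<and> a < b \<and> (a = x \<or> b = x)}"
  have fin: "finite ?P" by (rule finite_subset[of _ "Q \<times> Q"]) (auto simp: Q)
  have "ordered_pairs Q = ordered_pairs (Q - {x}) \<union> ?P" by (auto simp: ordered_pairs_def)
  moreover have "(\<Sum>(a, b)\<in>ordered_pairs (Q - {x}) \<union> ?P. \<phi> a b) =
      (\<Sum>(a, b)\<in>ordered_pairs (Q - {x}). \<phi> a b) + (\<Sum>(a, b)\<in>?P. \<phi> a b)"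
    by (intro sum.union_disjoint finite_ordered_pairs finite_Diff Q fin) (auto simp: ordered_pairs_def)
  moreover have "(\<Sum>(a, b)\<in>?P. \<phi> a b) = (\<Sum>y\<in>Q - {x}. \<phi> x y)"
  proof (rule sum.reindex_bij_witness[where i = "\<lambda>y. if x < y then (x, y) else (y, x)"
        and j = "\<lambda>(a, b). if a = x then b else a"])
  qed (use Q in \<open>auto split: if_splits intro: sym\<close>)
  ultimately show ?thesis by simp
qed

lemma sum_ordered_pairs_double:
  fixes \<phi> :: "nat \<Rightarrow> nat \<Rightarrow> real"
  assumes "finite Q" and sym: "\<And>a b. \<phi> a b = \<phi> b a"
  shows "2 * (\<Sum>(a, b)\<in>ordered_pairs Q. \<phi> a b) = (\<Sum>x\<in>Q. \<Sum>y\<in>Q - {x}. \<phi> x y)"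
  using assms(1)
proof (induction Q rule: finite_induct)
  case (insert z Q)
  have "(\<Sum>x\<in>Q. \<Sum>y\<in>insert z Q - {x}. \<phi> x y) = (\<Sum>x\<in>Q. \<phi> x z + (\<Sum>y\<in>Q - {x}. \<phi> x y))"
  proof (intro sum.cong refl)
    fix x assume "x \<in> Q"
    then have "insert z Q - {x} = insert z (Q - {x})" using insert by auto
    then show "(\<Sum>y\<in>insert z Q - {x}. \<phi> x y) = \<phi> x z + (\<Sum>y\<in>Q - {x}. \<phi> x y)"
      using insert by simp
  qed
  also have "\<dots> = (\<Sum>y\<in>Q. \<phi> z y) + (\<Sum>x\<in>Q. \<Sum>y\<in>Q - {x}. \<phi> x y)"
    by (simp add: sum.distrib sym[of z])
  finally show ?case
    using insert sum_ordered_pairs_remove[of "insert z Q" z \<phi>] sym by simp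
qed (simp add: ordered_pairs_def)

lemma sum_ordered_pairs_separated:
  fixes \<phi> :: "nat \<Rightarrow> nat \<Rightarrow> real"
  assumes "finite Q" "A \<subseteq> Q" and sym: "\<And>a b. \<phi> a b = \<phi> b a"
  shows "(\<Sum>(a, b)\<in>ordered_pairs Q. if (a \<in> A) \<noteq> (b \<in> A) then \<phi> a b else 0) =
    (\<Sum>(a, b)\<in>A \<times> (Q - A). \<phi> a b)"
proof -
  have "(\<Sum>(a, b)\<in>ordered_pairs Q. if (a \<in> A) \<noteq> (b \<in> A) then \<phi> a b else 0) =
      (\<Sum>(a, b)\<in>{(a, b). a \<in> Q \<and> b \<in> Q \<and> a < b \<and> (a \<in> A) \<noteq> (b \<in> A)}. \<phi> a b)"
    by (rule sum.mono_neutral_cong_right[OF finite_ordered_pairs[OF assms(1)]])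
      (auto simp: ordered_pairs_def split: if_splits)
  also have "\<dots> = (\<Sum>(a, b)\<in>A \<times> (Q - A). \<phi> a b)"
  proof (rule sum.reindex_bij_witness[where i = "\<lambda>(a, b). if a < b then (a, b) else (b, a)"
        and j = "\<lambda>(a, b). if a \<in> A then (a, b) else (b, a)"])
  qed (use assms(2) in \<open>auto split: if_splits intro: sym simp: not_less order.order_iff_strict\<close>)
  finally show ?thesis .
qed

text \<open>The Hamiltonian with the graph abstracted away: the landscape argument uses only that
  the coupling is symmetric and nonnegative.\<close>

definition pair_energy :: "(nat \<Rightarrow> nat \<Rightarrow> real) \<Rightarrow> real \<Rightarrow> nat \<Rightarrow> config \<Rightarrow> real" where
  "pair_energy c h n s =
     - (\<Sum>(x, y)\<in>ordered_pairs (vertices n). c x y * of_int (s x) * of_int (s y))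
     - h * (\<Sum>x\<in>vertices n. of_int (s x))"

lemma hamiltonian_eq_pair_energy:
  "hamiltonian I r J h n G = pair_energy (\<lambda>x y. coupling I r J (graph_dist G x y)) h n"
  by (simp add: hamiltonian_def pair_energy_def ordered_pairs_def fun_eq_iff)

definition plus_set :: "nat \<Rightarrow> config \<Rightarrow> nat set" where
  "plus_set n s = {x \<in> vertices n. s x = 1}"

lemma plus_set_subset: "plus_set n s \<subseteq> vertices n"
  by (auto simp: plus_set_def)

lemma configs_cases: "s \<in> configs n \<Longrightarrow> x \<in> vertices n \<Longrightarrow> s x = 1 \<or> s x = -1"
  by (auto simp: configs_def PiE_iff)

lemma all_plus_config: "all_plus n \<in> configs n" and all_minus_config: "all_minus n \<in> configs n"
  by (auto simp: all_plus_def all_minus_def configs_def)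

locale pair_interaction =
  fixes n :: nat and c :: "nat \<Rightarrow> nat \<Rightarrow> real" and h :: real
  assumes n1: "n \<ge> 1" and sym: "\<And>x y. c x y = c y x" and c0: "\<And>x y. c x y \<ge> 0" and h: "h > 0"
begin

abbreviation V where "V \<equiv> vertices n"
abbreviation H where "H \<equiv> pair_energy c h n"

lemma energy_diff_minus:
  assumes s: "s \<in> configs n"
  defines "A \<equiv> plus_set n s"
  shows "H s - H (all_minus n) = 2 * (\<Sum>(x, y)\<in>A \<times> (V - A). c x y) - 2 * h * real (card A)"
proof -
  let ?P = "ordered_pairs V"
  have A: "A \<subseteq> V" "finite A" using finite_subset[OF plus_set_subset finite_vertices] by (auto simp: A_def plus_set_def)
  have "(\<Sum>(x, y)\<in>?P. c x y * of_int (all_minus n x) * of_int (all_minus n y)) -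
      (\<Sum>(x, y)\<in>?P. c x y * of_int (s x) * of_int (s y)) =
      (\<Sum>(x, y)\<in>?P. 2 * (if (x \<in> A) \<noteq> (y \<in> A) then c x y else 0))"
    unfolding sum_subtractf[symmetric]
  proof (intro sum.cong refl)
    fix p assume "p \<in> ?P"
    then obtain x y where p: "p = (x, y)" "x \<in> V" "y \<in> V" by (auto simp: ordered_pairs_def)
    then show "(case p of (x, y) \<Rightarrow> c x y * of_int (all_minus n x) * of_int (all_minus n y)) -
        (case p of (x, y) \<Rightarrow> c x y * of_int (s x) * of_int (s y)) =
        (case p of (x, y) \<Rightarrow> 2 * (if (x \<in> A) \<noteq> (y \<in> A) then c x y else 0))"
      using configs_cases[OF s p(2)] configs_cases[OF s p(3)]
      by (auto simp: all_minus_def A_def plus_set_def)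
  qed
  also have "\<dots> = 2 * (\<Sum>(x, y)\<in>?P. if (x \<in> A) \<noteq> (y \<in> A) then c x y else 0)"
    by (simp add: sum_distrib_left case_prod_unfold)
  also have "\<dots> = 2 * (\<Sum>(x, y)\<in>A \<times> (V - A). c x y)"
    by (subst sum_ordered_pairs_separated[OF finite_vertices A(1) sym]) simp
  finally have 1: "(\<Sum>(x, y)\<in>?P. c x y * of_int (all_minus n x) * of_int (all_minus n y)) -
      (\<Sum>(x, y)\<in>?P. c x y * of_int (s x) * of_int (s y)) = 2 * (\<Sum>(x, y)\<in>A \<times> (V - A). c x y)" .
  have "(\<Sum>x\<in>V. of_int (s x)) - (\<Sum>x\<in>V. of_int (all_minus n x)) = (\<Sum>x\<in>V. if x \<in> A then 2 else 0 :: real)"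
    unfolding sum_subtractf[symmetric]
  proof (intro sum.cong refl)
    fix x assume x: "x \<in> V"
    show "of_int (s x) - of_int (all_minus n x) = (if x \<in> A then 2 else 0 :: real)"
      using configs_cases[OF s x] x by (auto simp: all_minus_def A_def plus_set_def)
  qed
  also have "\<dots> = 2 * real (card A)"
    using A by (simp add: sum.If_cases Int_absorb1)
  finally have "(\<Sum>x\<in>V. of_int (s x)) = (\<Sum>x\<in>V. of_int (all_minus n x)) + 2 * real (card A)" by simp
  then show ?thesis using 1 by (simp add: pair_energy_def algebra_simps)
qed

lemma energy_all_plus_le:
  assumes s: "s \<in> configs n"
  shows "H (all_plus n) \<le> H s"
proof -
  have "(\<Sum>(x, y)\<in>ordered_pairs V. c x y * of_int (s x) * of_int (s y)) \<le>
      (\<Sum>(x, y)\<in>ordered_pairs V. c x y * of_int (all_plus n x) * of_int (all_plus n y))"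
  proof (intro sum_mono)
    fix p assume "p \<in> ordered_pairs V"
    then obtain x y where p: "p = (x, y)" "x \<in> V" "y \<in> V" by (auto simp: ordered_pairs_def)
    then show "(case p of (x, y) \<Rightarrow> c x y * of_int (s x) * of_int (s y)) \<le>
        (case p of (x, y) \<Rightarrow> c x y * of_int (all_plus n x) * of_int (all_plus n y))"
      using configs_cases[OF s p(2)] configs_cases[OF s p(3)] c0[of x y] by (auto simp: all_plus_def)
  qed
  moreover have "(\<Sum>x\<in>V. real_of_int (s x)) \<le> (\<Sum>x\<in>V. real_of_int (all_plus n x))"
  proof (intro sum_mono)
    fix x assume x: "x \<in> V"
    show "real_of_int (s x) \<le> real_of_int (all_plus n x)"
      using configs_cases[OF s x] x by (auto simp: all_plus_def)
  qed
  then have "h * (\<Sum>x\<in>V. real_of_int (s x)) \<le> h * (\<Sum>x\<in>V. real_of_int (all_plus n x))"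
    using h by (intro mult_left_mono) auto
  ultimately show ?thesis by (simp add: pair_energy_def)
qed

lemma energy_all_plus_less: "H (all_plus n) < H (all_minus n)"
proof -
  have "plus_set n (all_plus n) = V" by (auto simp: plus_set_def all_plus_def)
  then have "H (all_plus n) - H (all_minus n) = - (2 * h * real n)"
    using energy_diff_minus[OF all_plus_config] by simp
  moreover have "2 * h * real n > 0" using h n1 by (intro mult_pos_pos) auto
  ultimately show ?thesis by linarith
qed

text \<open>Its loss on removing x is twice the coupling of x to the other minus spins, the only
  pairs whose energy rises when x is flipped. Along a chain of flips the losses telescope.\<close>

definition pair_potential :: "nat set \<Rightarrow> real" where
  "pair_potential M = (\<Sum>(x, y)\<in>ordered_pairs M. 2 * c x y)"

lemma flip_energy_le:
  assumes u: "u \<in> configs n" and x: "x \<in> V" "u x = -1"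
  defines "M \<equiv> {y \<in> V. u y = -1}"
  shows "max 0 (H (u(x := 1)) - H u) \<le> pair_potential M - pair_potential (M - {x})"
proof -
  let ?v = "u(x := 1)"
  have M: "finite M" "x \<in> M" "M \<subseteq> V" using x by (auto simp: M_def)
  have split: "(\<Sum>(a, b)\<in>ordered_pairs V. c a b * of_int (w a) * of_int (w b)) =
      (\<Sum>(a, b)\<in>ordered_pairs (V - {x}). c a b * of_int (w a) * of_int (w b)) +
      of_int (w x) * (\<Sum>y\<in>V - {x}. c x y * of_int (w y))" for w :: config
  proof -
    have "(\<Sum>(a, b)\<in>ordered_pairs V. c a b * of_int (w a) * of_int (w b)) =
        (\<Sum>(a, b)\<in>ordered_pairs (V - {x}). c a b * of_int (w a) * of_int (w b)) +
        (\<Sum>y\<in>V - {x}. c x y * of_int (w x) * of_int (w y))"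
      by (rule sum_ordered_pairs_remove) (use x sym in \<open>auto simp: mult_ac\<close>)
    then show ?thesis by (simp add: sum_distrib_left mult_ac)
  qed
  have pairs: "(\<Sum>(a, b)\<in>ordered_pairs (V - {x}). c a b * of_int (?v a) * of_int (?v b)) =
      (\<Sum>(a, b)\<in>ordered_pairs (V - {x}). c a b * of_int (u a) * of_int (u b))"
    by (intro sum.cong) (auto simp: ordered_pairs_def)
  have row: "(\<Sum>y\<in>V - {x}. c x y * of_int (?v y)) = (\<Sum>y\<in>V - {x}. c x y * of_int (u y))"
    by (intro sum.cong) auto
  have "(\<Sum>y\<in>V. real_of_int (?v y)) = 2 + (\<Sum>y\<in>V. real_of_int (u y))"
  proof -
    have "(\<Sum>y\<in>V - {x}. real_of_int (?v y)) = (\<Sum>y\<in>V - {x}. real_of_int (u y))" by (intro sum.cong) auto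
    then show ?thesis using x by (simp add: sum.remove[OF finite_vertices x(1)] del: fun_upd_apply) simp
  qed
  then have "H ?v - H u = - 2 * (\<Sum>y\<in>V - {x}. c x y * of_int (u y)) - 2 * h"
    unfolding pair_energy_def split pairs row using x(2) by (simp add: algebra_simps)
  moreover have "(\<Sum>y\<in>V - {x}. - (c x y * of_int (u y))) \<le> (\<Sum>y\<in>V - {x}. if y \<in> M then c x y else 0)"
  proof (intro sum_mono)
    fix y assume y: "y \<in> V - {x}"
    then have "u y = 1 \<or> u y = -1" using configs_cases[OF u] by blast
    then show "- (c x y * of_int (u y)) \<le> (if y \<in> M then c x y else 0)"
      using y c0[of x y] by (auto simp: M_def)
  qed
  moreover have "(\<Sum>y\<in>V - {x}. if y \<in> M then c x y else 0) = (\<Sum>y\<in>M - {x}. c x y)"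
    by (rule sum.mono_neutral_cong_right) (use M in auto)
  ultimately have "H ?v - H u \<le> 2 * (\<Sum>y\<in>M - {x}. c x y)"
    using h by (simp add: sum_negf)
  moreover have "(\<Sum>y\<in>M - {x}. c x y) \<ge> 0" by (intro sum_nonneg c0)
  moreover have "pair_potential M - pair_potential (M - {x}) = 2 * (\<Sum>y\<in>M - {x}. c x y)"
    unfolding pair_potential_def
    using sum_ordered_pairs_remove[OF M(1,2), of "\<lambda>a b. 2 * c a b"] sym by (simp add: sum_distrib_left)
  ultimately show ?thesis by simp
qed

lemma pair_potential_le:
  assumes row: "\<And>x. x \<in> V \<Longrightarrow> (\<Sum>y\<in>V - {x}. c x y) \<le> \<rho>" and M: "M \<subseteq> V"
  shows "pair_potential M - pair_potential {} \<le> real n * \<rho>"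
proof -
  have "pair_potential M \<le> pair_potential V"
    unfolding pair_potential_def
    by (rule sum_mono2[OF finite_ordered_pairs[OF finite_vertices]]) (use M c0 in \<open>auto simp: ordered_pairs_def\<close>)
  also have "\<dots> = 2 * (\<Sum>(x, y)\<in>ordered_pairs V. c x y)"
    by (simp add: pair_potential_def sum_distrib_left case_prod_unfold)
  also have "\<dots> = (\<Sum>x\<in>V. \<Sum>y\<in>V - {x}. c x y)"
    by (rule sum_ordered_pairs_double) (simp_all add: sym)
  also have "\<dots> \<le> (\<Sum>x\<in>V. \<rho>)" by (intro sum_mono row)
  finally show ?thesis by (simp add: pair_potential_def ordered_pairs_def)
qed

section \<open>Communication heights and stability levels\<close>

lemma path_exists:
  assumes "s \<in> configs n" "t \<in> configs n"
  shows "\<exists>p. is_path n s t p"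
  using assms(1)
proof (induction "card {x \<in> V. s x \<noteq> t x}" arbitrary: s)
  case 0
  then have "{x \<in> V. s x \<noteq> t x} = {}" by simp
  then have "s x = t x" for x
    using 0 assms(2) by (cases "x \<in> V") (auto simp: configs_def PiE_iff extensional_def)
  then have "s = t" by auto
  then show ?case using assms(2) by (intro exI[of _ "[t]"]) (simp add: is_path_def)
next
  case (Suc m)
  then have "{x \<in> V. s x \<noteq> t x} \<noteq> {}" by (metis card.empty nat.simps(3))
  then obtain x where x: "x \<in> V" "s x \<noteq> t x" by auto
  define s' where "s' = s(x := t x)"
  have s': "s' \<in> configs n" using Suc.prems assms(2) x by (auto simp: s'_def configs_def PiE_iff extensional_def)
  have "{y \<in> V. s' y \<noteq> t y} = {y \<in> V. s y \<noteq> t y} - {x}" by (auto simp: s'_def)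
  then have "card {y \<in> V. s' y \<noteq> t y} = m" using x Suc.hyps(2) by (simp add: card_Diff_singleton)
  then obtain p where p: "is_path n s' t p" using Suc.hyps(1)[OF _ s'] by auto
  have "{y \<in> V. s y \<noteq> s' y} = {x}" using x by (auto simp: s'_def)
  then have flip: "single_flip n s s'" by (simp add: single_flip_def)
  have "single_flip n ((s # p) ! i) ((s # p) ! Suc i)" if "Suc i < length (s # p)" for i
    using that p flip by (cases i) (auto simp: is_path_def hd_conv_nth)
  then show ?case using p Suc.prems by (intro exI[of _ "s # p"]) (auto simp: is_path_def)
qed

text \<open>There are infinitely many paths, but their heights are energies of configurations;
  together with \<open>path_exists\<close> this makes the minimum in \<open>comm_height\<close> a
  genuine one.\<close>

lemma finite_heights: "finite {Max (H ` set p) | p. is_path n s t p}"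
proof (rule finite_subset)
  show "{Max (H ` set p) | p. is_path n s t p} \<subseteq> H ` configs n"
  proof safe
    fix p assume p: "is_path n s t p"
    then have "Max (H ` set p) \<in> H ` set p" by (intro Max_in) (auto simp: is_path_def)
    with p show "Max (H ` set p) \<in> H ` configs n" unfolding is_path_def by blast
  qed
qed (simp add: finite_configs)

lemma comm_height_le:
  assumes "is_path n s t p"
  shows "comm_height n H s t \<le> Max (H ` set p)"
proof -
  show ?thesis unfolding comm_height_def using assms by (intro Min_le finite_heights) auto
qed

lemma comm_height_attained:
  assumes "s \<in> configs n" "t \<in> configs n"
  obtains p where "is_path n s t p" "comm_height n H s t = Max (H ` set p)"
proof -
  have "{Max (H ` set p) | p. is_path n s t p} \<noteq> {}" using path_exists[OF assms] by auto
  then have "comm_height n H s t \<in> {Max (H ` set p) | p. is_path n s t p}"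
    unfolding comm_height_def by (rule Min_in[OF finite_heights])
  then show ?thesis using that by blast
qed

text \<open>The number of plus spins changes by at most one per flip, so the discrete intermediate
  value theorem applies.\<close>

lemma path_crosses:
  assumes p: "is_path n (all_minus n) t p" and t: "m \<le> card (plus_set n t)"
  shows "\<exists>s\<in>set p. card (plus_set n s) = m"
proof -
  have ne: "p \<noteq> []" and hd: "p ! 0 = all_minus n" and la: "p ! (length p - 1) = t" and sub: "set p \<subseteq> configs n"
    and fl: "Suc i < length p \<Longrightarrow> single_flip n (p ! i) (p ! Suc i)" for i
    using p by (auto simp: is_path_def hd_conv_nth last_conv_nth)
  let ?f = "\<lambda>i. int (card (plus_set n (p ! i)))"
  have step: "\<bar>?f (Suc i) - ?f i\<bar> \<le> 1" if i: "i < length p - 1" for i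
  proof -
    have "card {x \<in> V. (p ! i) x \<noteq> (p ! Suc i) x} = 1" using fl[of i] i by (simp add: single_flip_def)
    then obtain x where x: "{x \<in> V. (p ! i) x \<noteq> (p ! Suc i) x} = {x}" by (rule card_1_singletonE)
    then have eq: "(p ! i) y = (p ! Suc i) y" if "y \<in> V" "y \<noteq> x" for y using that by blast
    have sub: "plus_set n (p ! i) \<subseteq> insert x (plus_set n (p ! Suc i))"
      "plus_set n (p ! Suc i) \<subseteq> insert x (plus_set n (p ! i))"
      using eq by (force simp: plus_set_def)+
    have fin: "finite (insert x (plus_set n s))" for s
      using finite_subset[OF plus_set_subset finite_vertices] by simp
    have ins: "card (insert x (plus_set n s)) \<le> card (plus_set n s) + 1" for s
      using finite_subset[OF plus_set_subset finite_vertices, of n s] by (simp add: card_insert_if)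
    have "card (plus_set n (p ! i)) \<le> card (plus_set n (p ! Suc i)) + 1"
      using card_mono[OF fin sub(1)] ins by (rule order.trans)
    moreover have "card (plus_set n (p ! Suc i)) \<le> card (plus_set n (p ! i)) + 1"
      using card_mono[OF fin sub(2)] ins by (rule order.trans)
    ultimately show ?thesis by linarith
  qed
  have "plus_set n (all_minus n) = {}" by (auto simp: plus_set_def all_minus_def)
  then have f0: "?f 0 \<le> int m" using hd by simp
  have "\<exists>i\<le>length p - 1. ?f i = int m"
    by (rule nat0_intermed_int_val) (use step f0 la t in auto)
  then obtain i where i: "i \<le> length p - 1" "card (plus_set n (p ! i)) = m" by auto
  then have "i < length p" using ne by (cases p) auto
  then show ?thesis using i by (intro bexI[of _ "p ! i"]) auto
qed

text \<open>By \<open>small\<close>, a configuration below -1 in energy has more than n / 2 plus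
  spins, so the way to it leads through a bisection.\<close>

lemma stability_all_minus_ge:
  assumes small: "\<And>s. s \<in> configs n \<Longrightarrow> 2 * card (plus_set n s) \<le> n \<Longrightarrow> H s \<ge> H (all_minus n)"
    and half: "\<And>s. s \<in> configs n \<Longrightarrow> card (plus_set n s) = n div 2 \<Longrightarrow> H s - H (all_minus n) \<ge> \<Gamma>"
  shows "ereal \<Gamma> \<le> stability_level n H (all_minus n)"
proof -
  let ?L = "lower_states n H (all_minus n)"
  have ne: "?L \<noteq> {}" using energy_all_plus_less all_plus_config by (auto simp: lower_states_def)
  have fin: "finite ?L" using finite_configs[of n] by (simp add: lower_states_def)
  have "H (all_minus n) + \<Gamma> \<le> comm_height n H (all_minus n) t" if t: "t \<in> ?L" for t
  proof -
    have tc: "t \<in> configs n" and lower: "H t < H (all_minus n)" using t by (auto simp: lower_states_def)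
    have "n < 2 * card (plus_set n t)" using small[OF tc] lower by linarith
    then have le: "n div 2 \<le> card (plus_set n t)" by linarith
    obtain p where p: "is_path n (all_minus n) t p" "comm_height n H (all_minus n) t = Max (H ` set p)"
      using comm_height_attained[OF all_minus_config tc] .
    obtain s where s: "s \<in> set p" "card (plus_set n s) = n div 2" using path_crosses[OF p(1) le] by blast
    have "s \<in> configs n" using s p by (auto simp: is_path_def)
    then have "H (all_minus n) + \<Gamma> \<le> H s" using half s by fastforce
    also have "\<dots> \<le> Max (H ` set p)" using s by simp
    finally show ?thesis using p by simp
  qed
  then have "H (all_minus n) + \<Gamma> \<le> Min (comm_height n H (all_minus n) ` ?L)"
    using fin ne by (subst Min_ge_iff) auto
  then show ?thesis using ne by (simp add: stability_level_def)
qed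

text \<open>A metastable state has the maximal level, which is at least that of -1. Since +1 is a
  ground state and lies strictly below the state, every path to +1 climbs by at least that
  level.\<close>

lemma barrier_from_metastable:
  assumes stab: "ereal \<Gamma> \<le> stability_level n H (all_minus n)"
    and \<eta>: "\<eta> \<in> insert (all_minus n) (metastable_states n H)"
  shows "\<eta> \<in> configs n" "\<eta> \<noteq> all_plus n"
    "\<And>p. is_path n \<eta> (all_plus n) p \<Longrightarrow> \<exists>x\<in>set p. H x \<ge> H \<eta> + \<Gamma>"
proof -
  let ?U = "configs n - stable_states n H"
  have stable: "s \<in> stable_states n H \<longleftrightarrow> lower_states n H s = {}" if "s \<in> configs n" for s
    using that by (auto simp: stable_states_def lower_states_def is_arg_min_def)
  have minus_lower: "lower_states n H (all_minus n) \<noteq> {}"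
    using energy_all_plus_less all_plus_config by (auto simp: lower_states_def)
  have minus: "all_minus n \<in> ?U" using stable[OF all_minus_config] minus_lower all_minus_config by simp
  have fin: "finite ?U" by (rule finite_Diff[OF finite_configs])
  have "max_stability n H \<in> stability_level n H ` ?U"
    unfolding max_stability_def using fin minus by (intro Max_in) auto
  \<comment> \<open>Ground states have level \<infinity>; finiteness of the maximum therefore keeps
    them from being metastable.\<close>
  then have max: "max_stability n H < \<infinity>"
    using stable by (auto simp: stability_level_def)
  have le: "stability_level n H (all_minus n) \<le> max_stability n H"
    unfolding max_stability_def using fin minus by (intro Max_ge) auto
  have "stability_level n H \<eta> = stability_level n H (all_minus n) \<or> stability_level n H \<eta> = max_stability n H"
    using \<eta> by (auto simp: metastable_states_def)
  then have level: "ereal \<Gamma> \<le> stability_level n H \<eta> \<and> stability_level n H \<eta> < \<infinity>"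
    using stab le max order.trans[OF stab le] le_less_trans[OF le max] by (elim disjE) simp_all
  show conf: "\<eta> \<in> configs n" using \<eta> all_minus_config by (auto simp: metastable_states_def)
  have ne: "lower_states n H \<eta> \<noteq> {}" using level by (auto simp: stability_level_def)
  then obtain t where "t \<in> configs n" "H t < H \<eta>" by (auto simp: lower_states_def)
  then have lower: "H (all_plus n) < H \<eta>" using energy_all_plus_le[of t] by linarith
  then show "\<eta> \<noteq> all_plus n" by auto
  fix p assume p: "is_path n \<eta> (all_plus n) p"
  have "finite (lower_states n H \<eta>)" using finite_configs[of n] by (simp add: lower_states_def)
  moreover have "all_plus n \<in> lower_states n H \<eta>" using lower all_plus_config by (simp add: lower_states_def)
  ultimately have "Min (comm_height n H \<eta> ` lower_states n H \<eta>) \<le> comm_height n H \<eta> (all_plus n)"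
    by (intro Min_le) auto
  moreover have "\<Gamma> \<le> Min (comm_height n H \<eta> ` lower_states n H \<eta>) - H \<eta>"
    using level ne by (simp add: stability_level_def)
  ultimately have "H \<eta> + \<Gamma> \<le> Max (H ` set p)" using comm_height_le[OF p] by linarith
  moreover have "Max (H ` set p) \<in> H ` set p" using p by (intro Max_in) (auto simp: is_path_def)
  ultimately show "\<exists>x\<in>set p. H x \<ge> H \<eta> + \<Gamma>" by auto
qed

end

section \<open>Energy barriers on random regular graphs\<close>

lemma coupling_nonneg: "J \<ge> 0 \<Longrightarrow> coupling I r J i \<ge> 0"
  by (cases I) auto

lemma coupling_1: "r > 0 \<Longrightarrow> coupling I r J 1 = J"
  by (cases I) auto

lemma (in connected_regular) row_sum_le:
  assumes r: "r \<ge> 3" and J: "J \<ge> 0" and x: "x \<in> V" and "admissible I"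
    and I: "\<And>l. I = Polynomial l \<Longrightarrow> l < real (graph_diam n G)"
  shows "(\<Sum>y\<in>V - {x}. coupling I r J (dist x y)) \<le> J * (real r * f_bound I r (graph_diam n G))"
proof -
  let ?d = "graph_diam n G"
  have "(\<Sum>y\<in>V - {x}. coupling I r J (dist x y)) \<le>
      (\<Sum>j<?d. real (r * (r - 1) ^ j) * coupling I r J (Suc j))"
    by (rule sum_over_levels[OF x]) (rule coupling_nonneg[OF J])
  also have "\<dots> \<le> J * (real r * f_bound I r ?d)"
  proof (cases I)
    case Exponential
    \<comment> \<open>Spheres grow by the factor r - 1 while the coupling shrinks by r, so the sum
      is geometric with 1 / (1 - q) = r.\<close>
    define q where "q = (real r - 1) / real r"
    have q: "0 \<le> q" "1 - q = 1 / real r" using r by (auto simp: q_def field_simps)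
    have "(\<Sum>j<?d. real (r * (r - 1) ^ j) * coupling I r J (Suc j)) = (\<Sum>j<?d. J * real r * q ^ j)"
    proof (intro sum.cong refl)
      fix j
      have "real r powr (1 - real (Suc j)) = 1 / real r ^ j"
        using r by (simp add: powr_minus powr_realpow inverse_eq_divide)
      then show "real (r * (r - 1) ^ j) * coupling I r J (Suc j) = J * real r * q ^ j"
        using r Exponential by (simp add: q_def power_divide of_nat_diff)
    qed
    also have "\<dots> = J * real r * (\<Sum>j<?d. q ^ j)" by (simp add: sum_distrib_left)
    also have "\<dots> \<le> J * real r * real r"
    proof (intro mult_left_mono)
      have "(\<Sum>j<?d. q ^ j) / real r = 1 - q ^ ?d"
        using one_diff_power_eq[of q ?d] q by simp
      also have "\<dots> \<le> 1" using q by simp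
      finally show "(\<Sum>j<?d. q ^ j) \<le> real r" using r by (simp add: field_simps)
    qed (use J in auto)
    finally show ?thesis using Exponential by (simp add: mult.assoc)
  next
    case (Polynomial l)
    have l: "l > 2" "l < real ?d" using assms Polynomial by auto
    have sm: "summable (\<lambda>j. real (Suc j) powr (- l))"
      using summable_Suc_iff[of "\<lambda>j. real j powr (- l)"] l by (simp add: summable_real_powr_iff)
    \<comment> \<open>Every sphere is bounded like the largest one, which leaves a partial sum of
      the zeta series.\<close>
    have "(\<Sum>j<?d. real (r * (r - 1) ^ j) * coupling I r J (Suc j)) \<le>
        (\<Sum>j<?d. (real r * (real r - 1) ^ ?d) * (J * real (Suc j) powr (- l)))"
    proof (intro sum_mono)
      fix j assume "j \<in> {..<?d}"
      then have "(real r - 1) ^ j \<le> (real r - 1) ^ ?d" using r by (intro power_increasing) auto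
      then have "real (r * (r - 1) ^ j) \<le> real r * (real r - 1) ^ ?d"
        using r by (simp add: of_nat_diff)
      then show "real (r * (r - 1) ^ j) * coupling I r J (Suc j) \<le>
          (real r * (real r - 1) ^ ?d) * (J * real (Suc j) powr (- l))"
        unfolding Polynomial coupling.simps using J by (intro mult_right_mono) auto
    qed
    also have "\<dots> = (real r * (real r - 1) ^ ?d) * J * (\<Sum>j<?d. real (Suc j) powr (- l))"
      by (simp add: sum_distrib_left mult.assoc)
    also have "\<dots> \<le> (real r * (real r - 1) ^ ?d) * J * zeta_series l"
      unfolding zeta_series_def using r J by (intro mult_left_mono sum_le_suminf sm) auto
    finally show ?thesis using Polynomial l by (simp add: mult_ac)
  qed
  finally show ?thesis .
qed

text \<open>The pairs at distance one absorb the external field, because \<open>J\<close> times the Cheeger constant is at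
  least \<open>h\<close>.\<close>

lemma (in connected_regular) crossing_energy_ge:
  assumes r: "r > 0" and J: "J \<ge> 0" and hJ: "h \<le> J * cheeger n G"
    and A: "A \<subseteq> V" "2 * card A \<le> n" and K: "K \<subseteq> crossing A k" "k \<noteq> 1"
  shows "real (card K) * coupling I r J k \<le>
    (\<Sum>(x, y)\<in>A \<times> (V - A). coupling I r J (dist x y)) - h * real (card A)"
proof -
  have finA: "finite A" using A(1) finite_subset finite_vertices by blast
  let ?E = "edge_boundary n G A" and ?c = "\<lambda>(x, y). coupling I r J (dist x y)"
  have E: "?E \<subseteq> A \<times> (V - A)" and K': "K \<subseteq> A \<times> (V - A)"
    using K by (auto simp: edge_boundary_def crossing_def)
  have finK: "finite K" and finE: "finite ?E"
    using finite_subset[OF K'] finite_subset[OF E] finA by auto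
  have d1: "dist x y = 1" if "(x, y) \<in> ?E" for x y
    using that A(1) dist_eq_1_iff[of x y] by (auto simp: edge_boundary_def)
  have dk: "dist x y = k" if "(x, y) \<in> K" for x y
    using that K by (auto simp: crossing_def)
  have "h * real (card A) \<le> J * real (card ?E)"
  proof (cases "card A = 0")
    case False
    then have "cheeger n G * real (card A) \<le> real (card ?E)" using A by (intro cheeger_le) auto
    then have "J * (cheeger n G * real (card A)) \<le> J * real (card ?E)" using J by (rule mult_left_mono)
    moreover have "h * real (card A) \<le> J * cheeger n G * real (card A)" using hJ by (rule mult_right_mono) simp
    ultimately show ?thesis by (simp add: mult.assoc)
  qed (use J in simp)
  moreover have "(\<Sum>p\<in>?E. ?c p) = (\<Sum>p\<in>?E. J)"
    using coupling_1[OF r, of I J] d1 by (intro sum.cong) auto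
  moreover have "(\<Sum>p\<in>K. ?c p) = (\<Sum>p\<in>K. coupling I r J k)"
    using dk by (intro sum.cong) auto
  moreover have "?E \<inter> K = {}" using d1 dk K(2) by fastforce
  then have "(\<Sum>p\<in>?E \<union> K. ?c p) = (\<Sum>p\<in>?E. ?c p) + (\<Sum>p\<in>K. ?c p)"
    by (rule sum.union_disjoint[OF finE finK])
  moreover have "(\<Sum>p\<in>?E \<union> K. ?c p) \<le> (\<Sum>p\<in>A \<times> (V - A). ?c p)"
    using E K' finA coupling_nonneg[OF J] by (intro sum_mono2) auto
  ultimately show ?thesis by (simp add: case_prod_unfold mult.commute)
qed

text \<open>The deterministic statement for one graph. The alternative on \<open>\<Gamma>l\<close>
  covers small r, where the correction exceeds r / 2 and a barrier of height zero suffices.\<close>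

lemma (in connected_regular) hitting_time_tendsto_if_crossing:
  assumes r: "r \<ge> 3" and n: "n \<ge> 1" and J: "J \<ge> 1" and h: "h > 0" and hJ: "h \<le> J * cheeger n G"
    and "admissible I" and I: "\<And>l. I = Polynomial l \<Longrightarrow> l < real (graph_diam n G)"
    and \<Gamma>: "\<Gamma>l \<le> 0 \<or> (\<forall>A\<subseteq>V. card A = n div 2 \<longrightarrow> \<Gamma>l \<le> 2 * (real (card (crossing A k)) * coupling I r J k))"
    and k: "k \<noteq> 1" and \<epsilon>: "\<epsilon> > 0"
    and \<eta>: "\<eta> \<in> insert (all_minus n) (metastable_states n (hamiltonian I r J h n G))"
    and \<Gamma>u: "\<Gamma>u = J * (real r * f_bound I r (graph_diam n G)) * real n"
  shows "((\<lambda>\<beta>. measure (metropolis_law n (hamiltonian I r J h n G) \<beta> \<eta>)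
      {w \<in> space (metropolis_law n (hamiltonian I r J h n G) \<beta> \<eta>).
         ereal (exp (\<beta> * (\<Gamma>l - \<epsilon>))) < ereal_of_enat (hitting_time (all_plus n) w) \<and>
         ereal_of_enat (hitting_time (all_plus n) w) < ereal (exp (\<beta> * (\<Gamma>u + \<epsilon>)))}) \<longlongrightarrow> 1) at_top"
proof -
  let ?c = "\<lambda>x y. coupling I r J (dist x y)"
  have r0: "r > 0" and J0: "J \<ge> 0" using r J by auto
  interpret pair: pair_interaction n ?c h
    by unfold_locales (use n h graph_dist_sym[of G] coupling_nonneg[OF J0] in auto)
  have H: "hamiltonian I r J h n G = pair_energy ?c h n" by (rule hamiltonian_eq_pair_energy)
  \<comment> \<open>K = {} shows that no configuration with at most half plus spins lies below -1; K
    the full set of crossing pairs gives the height of the barrier.\<close>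
  have diff: "pair_energy ?c h n s - pair_energy ?c h n (all_minus n) \<ge> 2 * (real (card K) * coupling I r J k)"
    if "s \<in> configs n" "2 * card (plus_set n s) \<le> n" "K \<subseteq> crossing (plus_set n s) k" for s K
    using crossing_energy_ge[OF r0 J0 hJ plus_set_subset that(2,3) k, of I] pair.energy_diff_minus[OF that(1)]
    by (simp add: case_prod_unfold)
  have "ereal \<Gamma>l \<le> stability_level n (pair_energy ?c h n) (all_minus n)"
  proof (rule pair.stability_all_minus_ge)
    fix s assume s: "s \<in> configs n" "2 * card (plus_set n s) \<le> n"
    show "pair_energy ?c h n (all_minus n) \<le> pair_energy ?c h n s" using diff[OF s, of "{}"] by simp
  next
    fix s assume s: "s \<in> configs n" "card (plus_set n s) = n div 2"
    then have le: "2 * card (plus_set n s) \<le> n" by simp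
    show "\<Gamma>l \<le> pair_energy ?c h n s - pair_energy ?c h n (all_minus n)"
      using \<Gamma>
    proof
      assume "\<Gamma>l \<le> 0"
      then show ?thesis using diff[OF s(1) le, of "{}"] by simp
    next
      assume "\<forall>A\<subseteq>V. card A = n div 2 \<longrightarrow> \<Gamma>l \<le> 2 * (real (card (crossing A k)) * coupling I r J k)"
      then have "\<Gamma>l \<le> 2 * (real (card (crossing (plus_set n s) k)) * coupling I r J k)"
        using s(2) plus_set_subset by blast
      then show ?thesis using diff[OF s(1) le order.refl] by linarith
    qed
  qed
  note barrier = pair.barrier_from_metastable[OF this \<eta>[unfolded H]]
  show ?thesis
    unfolding H
  proof (rule hitting_time_tendsto[OF barrier(1,2) n \<epsilon>])
    fix p assume "is_path n \<eta> (all_plus n) p"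
    then show "\<exists>x\<in>set p. pair_energy ?c h n x \<ge> pair_energy ?c h n \<eta> + \<Gamma>l" by (rule barrier(3))
  next
    fix u x assume "u \<in> configs n" "x \<in> V" "u x = -1"
    then show "max 0 (pair_energy ?c h n (u(x := 1)) - pair_energy ?c h n u) \<le>
        pair.pair_potential {y \<in> V. u y = -1} - pair.pair_potential ({y \<in> V. u y = -1} - {x})"
      by (rule pair.flip_energy_le)
  next
    fix M assume "M \<subseteq> V"
    then have "pair.pair_potential M - pair.pair_potential {} \<le> real n * (J * (real r * f_bound I r (graph_diam n G)))"
      using row_sum_le[OF r J0 _ \<open>admissible I\<close> I] by (intro pair.pair_potential_le) auto
    then show "pair.pair_potential M - pair.pair_potential {} \<le> \<Gamma>u" by (simp add: \<Gamma>u mult_ac)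
  qed
qed

text \<open>Here u is r^(-1/4) and s about sqrt(r). From r u^4 = 1 and s u^2 \<le> 2 follows 24 s
  \<le> 48 u (u r), so \<epsilon> = 48 u is admissible; \<gamma> is u, and the thresholds are (1/2 -
  u) r and (1 - 49 u) r. The parent lost on each level is absorbed by u r \<ge> 1, the rounding of n
  / 2 by u n \<ge> 1.\<close>

lemma (in connected_regular) crossing_ge:
  fixes u :: real
  assumes cuts: "uniform_cuts n r s G" and u: "0 < u" "u < 1 / 200" and ru: "real r * u ^ 4 = 1"
    and s: "real s * u\<^sup>2 \<le> 2" and n: "1 \<le> u * real n"
    and tree: "real (card {x \<in> V. \<not> treelike n G (Suc k) x}) \<le> u * real n"
    and A: "A \<subseteq> V" "card A = n div 2"
  shows "(1 / 2 - 50 * u) * real n * ((1 / 2 - 2 * u) * real r * ((1 - 50 * u) * real r) ^ k)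
    \<le> real (card (crossing A (Suc k)))"
proof -
  have r0: "real r > 0" using ru u by (cases "r = 0") auto
  have n0: "n > 0" using n u by (cases "n = 0") auto
  have "u ^ 3 \<le> 1" using u by (intro power_le_one) auto
  then have "(real r * u) * u ^ 3 \<le> (real r * u) * 1" using u r0 by (intro mult_left_mono) auto
  then have ur: "1 \<le> u * real r" using ru by (simp add: power_eq_if mult_ac)
  have c0: "(1 / 2 - u) * real r - 1 \<ge> (1 / 2 - 2 * u) * real r"
    and c1: "(1 - 48 * u - u) * real r - 1 \<ge> (1 - 50 * u) * real r"
    using ur by (simp_all add: algebra_simps)
  have p: "(1 / 2 - 2 * u) * real r \<ge> 0" "(1 - 50 * u) * real r \<ge> 0" using u r0 by simp_all
  have "real n - 1 \<le> 2 * real (n div 2)"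
    by linarith
  then have half: "real (n div 2) - 48 * u * real n - u * real n \<ge> (1 / 2 - 50 * u) * real n"
    using n by (simp add: algebra_simps)
  have "(1 / 2 - 50 * u) * real n \<ge> 0" using u by simp
  then have half0: "real (n div 2) - 48 * u * real n - u * real n \<ge> 0" using half by (rule order.trans)
  have "(real s * u\<^sup>2) * (24 * real r * u\<^sup>2) \<le> 2 * (24 * real r * u\<^sup>2)" using s by (rule mult_right_mono) simp
  moreover have "(real s * u\<^sup>2) * (24 * real r * u\<^sup>2) = 24 * real s * (real r * u ^ 4)"
    by (simp add: power_eq_if mult_ac)
  ultimately have "24 * real s * (real r * u ^ 4) \<le> 2 * (24 * real r * u\<^sup>2)" by linarith
  then have \<epsilon>: "24 * real s \<le> 48 * u * (u * real r)"
    unfolding ru by (simp add: power2_eq_square mult_ac)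
  have "(1 / 2 - 50 * u) * real n * ((1 / 2 - 2 * u) * real r * ((1 - 50 * u) * real r) ^ k) \<le>
    (real (n div 2) - 48 * u * real n - u * real n) *
      (((1 / 2 - u) * real r - 1) * ((1 - 48 * u - u) * real r - 1) ^ k)"
    by (rule mult_mono[OF half mult_mono[OF c0 power_mono[OF c1 p(2)]]])
      (use order.trans[OF p(1) c0] half0 p u in \<open>auto intro!: mult_nonneg_nonneg zero_le_power\<close>)
  also have "\<dots> \<le> real (card (crossing A (Suc k)))"
    by (rule card_crossing_ge[OF cuts n0 u(1) _ \<epsilon> tree A]) (use p c0 c1 r0 in auto)
  finally show ?thesis .
qed

text \<open>Base 2, because a tree level will grow by at least (1 - 50 u) r \<ge> 9/4. The constant
  4 offsets two factors 1/4 and a factor 2, leaving the required 1/2.\<close>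

lemma ex_exp_ge_powr: "\<exists>k\<ge>1. 4 \<le> 2 ^ k * real (Suc k) powr (- l)"
proof -
  have "filterlim (\<lambda>k. 2 ^ k * real (Suc k) powr (- l)) at_top sequentially" by real_asymp
  then have "eventually (\<lambda>k. 4 \<le> 2 ^ k * real (Suc k) powr (- l)) sequentially"
    by (simp add: filterlim_at_top)
  then have "eventually (\<lambda>k. 4 \<le> 2 ^ k * real (Suc k) powr (- l) \<and> k \<ge> 1) sequentially"
    using eventually_ge_at_top by (rule eventually_conj)
  then show ?thesis by (auto simp: eventually_sequentially)
qed

text \<open>The exponential interaction reaches the barrier through pairs at distance two alone; the polynomial
  one needs a distance at which the exponential growth of the spheres beats the decay of the coupling.\<close>

lemma crossing_energy_threshold:
  assumes r: "r \<ge> 3"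
  obtains k s :: nat and \<gamma> :: real where "k \<ge> 1" "s \<ge> 1" "r \<le> s\<^sup>2" "\<gamma> > 0"
    "\<forall>n G J. 1 \<le> \<gamma> * real n \<longrightarrow> connected_regular n r G \<longrightarrow> uniform_cuts n r s G \<longrightarrow>
      real (card {x \<in> vertices n. \<not> treelike n G (Suc k) x}) \<le> \<gamma> * real n \<longrightarrow> J \<ge> 0 \<longrightarrow>
      J * (real r / 2 - 100 * real r powr (3 / 4)) * real n \<le> 0 \<or>
      (\<forall>A\<subseteq>vertices n. card A = n div 2 \<longrightarrow>
        J * (real r / 2 - 100 * real r powr (3 / 4)) * real n \<le>
          2 * (real (card (connected_regular.crossing n G A (Suc k))) * coupling I r J (Suc k)))"
proof -
  define u where "u = real r powr (- 1 / 4)"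
  define s where "s = nat \<lceil>sqrt (real r)\<rceil>"
  have r0: "real r > 0" and u0: "u > 0" using r by (auto simp: u_def)
  have u2: "u\<^sup>2 = real r powr (- 1 / 2)"
    using powr_add[of "real r" "- 1 / 4" "- 1 / 4"] by (simp add: u_def power2_eq_square)
  have "u ^ 4 = u\<^sup>2 * u\<^sup>2" by (simp add: power_eq_if)
  then have u4: "u ^ 4 = real r powr (- 1)"
    using powr_add[of "real r" "- 1 / 2" "- 1 / 2"] by (simp add: u2)
  have ru: "real r * u ^ 4 = 1" using r0 by (simp add: u4 powr_minus)
  have w: "real r powr (3 / 4) = real r * u"
    using r0 powr_add[of "real r" 1 "- 1 / 4"] by (simp add: u_def)
  have sq1: "sqrt (real r) \<ge> 1" using r by simp
  have s_ge: "sqrt (real r) \<le> real s" and s_le: "real s \<le> sqrt (real r) + 1"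
    unfolding s_def using sq1 by linarith+
  have s1: "s \<ge> 1" using s_ge sq1 by linarith
  have "(sqrt (real r))\<^sup>2 \<le> (real s)\<^sup>2" using s_ge by (intro power_mono) auto
  then have "real r \<le> real (s\<^sup>2)" using r0 by simp
  then have rs: "r \<le> s\<^sup>2" by (simp only: of_nat_le_iff)
  have "sqrt (real r) * u\<^sup>2 = 1"
    unfolding u2 using r0 by (simp add: powr_half_sqrt[symmetric] flip: powr_add)
  moreover have "real s \<le> 2 * sqrt (real r)" using s_le sq1 by linarith
  then have "real s * u\<^sup>2 \<le> (2 * sqrt (real r)) * u\<^sup>2" by (rule mult_right_mono) simp
  ultimately have su: "real s * u\<^sup>2 \<le> 2" by simp
  \<comment> \<open>The pairs used are at distance k + 1, so k = 1 means distance two.\<close>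
  define k where "k = (case I of Exponential \<Rightarrow> 1 | Polynomial l \<Rightarrow> SOME k. k \<ge> 1 \<and> 4 \<le> 2 ^ k * real (Suc k) powr (- l))"
  have kP: "k \<ge> 1 \<and> 4 \<le> 2 ^ k * real (Suc k) powr (- l)" if "I = Polynomial l" for l
    unfolding k_def that interaction.case by (rule someI_ex[OF ex_exp_ge_powr])
  have k1: "k \<ge> 1"
  proof (cases I)
    case Exponential
    then show ?thesis by (simp add: k_def)
  qed (use kP in blast)
  let ?\<Gamma> = "\<lambda>J n. J * (real r / 2 - 100 * real r powr (3 / 4)) * real n"
  have "?\<Gamma> J n \<le> 0 \<or> (\<forall>A\<subseteq>vertices n. card A = n div 2 \<longrightarrow>
      ?\<Gamma> J n \<le> 2 * (real (card (connected_regular.crossing n G A (Suc k))) * coupling I r J (Suc k)))"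
    if n: "1 \<le> u * real n" and G: "connected_regular n r G" and cuts: "uniform_cuts n r s G"
      and tree: "real (card {x \<in> vertices n. \<not> treelike n G (Suc k) x}) \<le> u * real n" and J: "J \<ge> 0"
    for n G J
  \<comment> \<open>From u = 1/200 on, the lower exponent J r (1/2 - 100 u) n is not positive. Below
    that value the factors 1/2 - 50 u and 1/2 - 2 u exceed 1/4, and 1 - 50 u exceeds 3/4.\<close>
  proof (cases "u < 1 / 200")
    case False
    then have "real r * (1 / 200) \<le> real r * u" using r0 by (intro mult_left_mono) auto
    then have "real r / 2 - 100 * real r powr (3 / 4) \<le> 0" unfolding w by simp
    then have "?\<Gamma> J n \<le> 0" using J by (intro mult_nonpos_nonneg mult_nonneg_nonpos) auto
    then show ?thesis by simp
  next
    case True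
    interpret connected_regular n r G by (rule G)
    have "?\<Gamma> J n \<le> 2 * (real (card (crossing A (Suc k))) * coupling I r J (Suc k))"
      if A: "A \<subseteq> V" "card A = n div 2" for A
    proof -
      let ?N = "(1 / 2 - 50 * u) * real n * ((1 / 2 - 2 * u) * real r * ((1 - 50 * u) * real r) ^ k)"
      have cJ: "coupling I r J (Suc k) \<ge> 0" by (rule coupling_nonneg[OF J])
      have N: "?N \<le> real (card (crossing A (Suc k)))"
        by (rule crossing_ge[OF cuts u0 True ru su n tree A])
      have "?\<Gamma> J n \<le> 2 * (?N * coupling I r J (Suc k))"
      proof (cases I)
        case Exponential
        then have k: "k = 1" by (simp add: k_def)
        have c: "coupling I r J (Suc k) = J / real r"
          using r0 by (simp add: Exponential k powr_minus divide_inverse)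
        \<comment> \<open>The linear losses of the product amount to 77 u.\<close>
        have "1 / 2 - 100 * u \<le> 2 * (1 / 2 - 50 * u) * (1 / 2 - 2 * u) * (1 - 50 * u)"
        proof -
          have "2 * (1 / 2 - 50 * u) * (1 / 2 - 2 * u) = 1 / 2 - 52 * u + 200 * u\<^sup>2"
            by (simp add: algebra_simps power2_eq_square)
          moreover have "(1 / 2 - 52 * u + 200 * u\<^sup>2) * (1 - 50 * u) =
              1 / 2 - 100 * u + 23 * u + 2600 * u\<^sup>2 + 200 * u\<^sup>2 * (1 - 50 * u)"
            by (simp add: algebra_simps power2_eq_square)
          moreover have "200 * u\<^sup>2 * (1 - 50 * u) \<ge> 0" using True by (intro mult_nonneg_nonneg) auto
          ultimately show ?thesis using u0 zero_le_power2[of u] by simp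
        qed
        then have "(J * real r * real n) * (1 / 2 - 100 * u) \<le>
            (J * real r * real n) * (2 * (1 / 2 - 50 * u) * (1 / 2 - 2 * u) * (1 - 50 * u))"
          using J by (intro mult_left_mono) auto
        moreover have "?\<Gamma> J n = (J * real r * real n) * (1 / 2 - 100 * u)"
          unfolding w by (simp add: algebra_simps)
        moreover have "2 * (?N * coupling I r J (Suc k)) =
            (J * real r * real n) * (2 * (1 / 2 - 50 * u) * (1 / 2 - 2 * u) * (1 - 50 * u))"
          unfolding c unfolding k using r0 by simp
        ultimately show ?thesis by linarith
      next
        case (Polynomial l)
        define z where "z = real (Suc k) powr (- l)"
        have z0: "z \<ge> 0" by (simp add: z_def)
        have c: "coupling I r J (Suc k) = J * z" by (simp add: Polynomial z_def)
        have z: "4 \<le> 2 ^ k * z" using kP[OF Polynomial] by (simp add: z_def)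
        have "3 / 4 * 3 \<le> (1 - 50 * u) * real r" using True r by (intro mult_mono) auto
        then have "2 ^ k \<le> ((1 - 50 * u) * real r) ^ k" by (intro power_mono) auto
        then have "1 / 4 * real n * (1 / 4 * real r * 2 ^ k) \<le> ?N"
          using True r0 by (intro mult_mono mult_right_mono) auto
        then have "1 / 4 * real n * (1 / 4 * real r * 2 ^ k) * (J * z) \<le> ?N * (J * z)"
          using J z0 by (intro mult_right_mono) auto
        moreover have "(real n * real r * J) * 4 \<le> (real n * real r * J) * (2 ^ k * z)"
          using z J by (intro mult_left_mono) auto
        moreover have "?\<Gamma> J n \<le> real n * real r * J / 2"
          using mult_nonneg_nonneg[of "J * (real r * u)" "real n"] J r0 u0 unfolding w by (simp add: algebra_simps)
        moreover have "1 / 4 * real n * (1 / 4 * real r * 2 ^ k) * (J * z) =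
            (real n * real r * J) * (2 ^ k * z) / 16"
          by simp
        moreover have "a \<le> 2 * q" if "p \<le> q" "x * 4 \<le> y" "a \<le> x / 2" "p = y / 16" for a p q x y :: real
          using that by simp
        ultimately show ?thesis unfolding c by blast
      qed
      also have "\<dots> \<le> 2 * (real (card (crossing A (Suc k))) * coupling I r J (Suc k))"
        using N cJ by (intro mult_left_mono mult_right_mono) auto
      finally show ?thesis .
    qed
    then show ?thesis by blast
  qed
  then show ?thesis using that[OF k1 s1 rs u0] by blast
qed

section \<open>The random graph with high probability\<close>

theorem theorem2p8:
  shows "\<exists>\<omega>l \<omega>u :: nat \<Rightarrow> real.
    \<omega>l \<in> o(\<lambda>r. real r) \<and> \<omega>u \<in> o(\<lambda>r. real r) \<and>
    (\<forall>(r::nat) (I::interaction). r \<ge> 3 \<longrightarrow> admissible I \<longrightarrow>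
      ((\<lambda>n::nat. measure_pmf.prob (random_regular_graph n r)
         {G. \<forall>J h :: real.
            h > 0 \<and>
            int n > max \<lceil>real r ^ r\<rceil> \<lceil>(real r)\<^sup>2 * J / h\<rceil> \<and>
            cheeger n G > 0 \<and>
            J \<ge> max 1 (of_int \<lceil>h / cheeger n G\<rceil>) \<longrightarrow>
            (let H = hamiltonian I r J h n G;
                 \<Gamma>l = J * (real r / 2 - \<omega>l r) * real n;
                 \<Gamma>u = J * (real r * f_bound I r (graph_diam n G) + \<omega>u r) * real n
             in \<forall>\<epsilon>>0. \<forall>\<eta> \<in> insert (all_minus n) (metastable_states n H).
                  ((\<lambda>\<beta>. measure (metropolis_law n H \<beta> \<eta>)
                     {w \<in> space (metropolis_law n H \<beta> \<eta>).
                        ereal (exp (\<beta> * (\<Gamma>l - \<epsilon>))) < ereal_of_enat (hitting_time (all_plus n) w) \<and>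
                        ereal_of_enat (hitting_time (all_plus n) w) < ereal (exp (\<beta> * (\<Gamma>u + \<epsilon>)))})
                   \<longlongrightarrow> 1) at_top)})
       \<longlongrightarrow> 1) (inf sequentially (principal {n. n > r \<and> even (n * r)})))"
proof (rule exI[of _ "\<lambda>r. 100 * real r powr (3 / 4)"], rule exI[of _ "\<lambda>_. 0"], intro conjI allI impI)
  show "(\<lambda>r::nat. 100 * real r powr (3 / 4)) \<in> o(\<lambda>r. real r)" by real_asymp
  show "(\<lambda>_. 0) \<in> o(\<lambda>r::nat. real r)" by simp
next
  fix r :: nat and I :: interaction
  assume r: "r \<ge> 3" and I: "admissible I"
  let ?F = "inf sequentially (principal {n. n > r \<and> even (n * r)})"
  let ?concl = "\<lambda>n G. \<forall>J h :: real.
            h > 0 \<and>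
            int n > max \<lceil>real r ^ r\<rceil> \<lceil>(real r)\<^sup>2 * J / h\<rceil> \<and>
            cheeger n G > 0 \<and>
            J \<ge> max 1 (of_int \<lceil>h / cheeger n G\<rceil>) \<longrightarrow>
            (let H = hamiltonian I r J h n G;
                 \<Gamma>l = J * (real r / 2 - 100 * real r powr (3 / 4)) * real n;
                 \<Gamma>u = J * (real r * f_bound I r (graph_diam n G) + 0) * real n
             in \<forall>\<epsilon>>0. \<forall>\<eta> \<in> insert (all_minus n) (metastable_states n H).
                  ((\<lambda>\<beta>. measure (metropolis_law n H \<beta> \<eta>)
                     {w \<in> space (metropolis_law n H \<beta> \<eta>).
                        ereal (exp (\<beta> * (\<Gamma>l - \<epsilon>))) < ereal_of_enat (hitting_time (all_plus n) w) \<and>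
                        ereal_of_enat (hitting_time (all_plus n) w) < ereal (exp (\<beta> * (\<Gamma>u + \<epsilon>)))})
                   \<longlongrightarrow> 1) at_top)"
  obtain k s :: nat and \<gamma> :: real where k: "k \<ge> 1" and s: "s \<ge> 1" "r \<le> s\<^sup>2" and \<gamma>: "\<gamma> > 0" and thr:
    "\<forall>n G J. 1 \<le> \<gamma> * real n \<longrightarrow> connected_regular n r G \<longrightarrow> uniform_cuts n r s G \<longrightarrow>
      real (card {x \<in> vertices n. \<not> treelike n G (Suc k) x}) \<le> \<gamma> * real n \<longrightarrow> J \<ge> 0 \<longrightarrow>
      J * (real r / 2 - 100 * real r powr (3 / 4)) * real n \<le> 0 \<or>
      (\<forall>A\<subseteq>vertices n. card A = n div 2 \<longrightarrow>
        J * (real r / 2 - 100 * real r powr (3 / 4)) * real n \<le>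
          2 * (real (card (connected_regular.crossing n G A (Suc k))) * coupling I r J (Suc k)))"
    by (rule crossing_energy_threshold[OF r, where I = I])
  note thr = thr[rule_format]
  \<comment> \<open>Once n exceeds r^(L + 1), the Moore bound pushes the diameter above
    \<lambda>.\<close>
  define L where "L = (case I of Exponential \<Rightarrow> 0 | Polynomial l \<Rightarrow> nat \<lceil>l\<rceil>)"
  define C where "C = (\<Sum>i\<le>Suc k. \<Sum>j\<le>Suc k. 2 * real r ^ (i + j + 1))"
  define \<delta> where "\<delta> n = 2 * (2 / 9) ^ n + C / (\<gamma> * real n)" for n :: nat
  \<comment> \<open>The conditions on G mention neither J nor h, so one good graph serves all of
    them at once.\<close>
  have good: "?concl n G"
    if n: "n \<ge> 1" "1 \<le> \<gamma> * real n" "r ^ Suc L < n" and G: "G \<in> regular_graphs n r"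
      and cuts: "uniform_cuts n r s G"
      and tree: "real (card {x \<in> vertices n. \<not> treelike n G (Suc k) x}) \<le> \<gamma> * real n" for n G
  proof (intro allI impI)
    fix J h :: real
    assume *: "h > 0 \<and> int n > max \<lceil>real r ^ r\<rceil> \<lceil>(real r)\<^sup>2 * J / h\<rceil> \<and> cheeger n G > 0 \<and>
      J \<ge> max 1 (of_int \<lceil>h / cheeger n G\<rceil>)"
    interpret connected_regular n r G
      using G * by unfold_locales (auto intro: connected_graph_if_cheeger_pos)
    have J: "J \<ge> 1" and h: "h > 0" using * by auto
    have "h / cheeger n G \<le> J" using * le_of_int_ceiling[of "h / cheeger n G"] by linarith
    then have hJ: "h \<le> J * cheeger n G" using * by (simp add: field_simps)
    have diam: "l < real (graph_diam n G)" if "I = Polynomial l" for l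
    proof (rule ccontr)
      assume "\<not> l < real (graph_diam n G)"
      then have "graph_diam n G \<le> L" using that by (simp add: L_def) linarith
      then have "r ^ Suc (graph_diam n G) \<le> r ^ Suc L" using r by (intro power_increasing) auto
      then show False using card_vertices_le_power_diam r n by linarith
    qed
    show "let H = hamiltonian I r J h n G;
                 \<Gamma>l = J * (real r / 2 - 100 * real r powr (3 / 4)) * real n;
                 \<Gamma>u = J * (real r * f_bound I r (graph_diam n G) + 0) * real n
             in \<forall>\<epsilon>>0. \<forall>\<eta> \<in> insert (all_minus n) (metastable_states n H).
                  ((\<lambda>\<beta>. measure (metropolis_law n H \<beta> \<eta>)
                     {w \<in> space (metropolis_law n H \<beta> \<eta>).
                        ereal (exp (\<beta> * (\<Gamma>l - \<epsilon>))) < ereal_of_enat (hitting_time (all_plus n) w) \<and>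
                        ereal_of_enat (hitting_time (all_plus n) w) < ereal (exp (\<beta> * (\<Gamma>u + \<epsilon>)))})
                   \<longlongrightarrow> 1) at_top"
      unfolding Let_def
    proof (intro allI impI ballI)
      fix \<epsilon> :: real and \<eta>
      assume "\<epsilon> > 0" and \<eta>: "\<eta> \<in> insert (all_minus n) (metastable_states n (hamiltonian I r J h n G))"
      show "((\<lambda>\<beta>. measure (metropolis_law n (hamiltonian I r J h n G) \<beta> \<eta>)
          {w \<in> space (metropolis_law n (hamiltonian I r J h n G) \<beta> \<eta>).
            ereal (exp (\<beta> * (J * (real r / 2 - 100 * real r powr (3 / 4)) * real n - \<epsilon>)))
              < ereal_of_enat (hitting_time (all_plus n) w) \<and>
            ereal_of_enat (hitting_time (all_plus n) w) <
              ereal (exp (\<beta> * (J * (real r * f_bound I r (graph_diam n G) + 0) * real n + \<epsilon>)))}) \<longlongrightarrow> 1) at_top"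
        by (rule hitting_time_tendsto_if_crossing[OF r n(1) J h hJ I diam
              thr[OF n(2) connected_regular_axioms cuts tree] _ \<open>\<epsilon> > 0\<close> \<eta>])
          (use J k in auto)
    qed
  qed
  have lower: "1 - \<delta> n \<le> measure_pmf.prob (random_regular_graph n r) {G. ?concl n G}"
    if n: "n \<ge> 1" "1 \<le> \<gamma> * real n" "r ^ Suc L < n" "r\<^sup>2 \<le> n"
      "2 * (2 * (2 * Suc k + 2) + 2 * (r * (r + 2))) \<le> r * n" "n > r" "even (n * r)" for n
  proof -
    let ?R = "regular_graphs n r"
    let ?B1 = "{G \<in> ?R. \<not> uniform_cuts n r s G}"
    let ?B2 = "{G \<in> ?R. real (card {x \<in> vertices n. \<not> treelike n G (Suc k) x}) > \<gamma> * real n}"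
    have ne: "?R \<noteq> {}" by (rule regular_graphs_nonempty) fact+
    then have pos: "real (card ?R) > 0" by (simp add: card_gt_0_iff)
    have sub: "?R \<subseteq> (?R \<inter> {G. ?concl n G}) \<union> (?B1 \<union> ?B2)"
    proof
      fix G assume G: "G \<in> ?R"
      show "G \<in> (?R \<inter> {G. ?concl n G}) \<union> (?B1 \<union> ?B2)"
      proof (cases "G \<in> ?B1 \<union> ?B2")
        case False
        then have "?concl n G" using G by (intro good[OF n(1,2,3) G]) auto
        then show ?thesis using G by blast
      qed simp
    qed
    have "card ?R \<le> card ((?R \<inter> {G. ?concl n G}) \<union> (?B1 \<union> ?B2))"
      by (rule card_mono[OF _ sub]) simp
    also have "\<dots> \<le> card (?R \<inter> {G. ?concl n G}) + (card ?B1 + card ?B2)"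
      by (rule order.trans[OF card_Un_le add_left_mono[OF card_Un_le]])
    finally have "real (card ?R) \<le> real (card (?R \<inter> {G. ?concl n G})) + (real (card ?B1) + real (card ?B2))"
      by (simp only: of_nat_add[symmetric] of_nat_le_iff)
    also have "\<dots> \<le> real (card (?R \<inter> {G. ?concl n G})) +
        (real (card ?R) * (2 * (2 / 9) ^ n) + real (card ?R) * (C / (\<gamma> * real n)))"
      unfolding C_def
      by (intro add_left_mono add_mono card_not_uniform_cuts card_many_not_treelike r s n \<gamma>)
    finally have "real (card ?R) * (1 - \<delta> n) \<le> real (card (?R \<inter> {G. ?concl n G}))"
      by (simp add: \<delta>_def algebra_simps)
    then have "1 - \<delta> n \<le> real (card (?R \<inter> {G. ?concl n G})) / real (card ?R)"
      using pos by (subst pos_le_divide_eq) (simp_all add: mult.commute)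
    also have "\<dots> = measure_pmf.prob (random_regular_graph n r) {G. ?concl n G}"
      unfolding random_regular_graph_def by (rule measure_pmf_of_set[symmetric, OF ne finite_regular_graphs])
    finally show ?thesis .
  qed
  have "(\<delta> \<longlongrightarrow> 0) sequentially"
    unfolding \<delta>_def using \<gamma> by real_asymp
  then have "((\<lambda>n. 1 - \<delta> n) \<longlongrightarrow> 1 - 0) ?F"
    by (intro tendsto_diff tendsto_const tendsto_mono[OF inf_le1])
  then have lim: "((\<lambda>n. 1 - \<delta> n) \<longlongrightarrow> 1) ?F" by simp
  have ev: "eventually (\<lambda>n. n \<ge> 1 \<and> 1 \<le> \<gamma> * real n \<and> r ^ Suc L < n \<and> r\<^sup>2 \<le> n \<and>
      2 * (2 * (2 * Suc k + 2) + 2 * (r * (r + 2))) \<le> r * n) sequentially"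
  proof (intro eventually_conj)
    show "eventually (\<lambda>n. 1 \<le> \<gamma> * real n) sequentially" using \<gamma> by real_asymp
    have "2 * (2 * (2 * Suc k + 2) + 2 * (r * (r + 2))) \<le> r * n"
      if "n \<ge> 2 * (2 * (2 * Suc k + 2) + 2 * (r * (r + 2)))" for n
      using order.trans[OF that] r by simp
    then show "eventually (\<lambda>n. 2 * (2 * (2 * Suc k + 2) + 2 * (r * (r + 2))) \<le> r * n) sequentially"
      by (rule eventually_sequentiallyI)
  qed (rule eventually_ge_at_top eventually_gt_at_top)+
  show "((\<lambda>n. measure_pmf.prob (random_regular_graph n r) {G. ?concl n G}) \<longlongrightarrow> 1) ?F"
  proof (rule tendsto_sandwich[OF _ _ lim tendsto_const])
    show "eventually (\<lambda>n. 1 - \<delta> n \<le> measure_pmf.prob (random_regular_graph n r) {G. ?concl n G}) ?F"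
      unfolding eventually_inf_principal using ev by eventually_elim (use lower in blast)
    show "eventually (\<lambda>n. measure_pmf.prob (random_regular_graph n r) {G. ?concl n G} \<le> 1) ?F"
      by (intro always_eventually allI measure_pmf.prob_le_1)
  qed
qed

end
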